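(* For a positive integer $E$, let $\mathcal N=\mathcal N(E)=\#\{\lambda\in\mathbb Z^d:|\lambda|^2=E\}$ and let $f$ be the random Gaussian Laplace eigenfunction with eigenvalue $4\pi^2E$ on $\mathbb T^d=\mathbb R^d/\mathbb Z^d$ (defined in the context), with Leray nodal measure $\mathcal L(f)$. Consider only those $E$ with $\mathcal N(E)>3^d$. (i) If $d=2$, then $\operatorname{Var}(\mathcal L(f))=\frac1{4\pi\mathcal N}+O\bigl(\frac1{\mathcal N^2}\bigr)$, with an absolute implied constant. (ii) If $d\ge3$, then for every $\epsilon>0$, $\operatorname{Var}(\mathcal L(f))=\frac1{4\pi\mathcal N}+O\Bigl(\frac{E^{\frac{d-3}2+\epsilon}}{\mathcal N^2}\Bigr)$, with implied constant depending only on $d$ and $\epsilon$. (iii) For every $d\ge2$, $\operatorname{Var}(\mathcal L(f))=O\bigl(\frac1{\mathcal N}\bigr)$, with implied constant depending only on $d$.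
   Context: $\mathbb T^d=\mathbb R^d/\mathbb Z^d$ carries Lebesgue (probability) measure $\operatorname{meas}$. Let $\Lambda=\{\lambda\in\mathbb Z^d:|\lambda|^2=E\}$ with $E\ge1$ and $\mathcal N=\#\Lambda$, and let $\Lambda/\pm$ be a set of representatives of $\Lambda$ modulo $\lambda\mapsto-\lambda$. The random eigenfunction is $$f(x)=\sqrt{\tfrac{2}{\mathcal N}}\sum_{\lambda\in\Lambda/\pm}\bigl(b_\lambda\cos 2\pi\langle\lambda,x\rangle-c_\lambda\sin2\pi\langle\lambda,x\rangle\bigr),$$ where $b_\lambda,c_\lambda$ ($\lambda\in\Lambda/\pm$) are independent standard real Gaussians $N(0,1)$. The Leray measure of the nodal set of $f$ is $$\mathcal L(f)=\lim_{\epsilon\to0^+}\frac1{2\epsilon}\operatorname{meas}\{x\in\mathbb T^d:|f(x)|<\epsilon\},$$ which is defined whenever there is no $x$ with $f(x)=0$ and $\nabla f(x)=0$; this is the case for almost every $f$. The variance is with respect to the Gaussian randomness of $f$. *)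

theory Defs
  imports "HOL-Probability.Probability"
begin

text \<open>The dimension \<open>d\<close> is \<open>CARD('n)\<close>; \<open>\<int>\<^sup>d\<close> is the set of vectors of
  \<open>real ^ 'n\<close> with integer components.\<close>

definition frequencies :: "nat \<Rightarrow> (real ^ 'n) set" where
  "frequencies E = {k. (\<forall>i. k $ i \<in> \<int>) \<and> (norm k)\<^sup>2 = real E}"

definition half_system :: "(real ^ 'n) set \<Rightarrow> (real ^ 'n) set \<Rightarrow> bool" where
  "half_system \<Lambda> R \<longleftrightarrow> R \<subseteq> \<Lambda> \<and> (\<forall>k\<in>\<Lambda>. \<exists>!l. l \<in> R \<and> (l = k \<or> l = - k))"

text \<open>The random coefficients \<open>(b, c)\<close> are the coordinates of the standard Gaussian
  product space indexed by two copies of the set \<open>R\<close> of representatives.\<close>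

definition coeff_space ::
  "(real ^ 'n) set \<Rightarrow> ((real ^ 'n \<Rightarrow> real) \<times> (real ^ 'n \<Rightarrow> real)) measure" where
  "coeff_space R =
     (\<Pi>\<^sub>M k\<in>R. density lborel std_normal_density) \<Otimes>\<^sub>M
     (\<Pi>\<^sub>M k\<in>R. density lborel std_normal_density)"

definition eigenfunction ::
  "nat \<Rightarrow> (real ^ 'n) set \<Rightarrow> (real ^ 'n \<Rightarrow> real) \<times> (real ^ 'n \<Rightarrow> real) \<Rightarrow> real ^ 'n \<Rightarrow> real" where
  "eigenfunction E R = (\<lambda>(b, c) x.
     sqrt (2 / real (card (frequencies E :: (real ^ 'n) set))) *
     (\<Sum>k\<in>R. b k * cos (2 * pi * (k \<bullet> x)) - c k * sin (2 * pi * (k \<bullet> x))))"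

text \<open>Functions on the torus are \<open>\<int>\<^sup>d\<close>-periodic functions on \<open>real ^ 'n\<close>, and the
  measure of a subset of the torus is computed on the half-open unit cube.\<close>

definition fundamental_cube :: "(real ^ 'n) set" where
  "fundamental_cube = {x. \<forall>i. 0 \<le> x $ i \<and> x $ i < 1}"

text \<open>If the limit does not exist, the value is an irrelevant constant.\<close>

definition leray_measure :: "(real ^ 'n \<Rightarrow> real) \<Rightarrow> real" where
  "leray_measure f =
     Lim (at_right 0)
       (\<lambda>\<epsilon>. 1 / (2 * \<epsilon>) * measure lborel {x \<in> fundamental_cube. \<bar>f x\<bar> < \<epsilon>})"

text \<open>The Bochner integral of a non-integrable function is 0, so a statement that a variance
  has a given value is meaningful only together with square-integrability.\<close>

definition has_variance :: "'a measure \<Rightarrow> ('a \<Rightarrow> real) \<Rightarrow> real \<Rightarrow> bool" where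
  "has_variance M X v \<longleftrightarrow>
     integrable M X \<and> integrable M (\<lambda>\<omega>. (X \<omega>)\<^sup>2) \<and> prob_space.variance M X = v"

end

theory Submission
  imports Defs "HOL-Real_Asymp.Real_Asymp"
begin

text \<open>
  The field \<open>f\<close> is a stationary Gaussian field with covariance \<open>u(x - y)\<close>, where \<open>u\<close> is the mean of
  \<open>cos 2\<pi>\<langle>\<lambda>, \<cdot>\<rangle>\<close> over \<open>\<Lambda>\<close>. Put \<open>L\<^sub>\<epsilon> = meas {\<bar>f\<bar> < \<epsilon>} / 2\<epsilon>\<close>. The bivariate Gaussian density gives
  \<open>E(L\<^sub>\<epsilon> L\<^sub>\<delta>) = W + O(max(\<epsilon>, \<delta>)\<^bsup>1/2\<^esup>)\<close> with \<open>W = (1/2\<pi>) \<integral> (1 - u\<^sup>2)\<^bsup>-1/2\<^esup>\<close>. Hence \<open>L\<^sub>\<epsilon>\<close> converges in \<open>L\<^sup>2\<close>, and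
  almost surely along \<open>\<epsilon> = k\<^bsup>-8\<^esup>\<close>; since \<open>2\<epsilon>L\<^sub>\<epsilon>\<close> is monotone in \<open>\<epsilon>\<close> and consecutive ratios tend to 1, the
  full limit exists almost surely, with no recourse to the geometry of the nodal set. So the variance is
  \<open>(1/2\<pi>) \<integral> ((1 - u\<^sup>2)\<^bsup>-1/2\<^esup> - 1)\<close>, and \<open>(1 - u\<^sup>2)\<^bsup>-1/2\<^esup> = 1 + u\<^sup>2/2 + O(u\<^sup>4 (1 - u\<^sup>2)\<^bsup>-1/2\<^esup>)\<close> with \<open>\<integral> u\<^sup>2 = 1/N\<close>.

  Symmetry of \<open>\<Lambda>\<close> makes \<open>u\<close> strictly concave (with constant of order \<open>E\<close>) wherever it is close to 1, so on a
  cube of side of order \<open>E\<^bsup>-1/2\<^esup>\<close> that meets \<open>{\<bar>u\<bar> \<approx> 1}\<close> the singularity of \<open>(1 - u\<^sup>2)\<^bsup>-3/4\<^esup>\<close> is no worse than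
  \<open>\<bar>x - z\<bar>\<^bsup>-3/2\<^esup>\<close>, and its integral is bounded by a multiple of the volume of the cube, that is, of
  \<open>\<integral> u\<^sup>4\<close> over it. The error is therefore \<open>O(\<integral> u\<^sup>4)\<close>, and \<open>N\<^sup>4 \<integral> u\<^sup>4\<close> counts the quadruples in \<open>\<Lambda>\<close> with sum 0.
  Two of the entries determine a hyperplane that contains the third; its section of the sphere has at most two
  points if \<open>d = 2\<close>, and for \<open>d \<ge> 3\<close> fixing \<open>d - 3\<close> coordinates reduces the count to \<open>X\<^sup>2 + D Y\<^sup>2 = K\<close>.
\<close>

section \<open>Representations by binary quadratic forms\<close>

text \<open>The exponent 3/4 answers the main obstacle. With v of order \<delta>^2 / (1 - u^2),
  expanding exp(-v) in the bivariate density to first order would leave the error weight (1 -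
  u^2)^(-3/2), hence a singularity |x - z|^(-3), which is not integrable for d = 2 or d = 3. The
  cruder inequality 1 - v^(1/4) \<le> exp(-v) weakens the error from \<delta>^2 to \<delta>^(1/2),
  but leaves only |x - z|^(-3/2), integrable for every d \<ge> 2. The same weight dominates the
  fourth-order remainder of (1 - u^2)^(-1/2), so one estimate serves both purposes. The power 8 of
  the mesh makes squared L2 distances of order k^(-4), so that the distances themselves are
  summable. In the count of quadruples the pairs with a + b = 0 contribute up to N^2; this is the
  source of the bare 1 / N^2 in the error. Every other pair has at most M completions, where M \<le>
  2 in the plane, M is a hyperplane count for d \<ge> 3, and the trivial M \<le> N already gives
  (iii).\<close>

lemma card_le_fibers:
  assumes "finite B" and "\<And>x. x \<in> S \<Longrightarrow> f x \<in> B"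
    and fib: "\<And>b. b \<in> B \<Longrightarrow> finite {x\<in>S. f x = b} \<and> card {x\<in>S. f x = b} \<le> k"
  shows "finite S" and "card S \<le> k * card B"
proof -
  have S: "S = (\<Union>b\<in>B. {x\<in>S. f x = b})" using assms(2) by auto
  have fin: "finite (\<Union>b\<in>B. {x\<in>S. f x = b})" using fib \<open>finite B\<close> by blast
  with S show "finite S" by simp
  have "card (\<Union>b\<in>B. {x\<in>S. f x = b}) \<le> (\<Sum>b\<in>B. card {x\<in>S. f x = b})"
    by (rule card_UN_le[OF \<open>finite B\<close>])
  also have "\<dots> \<le> (\<Sum>b\<in>B. k)" using fib by (intro sum_mono) auto
  finally show "card S \<le> k * card B" using S by (simp add: mult.commute)
qed

section \<open>Growth of the number of divisors\<close>

lemma card_divisors_mult_le: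
  fixes a b :: nat
  assumes "a > 0" "b > 0"
  shows "card {d. d dvd a * b} \<le> card {d. d dvd a} * card {d. d dvd b}"
proof -
  have "{d. d dvd a * b} \<subseteq> (\<lambda>(x, y). x * y) ` ({d. d dvd a} \<times> {d. d dvd b})"
  proof
    fix d assume "d \<in> {d. d dvd a * b}"
    then obtain x y where "d = x * y" "x dvd a" "y dvd b" using division_decomp by blast
    then show "d \<in> (\<lambda>(x, y). x * y) ` ({d. d dvd a} \<times> {d. d dvd b})" by force
  qed
  then have "card {d. d dvd a * b} \<le> card ({d. d dvd a} \<times> {d. d dvd b})"
    by (rule surj_card_le[rotated]) (use assms in simp)
  then show ?thesis by (simp add: card_cartesian_product)
qed

lemma card_divisors_prime_power:
  fixes p :: nat assumes "prime p"
  shows "card {d. d dvd p ^ a} \<le> a + 1"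
proof -
  have "{d. d dvd p ^ a} \<subseteq> (\<lambda>i. p ^ i) ` {..a}"
    using divides_primepow_nat[OF assms] by auto
  then have "card {d. d dvd p ^ a} \<le> card {..a}" by (rule surj_card_le[rotated]) simp
  then show ?thesis by simp
qed

text \<open>Split off the full power p^a of one prime at a time. Its factor a + 1 is at most 2^a
  \<le> p^(a e) as soon as p \<ge> \<open>P\<close>, that is, p^e \<ge> 2; each smaller prime costs
  one factor \<open>B\<close>, and there are boundedly many of them.\<close>

lemma divisor_bound:
  fixes e :: real
  assumes "e > 0"
  obtains C where "C > 0" "\<And>n::nat. n > 0 \<Longrightarrow> real (card {d. d dvd n}) \<le> C * real n powr e"
proof -
  define P where "P = 2 powr (1 / e)"
  \<comment> \<open>With \<open>B * (e * ln 2) \<ge> 1\<close> and \<open>B \<ge> 1\<close> one gets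
    a + 1 \<le> B (1 + a e ln 2) \<le> B * 2^(a e).\<close>
  define B where "B = max 1 (1 / (e * ln 2))"
  have B1: "B \<ge> 1" by (simp add: B_def)
  have Bpow: "real a + 1 \<le> B * (2 powr e) ^ a" for a
  proof -
    have "1 + a * (e * ln 2) \<le> exp (a * (e * ln 2))" by (rule exp_ge_add_one_self)
    also have "\<dots> = (2 powr e) ^ a" by (simp add: powr_def exp_of_nat_mult)
    finally have *: "1 + a * (e * ln 2) \<le> (2 powr e) ^ a" .
    have "real a + 1 \<le> B * (1 + a * (e * ln 2))"
    proof -
      have "1 \<le> B * (e * ln 2)"
        proof -
          have "1 / (e * ln 2) * (e * ln 2) \<le> B * (e * ln 2)"
            using assms by (intro mult_right_mono) (auto simp: B_def)
          then show ?thesis using assms by simp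
        qed
      then have "real a * 1 \<le> real a * (B * (e * ln 2))" by (intro mult_left_mono) auto
      then show ?thesis using B1 by (simp add: algebra_simps)
    qed
    also have "\<dots> \<le> B * (2 powr e) ^ a" using * B1 by (intro mult_left_mono) auto
    finally show ?thesis .
  qed
  let ?A = "\<lambda>n. {p::nat. prime p \<and> p dvd n \<and> real p < P}"
  have main: "real (card {d. d dvd n}) \<le> B ^ card (?A n) * real n powr e" if "n > 0" for n :: nat
    using that
  proof (induction n rule: less_induct)
    case (less n)
    show ?case
    proof (cases "n = 1")
      case True
      then show ?thesis using B1 by simp
    next
      case False
      then obtain p where p: "prime p" "p dvd n" using prime_factor_nat by blast
      obtain m where m: "n = p ^ multiplicity p n * m" "\<not> p dvd m"
        using multiplicity_decompose'[of n p] less.prems p(1) not_prime_unit by blast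
      define a where "a = multiplicity p n"
      have a: "a > 0" unfolding a_def using p less.prems by (simp add: prime_multiplicity_gt_zero_iff)
      have n: "n = p ^ a * m" using m a_def by simp
      have m0: "m > 0" using n less.prems by (cases m) auto
      have "p ^ a > 1" using p a by (metis one_less_power prime_gt_1_nat)
      then have "m < n" using n m0 by simp
      then have IH: "real (card {d. d dvd m}) \<le> B ^ card (?A m) * real m powr e"
        using less.IH m0 by blast
      have finA: "finite (?A n)" by (rule finite_subset[of _ "{..n}"]) (use less.prems dvd_imp_le in auto)
      have sub: "?A m \<subseteq> ?A n" using n by auto
      have p0: "real p > 0" using p prime_gt_0_nat by simp
      have "real (card {d. d dvd n}) \<le> (real a + 1) * real (card {d. d dvd m})"
      proof -
        have "card {d. d dvd n} \<le> card {d. d dvd p ^ a} * card {d. d dvd m}"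
          unfolding n using p m0 prime_gt_0_nat by (intro card_divisors_mult_le) auto
        also have "\<dots> \<le> (a + 1) * card {d. d dvd m}"
          using card_divisors_prime_power[OF p(1)] by (intro mult_right_mono) auto
        finally have "real (card {d. d dvd n}) \<le> real ((a + 1) * card {d. d dvd m})"
          by (rule of_nat_mono)
        then show ?thesis by (simp add: algebra_simps)
      qed
      also have "\<dots> \<le> (real a + 1) * (B ^ card (?A m) * real m powr e)"
        using IH by (intro mult_left_mono) auto
      also have "\<dots> \<le> (B ^ card (?A n - ?A m) * (real p powr e) ^ a) * (B ^ card (?A m) * real m powr e)"
      proof (intro mult_right_mono)
        show "real a + 1 \<le> B ^ card (?A n - ?A m) * (real p powr e) ^ a"
        proof (cases "real p < P")
          case True
          have "p \<in> ?A n - ?A m" using True p m by auto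
          then have "card (?A n - ?A m) > 0" using finA card_gt_0_iff by blast
          then have "B ^ 1 \<le> B ^ card (?A n - ?A m)" using B1 by (intro power_increasing) auto
          moreover have "(2 powr e) ^ a \<le> (real p powr e) ^ a"
            using p prime_ge_2_nat[of p] assms by (intro power_mono powr_mono2) auto
          ultimately have "B * (2 powr e) ^ a \<le> B ^ card (?A n - ?A m) * (real p powr e) ^ a"
            using B1 by (intro mult_mono) auto
          then show ?thesis using Bpow[of a] by linarith
        next
          case False
          have "2 = P powr e" using assms by (simp add: P_def powr_powr)
          also have "\<dots> \<le> real p powr e" using False assms by (intro powr_mono2) (auto simp: P_def)
          finally have "2 ^ a \<le> (real p powr e) ^ a" by (intro power_mono) auto
          moreover have "real a + 1 \<le> 2 ^ a"
          proof -
            have "a + 1 \<le> 2 ^ a" using less_exp[of a] by linarith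
            then have "real (a + 1) \<le> real (2 ^ a)" by (rule of_nat_mono)
            then show ?thesis by simp
          qed
          ultimately have "real a + 1 \<le> 1 * (real p powr e) ^ a" by simp
          also have "\<dots> \<le> B ^ card (?A n - ?A m) * (real p powr e) ^ a"
            using B1 by (intro mult_right_mono) auto
          finally show ?thesis .
        qed
      qed (use B1 in auto)
      also have "\<dots> = (B ^ card (?A n - ?A m) * B ^ card (?A m)) * ((real p powr e) ^ a * real m powr e)"
        by (simp add: algebra_simps)
      also have "B ^ card (?A n - ?A m) * B ^ card (?A m) = B ^ card (?A n)"
        using finA sub by (simp add: power_add[symmetric] card_Diff_subset finite_subset card_mono)
      also have "(real p powr e) ^ a * real m powr e = real n powr e"
        using n p0 by (simp add: powr_mult powr_realpow[symmetric] powr_powr mult.commute)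
      finally show ?thesis .
    qed
  qed
  \<comment> \<open>The exponent counts all naturals below \<open>P\<close>, not only the primes
    dividing n, which makes \<open>C\<close> independent of n.\<close>
  define C where "C = B ^ card {p::nat. real p < P}"
  have finP: "finite {p::nat. real p < P}"
    by (rule finite_subset[of _ "{..nat \<lceil>P\<rceil>}"]) (auto, linarith)
  have "real (card {d. d dvd n}) \<le> C * real n powr e" if "n > 0" for n :: nat
  proof -
    have "B ^ card (?A n) \<le> C" unfolding C_def using B1
      by (intro power_increasing card_mono finP) auto
    then have "B ^ card (?A n) * real n powr e \<le> C * real n powr e" by (intro mult_right_mono) auto
    then show ?thesis using main[OF that] by linarith
  qed
  moreover have "C > 0" using B1 by (simp add: C_def)
  ultimately show ?thesis using that by blast
qed

section \<open>Counting solutions through gcds with K\<close>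

lemma dvd_mult_gcd_gcd:
  fixes a b K :: int
  assumes "K dvd a * b"
  shows "K dvd gcd a K * gcd b K"
proof -
  have "K dvd gcd (a * gcd b K) (K * gcd b K)"
  proof (rule gcd_greatest)
    have "K dvd gcd (a * b) (a * K)" using assms by (intro gcd_greatest) auto
    then have "K dvd a * gcd b K" by (simp add: gcd_mult_left)
    then show "K dvd a * gcd b K" .
  qed simp
  then show ?thesis by (simp add: gcd_mult_right gcd.commute)
qed

text \<open>Fix one solution \<open>(X\<^sub>0, Y\<^sub>0)\<close>. Since \<open>K\<close> divides \<open>(X Y\<^sub>0 - X\<^sub>0 Y)(X Y\<^sub>0 + X\<^sub>0 Y)\<close>, a solution is
  classified by the gcds of the two factors with \<open>K\<close>. Two solutions of one class satisfy \<open>K | 2(X Y' - X' Y)\<close>, while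
  \<open>(\<alpha> X X' + \<beta> Y Y')\<^sup>2 + \<alpha> \<beta> (X Y' - X' Y)\<^sup>2 = K\<^sup>2\<close>, which leaves at most ten of them.\<close>

lemma card_coprime_binary_representations:
  fixes \<alpha> \<beta> K :: int
  assumes pos: "\<alpha> > 0" "\<beta> > 0" "K > 0"
  defines "S \<equiv> {(X, Y). \<alpha> * X\<^sup>2 + \<beta> * Y\<^sup>2 = K \<and> coprime (\<alpha> * X\<^sup>2) K}"
  shows "finite S \<and> card S \<le> 10 * (card {d. d > 0 \<and> d dvd K})\<^sup>2"
proof (cases "S = {}")
  case True then show ?thesis by simp
next
  case False
  then obtain X0 Y0 where P0: "(X0, Y0) \<in> S" by auto
  define D where "D = {d. d > 0 \<and> d dvd K}"
  have finD: "finite D"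
    by (rule finite_subset[of _ "{1..K}"]) (use pos zdvd_imp_le in \<open>auto simp: D_def\<close>)
  \<comment> \<open>K is the sum of the two terms, so a common factor of K and one term is shared by
    the other.\<close>
  have cop: "coprime \<alpha> K" "coprime X K" "coprime \<beta> K" "coprime Y K" if "(X, Y) \<in> S" for X Y
  proof -
    from that have 1: "coprime (\<alpha> * X\<^sup>2) K" and eq: "\<alpha> * X\<^sup>2 + \<beta> * Y\<^sup>2 = K" by (auto simp: S_def)
    from eq have "\<beta> * Y\<^sup>2 = K - \<alpha> * X\<^sup>2" by simp
    moreover have "gcd (K - \<alpha> * X\<^sup>2) K = gcd (\<alpha> * X\<^sup>2) K" by (rule gcd_diff2)
    ultimately have 2: "coprime (\<beta> * Y\<^sup>2) K"
      using 1 by (simp only: coprime_iff_gcd_eq_1)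
    from 1 2 show "coprime \<alpha> K" "coprime X K" "coprime \<beta> K" "coprime Y K" by auto
  qed
  define \<Phi> where "\<Phi> = (\<lambda>(X, Y). (gcd (X * Y0 - X0 * Y) K, gcd (X * Y0 + X0 * Y) K))"
  have "card S \<le> 10 * card (D \<times> D)" and "finite S"
  proof -
    have B: "finite (D \<times> D)" using finD by simp
    have im: "\<Phi> P \<in> D \<times> D" if "P \<in> S" for P
      using pos by (auto simp: \<Phi>_def D_def split: prod.splits)
    have fib: "finite {x\<in>S. \<Phi> x = b} \<and> card {x\<in>S. \<Phi> x = b} \<le> 10" if "b \<in> D \<times> D" for b
    proof (cases "{x\<in>S. \<Phi> x = b} = {}")
      case True then show ?thesis by (simp only: True) simp
    next
      case False
      then obtain X Y where P: "(X, Y) \<in> S" "\<Phi> (X, Y) = b" by auto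
      obtain d1 d2 where b: "b = (d1, d2)" by force
      have d1: "d1 = gcd (X * Y0 - X0 * Y) K" and d2: "d2 = gcd (X * Y0 + X0 * Y) K"
        using P b by (auto simp: \<Phi>_def)
      have eq0: "\<alpha> * X0\<^sup>2 + \<beta> * Y0\<^sup>2 = K" and eq: "\<alpha> * X\<^sup>2 + \<beta> * Y\<^sup>2 = K"
        using P0 P by (auto simp: S_def)
      have "\<alpha> * \<beta> * ((X * Y0 - X0 * Y) * (X * Y0 + X0 * Y)) = K * (\<alpha> * X\<^sup>2 - \<alpha> * X0\<^sup>2)"
      proof -
        have "\<alpha> * \<beta> * ((X * Y0 - X0 * Y) * (X * Y0 + X0 * Y)) = \<alpha> * X\<^sup>2 * (\<beta> * Y0\<^sup>2) - \<alpha> * X0\<^sup>2 * (\<beta> * Y\<^sup>2)"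
          by (simp add: algebra_simps power2_eq_square)
        also have "\<beta> * Y0\<^sup>2 = K - \<alpha> * X0\<^sup>2" using eq0 by simp
        also have "\<beta> * Y\<^sup>2 = K - \<alpha> * X\<^sup>2" using eq by simp
        finally show ?thesis by (simp add: algebra_simps)
      qed
      then have "K dvd (\<alpha> * \<beta>) * ((X * Y0 - X0 * Y) * (X * Y0 + X0 * Y))" by simp
      moreover have "coprime K (\<alpha> * \<beta>)" using cop[OF P0] by (simp add: coprime_commute)
      ultimately have "K dvd (X * Y0 - X0 * Y) * (X * Y0 + X0 * Y)"
        using coprime_dvd_mult_right_iff by blast
      then have Kd: "K dvd d1 * d2" unfolding d1 d2
        by (simp add: dvd_mult_gcd_gcd)
      \<comment> \<open>The two factors add up to 2 X Y0, and X Y0 is prime to K.\<close>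
      have "gcd d1 d2 dvd 2"
      proof -
        have "gcd d1 d2 dvd X * Y0 - X0 * Y" "gcd d1 d2 dvd X * Y0 + X0 * Y" and gK: "gcd d1 d2 dvd K"
          unfolding d1 d2 by (meson dvd_trans gcd_dvd1 gcd_dvd2)+
        then have "gcd d1 d2 dvd (X * Y0 - X0 * Y) + (X * Y0 + X0 * Y)" by (metis dvd_add)
        then have "gcd d1 d2 dvd (X * Y0) * 2" by (simp add: algebra_simps)
        moreover have "coprime K (X * Y0)" using cop[OF P0] cop[OF P(1)] by (simp add: coprime_commute)
        then have "coprime (gcd d1 d2) (X * Y0)" using gK coprime_divisors dvd_refl by blast
        ultimately show ?thesis using coprime_dvd_mult_right_iff by blast
      qed
      \<comment> \<open>Brahmagupta composition of (X, Y) with (X', Y'): \<open>w\<close> and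
        \<open>t\<close> represent the product of the two values by the form w^2 + \<alpha> \<beta>
        t^2.\<close>
      define w where "w = (\<lambda>(X', Y'). \<alpha> * X * X' + \<beta> * Y * Y')"
      define t where "t = (\<lambda>(X', Y'). X * Y' - X' * Y)"
      have wt: "(w P')\<^sup>2 + \<alpha> * \<beta> * (t P')\<^sup>2 = K\<^sup>2" if "P' \<in> S" for P'
      proof -
        obtain X' Y' where P': "P' = (X', Y')" by force
        have "(w P')\<^sup>2 + \<alpha> * \<beta> * (t P')\<^sup>2 = (\<alpha> * X\<^sup>2 + \<beta> * Y\<^sup>2) * (\<alpha> * X'\<^sup>2 + \<beta> * Y'\<^sup>2)"
          unfolding P' w_def t_def by (simp add: algebra_simps power2_eq_square)
        moreover have "\<alpha> * X'\<^sup>2 + \<beta> * Y'\<^sup>2 = K" using that P' by (auto simp: S_def)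
        ultimately show ?thesis using eq by (simp add: power2_eq_square)
      qed
      \<comment> \<open>Within one class, \<open>Y0 * t P'\<close> is a combination of corresponding
        factors of the two solutions, and Y0 is prime to K; so d1 and d2 both divide t. Then K | d1
        d2 | gcd(d1, d2) t | 2 t.\<close>
      have tK: "K dvd 2 * t P'" if "P' \<in> S" "\<Phi> P' = b" for P'
      proof -
        obtain X' Y' where P': "P' = (X', Y')" by force
        have e1: "d1 = gcd (X' * Y0 - X0 * Y') K" and e2: "d2 = gcd (X' * Y0 + X0 * Y') K"
          using that b P' by (auto simp: \<Phi>_def)
        have c: "coprime K Y0" using cop[OF P0] by (simp add: coprime_commute)
        have "d1 dvd Y' * (X * Y0 - X0 * Y) - Y * (X' * Y0 - X0 * Y')"
          using d1 e1 by (metis dvd_diff dvd_mult gcd_dvd1)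
        then have "d1 dvd Y0 * t P'" by (simp add: P' t_def algebra_simps)
        moreover have "coprime d1 Y0" using c d1 coprime_divisors gcd_dvd2 dvd_refl by blast
        ultimately have 1: "d1 dvd t P'" using coprime_dvd_mult_right_iff by blast
        have "d2 dvd Y' * (X * Y0 + X0 * Y) - Y * (X' * Y0 + X0 * Y')"
          using d2 e2 by (metis dvd_diff dvd_mult gcd_dvd1)
        then have "d2 dvd Y0 * t P'" by (simp add: P' t_def algebra_simps)
        moreover have "coprime d2 Y0" using c d2 coprime_divisors gcd_dvd2 dvd_refl by blast
        ultimately have 2: "d2 dvd t P'" using coprime_dvd_mult_right_iff by blast
        have "d1 * d2 dvd gcd d1 d2 * t P'"
        proof -
          have "d1 * d2 dvd d1 * t P'" "d1 * d2 dvd d2 * t P'" using 1 2 by (auto simp: mult.commute)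
          then have "d1 * d2 dvd gcd (d1 * t P') (d2 * t P')" by simp
          also have "gcd (d1 * t P') (d2 * t P') dvd gcd d1 d2 * t P'"
            by (simp add: gcd_mult_right)
          finally show ?thesis .
        qed
        also have "gcd d1 d2 * t P' dvd 2 * t P'" using \<open>gcd d1 d2 dvd 2\<close> by (rule mult_dvd_mono) simp
        finally show ?thesis using Kd dvd_trans by blast
      qed
      define \<Psi> where "\<Psi> = (\<lambda>P'. (2 * t P', w P' \<ge> 0))"
      have inj: "inj_on \<Psi> {x\<in>S. \<Phi> x = b}"
      proof (rule inj_onI)
        fix P' P'' assume a: "P' \<in> {x\<in>S. \<Phi> x = b}" "P'' \<in> {x\<in>S. \<Phi> x = b}" "\<Psi> P' = \<Psi> P''"
        then have tt: "t P' = t P''" and sg: "(w P' \<ge> 0) = (w P'' \<ge> 0)" by (auto simp: \<Psi>_def)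
        have "(w P')\<^sup>2 = (w P'')\<^sup>2" using wt[of P'] wt[of P''] a tt by simp
        then have ww: "w P' = w P''" using sg by (auto simp: power2_eq_iff)
        obtain X' Y' X'' Y'' where P': "P' = (X', Y')" "P'' = (X'', Y'')" by force
        \<comment> \<open>For fixed (X, Y) the map to (w, t) is linear with determinant K > 0; these
          identities invert it.\<close>
        have f: "w (x, y) * X - \<beta> * Y * t (x, y) = K * x" "w (x, y) * Y + \<alpha> * X * t (x, y) = K * y" for x y
          unfolding eq[symmetric] w_def t_def by (simp_all add: algebra_simps power2_eq_square)
        have "K * X' = K * X''" "K * Y' = K * Y''"
          using f[of X' Y'] f[of X'' Y''] ww tt by (auto simp: P')
        then show "P' = P''" using pos P' by simp
      qed
      have im: "\<Psi> ` {x\<in>S. \<Phi> x = b} \<subseteq> {-2*K, -K, 0, K, 2*K} \<times> (UNIV :: bool set)"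
      proof (rule image_subsetI)
        fix P' assume a: "P' \<in> {x\<in>S. \<Phi> x = b}"
        then obtain q where q: "2 * t P' = K * q" using tK by blast
        \<comment> \<open>Since \<alpha> \<beta> \<ge> 1, |t| \<le> K, so 2 t is one of five
          multiples of K; the sign of \<open>w\<close> doubles this to ten.\<close>
        have "1 * (t P')\<^sup>2 \<le> \<alpha> * \<beta> * (t P')\<^sup>2"
          using pos mult_pos_pos[OF pos(1,2)] by (intro mult_right_mono zero_le_power2) linarith
        also have "\<dots> \<le> K\<^sup>2"
        proof -
          have "P' \<in> S" using a by simp
          then show ?thesis using wt[of P'] zero_le_power2[of "w P'"] by linarith
        qed
        finally have "\<bar>t P'\<bar> \<le> K" using pos abs_le_square_iff[of "t P'" K] by simp
        then have "\<bar>K * q\<bar> \<le> 2 * K" using q by linarith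
        then have "K * \<bar>q\<bar> \<le> K * 2" using pos by (simp add: abs_mult)
        then have "\<bar>q\<bar> \<le> 2" using pos by simp
        then have "q \<in> {-2,-1,0,1,2}" by auto
        then show "\<Psi> P' \<in> {-2*K, -K, 0, K, 2*K} \<times> (UNIV :: bool set)"
          using q by (auto simp: \<Psi>_def)
      qed
      have fin: "finite ({-2*K, -K, 0, K, 2*K} \<times> (UNIV :: bool set))" by simp
      have "card {x\<in>S. \<Phi> x = b} \<le> card ({-2*K, -K, 0, K, 2*K} \<times> (UNIV :: bool set))"
        by (rule card_inj_on_le[OF inj im fin])
      also have "\<dots> \<le> 10"
      proof -
        have "card {-2*K, -K, 0, K, 2*K} \<le> 5" using card_length[of "[-2*K, -K, 0, K, 2*K]"] by simp
        then show ?thesis by (simp add: card_cartesian_product)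
      qed
      finally show ?thesis using inj_on_finite[OF inj im fin] by simp
    qed
    show "card S \<le> 10 * card (D \<times> D)" by (rule card_le_fibers(2)[OF B im fib])
    show "finite S" by (rule card_le_fibers(1)[OF B im fib])
  qed
  then show ?thesis by (simp add: D_def card_cartesian_product power2_eq_square)
qed

text \<open>The integers X with g | a X^2 form an ideal, and \<open>G\<close> is its least positive
  member, which exists because g belongs to it. Closure under differences: for two members g^2
  divides (a X Y)^2, so g divides the cross term a X Y.\<close>

lemma square_multiples_generator:
  fixes a g :: int
  assumes "g > 0"
  obtains G where "G > 0" "g dvd a * G\<^sup>2" "\<And>X. g dvd a * X\<^sup>2 \<Longrightarrow> G dvd X"
proof -
  define P where "P = (\<lambda>n::nat. n > 0 \<and> g dvd a * (int n)\<^sup>2)"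
  have "P (nat g)" using assms by (simp add: P_def power2_eq_square)
  define n where "n = (LEAST n. P n)"
  have n: "P n" unfolding n_def by (rule LeastI[of P, OF \<open>P (nat g)\<close>])
  have least: "n \<le> m" if "P m" for m unfolding n_def by (rule Least_le[of P, OF that])
  have "int n dvd X" if X: "g dvd a * X\<^sup>2" for X
  proof (rule ccontr)
    assume "\<not> int n dvd X"
    define r where "r = X mod int n"
    have n0: "int n > 0" using n by (simp add: P_def)
    have "r \<noteq> 0" using \<open>\<not> int n dvd X\<close> unfolding r_def
      by (metis dvd_eq_mod_eq_0)
    then have r: "r > 0" "r < int n"
      using pos_mod_sign[OF n0, of X] pos_mod_bound[OF n0, of X] unfolding r_def by linarith+
    have G: "g dvd a * (int n)\<^sup>2" using n by (simp add: P_def)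
    have "g\<^sup>2 dvd (a * X\<^sup>2) * (a * (int n)\<^sup>2)"
      unfolding power2_eq_square[of g] by (rule mult_dvd_mono[OF X G])
    also have "(a * X\<^sup>2) * (a * (int n)\<^sup>2) = (a * X * int n)\<^sup>2" by (simp add: algebra_simps power2_eq_square)
    finally have m: "g dvd a * X * int n" by simp
    define q where "q = X div int n"
    have "r = X - q * int n" by (simp add: r_def q_def minus_div_mult_eq_mod)
    then have "a * r\<^sup>2 = a * X\<^sup>2 - 2 * q * (a * X * int n) + q\<^sup>2 * (a * (int n)\<^sup>2)"
      by (simp only:) (simp add: algebra_simps power2_eq_square)
    moreover have "g dvd \<dots>" using X G m by (intro dvd_add dvd_diff) auto
    ultimately have "P (nat r)" using r by (simp add: P_def)
    then show False using least r by fastforce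
  qed
  then show ?thesis using that[of "int n"] n by (auto simp: P_def)
qed

text \<open>The solutions with a given \<open>g = gcd X\<^sup>2 K\<close> become, after dividing by \<open>g\<close>, solutions of a diagonal form that
  satisfy the coprimality condition.\<close>

lemma card_binary_representations:
  fixes D K :: int
  assumes pos: "D > 0" "K > 0"
  defines "S \<equiv> {(X, Y). X\<^sup>2 + D * Y\<^sup>2 = K}"
  shows "finite S" and "card S \<le> 10 * (card {d. d > 0 \<and> d dvd K}) ^ 3"
proof -
  define T where "T = {d. d > 0 \<and> d dvd K}"
  have finT: "finite T"
    by (rule finite_subset[of _ "{1..K}"]) (use pos zdvd_imp_le in \<open>auto simp: T_def\<close>)
  define f where "f = (\<lambda>(X, Y::int). gcd (X\<^sup>2) K)"
  have im: "f P \<in> T" if "P \<in> S" for P using pos by (auto simp: f_def T_def split: prod.splits)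
  have fib: "finite {x\<in>S. f x = g} \<and> card {x\<in>S. f x = g} \<le> 10 * (card T)\<^sup>2" if "g \<in> T" for g
  proof -
    have g: "g > 0" "g dvd K" using that by (auto simp: T_def)
    \<comment> \<open>g divides X^2, hence also D Y^2 = K - X^2, so X and Y run over multiples of
      \<open>G\<close> and \<open>H\<close>.\<close>
    obtain G where G: "G > 0" "g dvd 1 * G\<^sup>2" "\<And>X. g dvd 1 * X\<^sup>2 \<Longrightarrow> G dvd X"
      using square_multiples_generator[OF g(1)] by metis
    obtain H where H: "H > 0" "g dvd D * H\<^sup>2" "\<And>X. g dvd D * X\<^sup>2 \<Longrightarrow> H dvd X"
      using square_multiples_generator[OF g(1)] by metis
    define \<alpha> where "\<alpha> = G\<^sup>2 div g"
    define \<beta> where "\<beta> = D * H\<^sup>2 div g"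
    define K1 where "K1 = K div g"
    have \<alpha>: "G\<^sup>2 = g * \<alpha>" and \<beta>: "D * H\<^sup>2 = g * \<beta>" and K1: "K = g * K1"
      using G H g by (auto simp: \<alpha>_def \<beta>_def K1_def)
    have p: "\<alpha> > 0" "\<beta> > 0" "K1 > 0"
      using \<alpha> \<beta> K1 g G(1) H(1) pos
      by (metis zero_less_mult_pos zero_less_power mult_pos_pos)+
    define S1 where "S1 = {(X, Y). \<alpha> * X\<^sup>2 + \<beta> * Y\<^sup>2 = K1 \<and> coprime (\<alpha> * X\<^sup>2) K1}"
    have S1: "finite S1" "card S1 \<le> 10 * (card {d. d > 0 \<and> d dvd K1})\<^sup>2"
      using card_coprime_binary_representations[OF p] by (auto simp: S1_def)
    have "card {d. d > 0 \<and> d dvd K1} \<le> card T"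
      by (rule card_mono[OF finT]) (auto simp: T_def K1)
    then have "(card {d. d > 0 \<and> d dvd K1})\<^sup>2 \<le> (card T)\<^sup>2" by (rule power_mono) simp
    then have S1': "card S1 \<le> 10 * (card T)\<^sup>2" using S1 by linarith
    have sub: "{x\<in>S. f x = g} \<subseteq> (\<lambda>(X, Y). (G * X, H * Y)) ` S1"
    proof
      fix P assume P: "P \<in> {x\<in>S. f x = g}"
      obtain X Y where XY: "P = (X, Y)" by force
      have eq: "X\<^sup>2 + D * Y\<^sup>2 = K" and gg: "gcd (X\<^sup>2) K = g" using P XY by (auto simp: S_def f_def)
      have gX: "g dvd X\<^sup>2" using gg by (metis gcd_dvd1)
      have "D * Y\<^sup>2 = K - X\<^sup>2" using eq by simp
      then have gY: "g dvd D * Y\<^sup>2" using gX g by simp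
      obtain x where x: "X = G * x" using G(3)[of X] gX by auto
      obtain y where y: "Y = H * y" using H(3)[of Y] gY by auto
      have X2: "X\<^sup>2 = g * (\<alpha> * x\<^sup>2)" by (simp add: x power_mult_distrib \<alpha>)
      have "D * Y\<^sup>2 = (D * H\<^sup>2) * y\<^sup>2" by (simp add: y power_mult_distrib)
      then have Y2: "D * Y\<^sup>2 = g * (\<beta> * y\<^sup>2)" by (simp add: \<beta>)
      have "g * (\<alpha> * x\<^sup>2 + \<beta> * y\<^sup>2) = g * K1" using eq X2 Y2 K1 by (simp add: distrib_left)
      then have 1: "\<alpha> * x\<^sup>2 + \<beta> * y\<^sup>2 = K1" using g by simp
      have "g * gcd (\<alpha> * x\<^sup>2) K1 = g * 1"
      proof -
        have "gcd (g * (\<alpha> * x\<^sup>2)) (g * K1) = g" using gg X2 K1 by simp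
        then show ?thesis using g by (simp add: gcd_mult_left)
      qed
      then have "coprime (\<alpha> * x\<^sup>2) K1" using g unfolding coprime_iff_gcd_eq_1 by simp
      then have "(x, y) \<in> S1" using 1 by (simp add: S1_def)
      then show "P \<in> (\<lambda>(X, Y). (G * X, H * Y)) ` S1" using XY x y by force
    qed
    have "finite {x\<in>S. f x = g}" using sub S1(1) finite_surj by blast
    moreover have "card {x\<in>S. f x = g} \<le> card S1" by (rule surj_card_le[OF S1(1) sub])
    ultimately show ?thesis using S1' by simp
  qed
  show "finite S" by (rule card_le_fibers(1)[OF finT im fib])
  have "card S \<le> 10 * (card T)\<^sup>2 * card T" by (rule card_le_fibers(2)[OF finT im fib])
  then show "card S \<le> 10 * (card {d. d > 0 \<and> d dvd K}) ^ 3"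
    by (simp add: T_def power2_eq_square power3_eq_cube mult.assoc)
qed

text \<open>The count is cubic in the number of divisors of K, hence the exponent e / 3; the
  estimate is uniform in \<open>D\<close>.\<close>

lemma binary_representations_bound:
  fixes e :: real
  assumes "e > 0"
  obtains C where "C > 0"
    "\<And>D K::int. D > 0 \<Longrightarrow> K > 0 \<Longrightarrow> finite {(X, Y). X\<^sup>2 + D * Y\<^sup>2 = K} \<and>
       real (card {(X, Y). X\<^sup>2 + D * Y\<^sup>2 = K}) \<le> C * real_of_int K powr e"
proof -
  obtain C where C: "C > 0" "\<And>n::nat. n > 0 \<Longrightarrow> real (card {d. d dvd n}) \<le> C * real n powr (e / 3)"
    using divisor_bound[of "e / 3"] assms by auto
  have "finite {(X, Y). X\<^sup>2 + D * Y\<^sup>2 = K} \<and>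
       real (card {(X, Y). X\<^sup>2 + D * Y\<^sup>2 = K}) \<le> (10 * C ^ 3) * real_of_int K powr e"
    if p: "D > 0" "K > 0" for D K :: int
  proof -
    have "{d. d > 0 \<and> d dvd K} \<subseteq> int ` {d. d dvd nat K}"
    proof
      fix d assume "d \<in> {d. d > 0 \<and> d dvd K}"
      then have "d = int (nat d)" "nat d dvd nat K" using p by (auto simp: nat_dvd_iff)
      then show "d \<in> int ` {d. d dvd nat K}" by blast
    qed
    then have "card {d. d > 0 \<and> d dvd K} \<le> card {d. d dvd nat K}"
      by (rule surj_card_le[rotated]) (use p in simp)
    then have "real (card {d. d > 0 \<and> d dvd K}) \<le> C * real_of_int K powr (e / 3)"
      using C(2)[of "nat K"] p by simp
    then have "real (card {d. d > 0 \<and> d dvd K}) ^ 3 \<le> (C * real_of_int K powr (e / 3)) ^ 3"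
      by (rule power_mono) simp
    also have "\<dots> = C ^ 3 * real_of_int K powr e"
      using p by (simp add: power_mult_distrib powr_realpow[symmetric] powr_powr)
    finally have 1: "real (card {d. d > 0 \<and> d dvd K}) ^ 3 \<le> C ^ 3 * real_of_int K powr e" .
    have "real (card {(X, Y). X\<^sup>2 + D * Y\<^sup>2 = K}) \<le> real (10 * card {d. d > 0 \<and> d dvd K} ^ 3)"
      using card_binary_representations(2)[OF p] by (rule of_nat_mono)
    then show ?thesis using 1 card_binary_representations(1)[OF p] by simp
  qed
  then show ?thesis using that[of "10 * C ^ 3"] C(1) by simp
qed

text \<open>Fixing all but three coordinates costs at most 3 sqrt E per coordinate and leaves the
  intersection of a sphere with a plane in three dimensions. Its integer points map injectively to
  solutions of X^2 + D Y^2 = K with K at most 256 E^5, hence the exponent e / 5 for the binary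
  form.\<close>

lemma hyperplane_section_bound:
  fixes e :: real
  assumes "e > 0" and dim: "CARD('n::finite) \<ge> 3"
  obtains C where "C > 0"
    "\<And>E (v :: int ^ 'n) c. E \<ge> 1 \<Longrightarrow> v \<noteq> 0 \<Longrightarrow> (\<Sum>i\<in>UNIV. (v $ i)\<^sup>2) \<le> 4 * int E \<Longrightarrow>
       finite {l :: int ^ 'n. (\<Sum>i\<in>UNIV. (l $ i)\<^sup>2) = int E \<and> (\<Sum>i\<in>UNIV. l $ i * v $ i) = c} \<and>
       real (card {l :: int ^ 'n. (\<Sum>i\<in>UNIV. (l $ i)\<^sup>2) = int E \<and> (\<Sum>i\<in>UNIV. l $ i * v $ i) = c})
         \<le> C * real E powr ((real CARD('n) - 3) / 2 + e)"
proof -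
  obtain C0 where C0: "C0 > 0"
    "\<And>D K::int. D > 0 \<Longrightarrow> K > 0 \<Longrightarrow> finite {(X, Y). X\<^sup>2 + D * Y\<^sup>2 = K} \<and>
       real (card {(X, Y). X\<^sup>2 + D * Y\<^sup>2 = K}) \<le> C0 * real_of_int K powr (e / 5)"
    using binary_representations_bound[of "e / 5"] assms by auto
  \<comment> \<open>The summand 1 covers the degenerate section, K = 0; the other one covers 0 < K
    \<le> 256 E^5.\<close>
  define B where "B = 1 + C0 * 256 powr (e / 5)"
  define C where "C = B * 3 ^ (CARD('n) - 3)"
  have B1: "B \<ge> 1" using C0 by (simp add: B_def)
  have main: "finite S \<and> real (card S) \<le> C * real E powr ((real CARD('n) - 3) / 2 + e)"
    if E: "E \<ge> 1" and v: "v \<noteq> 0" and vE: "(\<Sum>i\<in>UNIV. (v $ i)\<^sup>2) \<le> 4 * int E"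
      and S: "S = {l :: int ^ 'n. (\<Sum>i\<in>UNIV. (l $ i)\<^sup>2) = int E \<and> (\<Sum>i\<in>UNIV. l $ i * v $ i) = c}"
    for E v c S
  proof -
    \<comment> \<open>The last of the three free coordinates is one where v does not vanish: there
      the plane equation can be solved.\<close>
    obtain j where j: "v $ j \<noteq> 0" using v by (metis vec_eq_iff zero_index)
    have "UNIV - {j} \<noteq> {}"
    proof
      assume "UNIV - {j} = {}"
      then have "CARD('n) = card {j}" by (metis Diff_eq_empty_iff UNIV_I subsetI subset_antisym)
      then show False using dim by simp
    qed
    then obtain i1 where i1: "i1 \<in> UNIV - {j}" by blast
    have "UNIV - {j, i1} \<noteq> {}"
    proof
      assume "UNIV - {j, i1} = {}"
      then have "CARD('n) = card {j, i1}" by (metis Diff_eq_empty_iff UNIV_I subsetI subset_antisym)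
      then show False using dim card_insert_le_m1[of 2 "{i1}" j] by simp
    qed
    then obtain i2 where i2: "i2 \<in> UNIV - {j} - {i1}" by blast
    define U where "U = UNIV - {i1, i2, j}"
    have dist: "i1 \<noteq> j" "i2 \<noteq> j" "i1 \<noteq> i2" using i1 i2 by auto
    have sumU: "sum h UNIV = h i1 + h i2 + h j + sum h U" for h :: "'n \<Rightarrow> int"
    proof -
      have "UNIV = insert i1 (insert i2 (insert j U))" by (auto simp: U_def)
      then have "sum h UNIV = sum h (insert i1 (insert i2 (insert j U)))" by simp
      then show ?thesis using dist by (simp add: U_def)
    qed
    have cardU: "card U = CARD('n) - 3"
      unfolding U_def using dist by (subst card_Diff_subset) auto
    define s where "s = \<lfloor>sqrt (real E)\<rfloor>"
    have s1: "s \<ge> 1" using E by (simp add: s_def le_floor_iff)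
    have sE: "real_of_int s \<le> sqrt (real E)" by (simp add: s_def)
    define f where "f = (\<lambda>l::int^'n. restrict (\<lambda>i. l $ i) U)"
    define W where "W = PiE U (\<lambda>_. {-s..s})"
    have finW: "finite W" unfolding W_def by (intro finite_PiE) auto
    have im: "f l \<in> W" if "l \<in> S" for l
    proof -
      have "l $ i \<in> {-s..s}" for i
      proof -
        have "(l $ i)\<^sup>2 \<le> (\<Sum>i\<in>UNIV. (l $ i)\<^sup>2)" by (rule member_le_sum) auto
        also have "\<dots> = int E" using that by (simp add: S)
        finally have "real_of_int ((l $ i)\<^sup>2) \<le> real_of_int (int E)" by (rule of_int_le_iff[THEN iffD2])
        then have "(real_of_int (l $ i))\<^sup>2 \<le> real E" by simp
        then have "sqrt ((real_of_int (l $ i))\<^sup>2) \<le> sqrt (real E)" by (rule real_sqrt_le_mono)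
        then have "real_of_int \<bar>l $ i\<bar> \<le> sqrt (real E)" by simp
        then have "\<bar>l $ i\<bar> \<le> s" unfolding s_def by (simp only: le_floor_iff)
        then show ?thesis by auto
      qed
      then show ?thesis by (auto simp: f_def W_def)
    qed
    define k where "k = nat \<lfloor>B * real E powr e\<rfloor>"
    have Ee: "real E powr e \<ge> 1" using E assms by (simp add: ge_one_powr_ge_zero)
    have k: "real k \<le> B * real E powr e" unfolding k_def using B1 by (intro of_nat_floor) simp
    have k': "n \<le> k" if "real n \<le> B * real E powr e" for n
      unfolding k_def using that by (simp add: le_nat_floor)
    have fib: "finite {l\<in>S. f l = b} \<and> card {l\<in>S. f l = b} \<le> k" if "b \<in> W" for b
    proof (cases "{l\<in>S. f l = b} = {}")
      case True show ?thesis by (simp only: True) simp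
    next
      case False
      then obtain l0 where l0: "l0 \<in> S" "f l0 = b" by auto
      define a b' w where "a = v $ i1" and "b' = v $ i2" and "w = v $ j"
      define D where "D = a\<^sup>2 + b'\<^sup>2 + w\<^sup>2"
      define c' where "c' = a * l0 $ i1 + b' * l0 $ i2 + w * l0 $ j"
      define m where "m = (l0 $ i1)\<^sup>2 + (l0 $ i2)\<^sup>2 + (l0 $ j)\<^sup>2"
      have fibeq: "a * l $ i1 + b' * l $ i2 + w * l $ j = c'" "(l $ i1)\<^sup>2 + (l $ i2)\<^sup>2 + (l $ j)\<^sup>2 = m"
        "\<And>i. i \<in> U \<Longrightarrow> l $ i = l0 $ i" if "l \<in> {l\<in>S. f l = b}" for l
      proof -
        have "f l = f l0" using that l0 by simp
        then show eqU: "l $ i = l0 $ i" if "i \<in> U" for i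
          using that unfolding f_def by (metis restrict_apply')
        have "(\<Sum>i\<in>UNIV. (l $ i)\<^sup>2) = (\<Sum>i\<in>UNIV. (l0 $ i)\<^sup>2)"
          "(\<Sum>i\<in>UNIV. l $ i * v $ i) = (\<Sum>i\<in>UNIV. l0 $ i * v $ i)" using that l0 by (auto simp: S)
        then show "a * l $ i1 + b' * l $ i2 + w * l $ j = c'" "(l $ i1)\<^sup>2 + (l $ i2)\<^sup>2 + (l $ j)\<^sup>2 = m"
          using eqU unfolding sumU c'_def m_def a_def b'_def w_def by (simp_all add: mult.commute)
      qed
      have w0: "w \<noteq> 0" using j by (simp add: w_def)
      then have w2: "w\<^sup>2 > 0" by simp
      have D0: "D > 0" using w2 by (simp add: D_def add_nonneg_pos)
      \<comment> \<open>\<open>M\<close> is the squared norm of \<open>D p - c' (a, b', w)\<close>, which is orthogonal to \<open>(a, b', w)\<close>; eliminating its last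
        coordinate and completing the square gives \<open>X\<^sup>2 + D Y\<^sup>2 = K\<close>.\<close>
      define M where "M = D\<^sup>2 * m - D * c'\<^sup>2"
      define K where "K = w\<^sup>2 * (w\<^sup>2 + a\<^sup>2) * M"
      define \<Psi> where "\<Psi> = (\<lambda>l::int^'n. ((w\<^sup>2 + a\<^sup>2) * (D * l $ i1 - c' * a) + a * b' * (D * l $ i2 - c' * b'),
          w * (D * l $ i2 - c' * b')))"
      have \<Psi>: "\<Psi> l \<in> {(X, Y). X\<^sup>2 + D * Y\<^sup>2 = K}" if "l \<in> {l\<in>S. f l = b}" for l
      proof -
        define X Y Z where "X = D * l $ i1 - c' * a" and "Y = D * l $ i2 - c' * b'" and "Z = D * l $ j - c' * w"
        have "a * X + b' * Y + w * Z = D * (a * l $ i1 + b' * l $ i2 + w * l $ j) - c' * D"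
          unfolding X_def Y_def Z_def D_def by (simp add: algebra_simps power2_eq_square)
        also have "\<dots> = 0" using fibeq(1)[OF that] by simp
        finally have "w * Z = - (a * X + b' * Y)" by simp
        then have wZ: "w\<^sup>2 * Z\<^sup>2 = (a * X + b' * Y)\<^sup>2" by (metis power2_minus power_mult_distrib)
        have "X\<^sup>2 + Y\<^sup>2 + Z\<^sup>2 = D\<^sup>2 * ((l $ i1)\<^sup>2 + (l $ i2)\<^sup>2 + (l $ j)\<^sup>2)
            - 2 * D * c' * (a * l $ i1 + b' * l $ i2 + w * l $ j) + c'\<^sup>2 * D"
          unfolding X_def Y_def Z_def D_def by (simp add: algebra_simps power2_eq_square)
        also have "\<dots> = M" unfolding fibeq[OF that] M_def by (simp add: algebra_simps power2_eq_square)
        finally have M: "X\<^sup>2 + Y\<^sup>2 + Z\<^sup>2 = M" .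
        have "K = (w\<^sup>2 + a\<^sup>2) * (w\<^sup>2 * X\<^sup>2 + w\<^sup>2 * Y\<^sup>2 + w\<^sup>2 * Z\<^sup>2)"
          unfolding K_def M[symmetric] by (simp add: algebra_simps)
        also have "\<dots> = ((w\<^sup>2 + a\<^sup>2) * X + a * b' * Y)\<^sup>2 + D * (w * Y)\<^sup>2"
          unfolding wZ D_def by (simp add: algebra_simps power2_eq_square)
        finally show ?thesis by (simp add: \<Psi>_def X_def Y_def)
      qed
      have inj: "inj_on \<Psi> {l\<in>S. f l = b}"
      proof (rule inj_onI)
        fix l l' assume l: "l \<in> {l\<in>S. f l = b}" and l': "l' \<in> {l\<in>S. f l = b}" and eq: "\<Psi> l = \<Psi> l'"
        have y: "l $ i2 = l' $ i2" using eq w0 D0 by (simp add: \<Psi>_def)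
        have "w\<^sup>2 + a\<^sup>2 \<noteq> 0" using w0 by (simp add: add_nonneg_eq_0_iff)
        then have x: "l $ i1 = l' $ i1" using eq y D0 w0 by (auto simp: \<Psi>_def)
        have "w * l $ j = w * l' $ j"
          using fibeq(1)[OF l] fibeq(1)[OF l'] unfolding x y by linarith
        then have z: "l $ j = l' $ j" using w0 by simp
        have "l $ i = l' $ i" for i
        proof (cases "i \<in> U")
          case True then show ?thesis using fibeq(3)[OF l] fibeq(3)[OF l'] by simp
        next
          case False then show ?thesis using x y z by (auto simp: U_def)
        qed
        then show "l = l'" by (simp add: vec_eq_iff)
      qed
      have im\<Psi>: "\<Psi> ` {l\<in>S. f l = b} \<subseteq> {(X, Y). X\<^sup>2 + D * Y\<^sup>2 = K}"
        by (rule image_subsetI) (rule \<Psi>)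
      have K0: "K \<ge> 0"
      proof -
        obtain X Y where "\<Psi> l0 = (X, Y)" by force
        then have "K = X\<^sup>2 + D * Y\<^sup>2" using \<Psi>[of l0] l0 by auto
        then show ?thesis using D0 by simp
      qed
      have "finite {(X, Y). X\<^sup>2 + D * Y\<^sup>2 = K} \<and>
        real (card {(X, Y). X\<^sup>2 + D * Y\<^sup>2 = K}) \<le> B * real E powr e"
      proof (cases "K = 0")
        case True
        \<comment> \<open>K = 0 means M = 0: the sphere touches the plane and the section is a
          single point.\<close>
        have "{(X, Y). X\<^sup>2 + D * Y\<^sup>2 = K} = {(0, 0)}"
          using D0 by (auto simp: True add_nonneg_eq_0_iff)
        moreover have "1 \<le> B * real E powr e" using mult_mono[OF B1 Ee] B1 by simp
        ultimately show ?thesis by simp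
      next
        case False
        then have K: "K > 0" using K0 by simp
        have DE: "D \<le> 4 * int E"
          using vE sumU[of "\<lambda>i. (v $ i)\<^sup>2"] sum_nonneg[of U "\<lambda>i. (v $ i)\<^sup>2"]
          by (simp add: D_def a_def b'_def w_def)
        have mE: "m \<le> int E"
        proof -
          have "(\<Sum>i\<in>UNIV. (l0 $ i)\<^sup>2) = int E" using l0 by (simp add: S)
          then show ?thesis using sumU[of "\<lambda>i. (l0 $ i)\<^sup>2"] sum_nonneg[of U "\<lambda>i. (l0 $ i)\<^sup>2"]
            by (simp add: m_def)
        qed
        have m0: "m \<ge> 0" by (simp add: m_def)
        have M0: "M \<ge> 0" using K w2 by (metis K_def zero_less_mult_pos add_pos_nonneg mult_pos_pos zero_le_power2 less_imp_le)
        \<comment> \<open>Crude sizes: D and w^2 + a^2 are at most 4 E and m is at most E, so K has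
          degree 5 in E.\<close>
        have "M \<le> D\<^sup>2 * m" using D0 by (simp add: M_def)
        also have "\<dots> \<le> (4 * int E)\<^sup>2 * int E"
          using DE D0 mE m0 by (intro mult_mono power_mono) auto
        finally have ME: "M \<le> (4 * int E)\<^sup>2 * int E" .
        have "w\<^sup>2 * (w\<^sup>2 + a\<^sup>2) \<le> (4 * int E) * (4 * int E)"
        proof (rule mult_mono)
          show "w\<^sup>2 \<le> 4 * int E" "w\<^sup>2 + a\<^sup>2 \<le> 4 * int E"
            using DE zero_le_power2[of a] zero_le_power2[of b'] unfolding D_def by linarith+
        qed simp_all
        then have "K \<le> ((4 * int E) * (4 * int E)) * ((4 * int E)\<^sup>2 * int E)"
          unfolding K_def using ME M0 by (intro mult_mono[of "w\<^sup>2 * (w\<^sup>2 + a\<^sup>2)"]) auto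
        also have "\<dots> = 256 * int E ^ 5" by (simp add: eval_nat_numeral)
        finally have "real_of_int K \<le> real_of_int (256 * int E ^ 5)" by (rule of_int_le_iff[THEN iffD2])
        then have "real_of_int K powr (e / 5) \<le> (256 * real E ^ 5) powr (e / 5)"
          using K assms by (intro powr_mono2) auto
        also have "\<dots> = 256 powr (e / 5) * real E powr e"
        proof -
          have "real E ^ 5 = real E powr 5" using E powr_realpow[of "real E" 5] by simp
          then show ?thesis using E by (simp only:) (simp add: powr_mult powr_powr del: powr_numeral)
        qed
        finally have "C0 * real_of_int K powr (e / 5) \<le> C0 * (256 powr (e / 5) * real E powr e)"
          using C0(1) by (intro mult_left_mono) auto
        also have "\<dots> \<le> B * real E powr e" by (simp add: B_def algebra_simps)
        finally show ?thesis using C0(2)[OF D0 K] by linarith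
      qed
      then have fin: "finite {(X, Y). X\<^sup>2 + D * Y\<^sup>2 = K}" and "card {(X, Y). X\<^sup>2 + D * Y\<^sup>2 = K} \<le> k"
        using k' by auto
      moreover have "card {l\<in>S. f l = b} \<le> card {(X, Y). X\<^sup>2 + D * Y\<^sup>2 = K}"
        by (rule card_inj_on_le[OF inj im\<Psi> fin])
      ultimately show ?thesis using inj_on_finite[OF inj im\<Psi> fin] by simp
    qed
    have "card S \<le> k * card W" by (rule card_le_fibers(2)[OF finW im fib])
    also have "card W = nat (2 * s + 1) ^ (CARD('n) - 3)"
      unfolding W_def using s1 by (simp add: card_PiE prod_constant cardU)
    finally have "real (card S) \<le> real (k * nat (2 * s + 1) ^ (CARD('n) - 3))" by (rule of_nat_mono)
    also have "\<dots> = real k * (2 * real_of_int s + 1) ^ (CARD('n) - 3)" using s1 by simp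
    also have "\<dots> \<le> (B * real E powr e) * (3 * sqrt (real E)) ^ (CARD('n) - 3)"
      using k s1 sE B1 by (intro mult_mono power_mono) auto
    also have "\<dots> = C * (real E powr e * sqrt (real E) ^ (CARD('n) - 3))"
      by (simp add: C_def power_mult_distrib)
    also have "sqrt (real E) ^ (CARD('n) - 3) = real E powr ((real CARD('n) - 3) / 2)"
    proof -
      have "sqrt (real E) ^ (CARD('n) - 3) = (real E powr (1 / 2)) powr real (CARD('n) - 3)"
        using E by (subst powr_realpow) (simp_all add: powr_half_sqrt)
      then show ?thesis using dim by (simp add: powr_powr of_nat_diff)
    qed
    also have "real E powr e * real E powr ((real CARD('n) - 3) / 2) = real E powr ((real CARD('n) - 3) / 2 + e)"
      by (simp add: powr_add)
    finally show ?thesis using card_le_fibers(1)[OF finW im fib] by simp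
  qed
  have "C > 0" using B1 by (simp add: C_def)
  then show ?thesis using main[OF _ _ _ refl] by (intro that[of C])
qed

section \<open>Additive energy of the frequencies\<close>

text \<open>For a set with L = -L this is the usual additive energy, the number of solutions of a +
  b = c + d. The form with equal signs is the one that the fourth moment of a cosine sum
  produces.\<close>

definition additive_energy :: "'a::ab_group_add set \<Rightarrow> nat" where
  "additive_energy L = card {(a, b, c, d). a \<in> L \<and> b \<in> L \<and> c \<in> L \<and> d \<in> L \<and> a + b + c + d = 0}"

text \<open>Choose (a, b) first. At most N pairs have a + b = 0, each with at most N completions;
  every other pair leaves the nonzero vector v = -(a + b) to be split as c + d, with at most
  \<open>M\<close> choices of c, and c determines d.\<close>

lemma additive_energy_le:
  fixes L :: "'a::ab_group_add set"
  assumes fin: "finite L"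
    and M: "\<And>v. v \<noteq> 0 \<Longrightarrow> card {l\<in>L. v - l \<in> L} \<le> M"
  shows "additive_energy L \<le> (1 + M) * (card L)\<^sup>2"
proof -
  let ?T = "{(a, b, c, d). a \<in> L \<and> b \<in> L \<and> c \<in> L \<and> d \<in> L \<and> a + b + c + d = 0}"
  let ?f = "\<lambda>(a, b, c::'a, d::'a). (a, b)"
  have finT: "finite ?T" by (rule finite_subset[of _ "L \<times> L \<times> L \<times> L"]) (use fin in auto)
  have fiber: "finite {x\<in>?T. ?f x = (a, b)} \<and> card {x\<in>?T. ?f x = (a, b)} \<le> card {l\<in>L. - (a + b) - l \<in> L}" for a b
  proof
    show "finite {x\<in>?T. ?f x = (a, b)}" using finT by simp
    show "card {x\<in>?T. ?f x = (a, b)} \<le> card {l\<in>L. - (a + b) - l \<in> L}"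
    proof (rule card_inj_on_le[where f = "\<lambda>(a, b, c, d). c"])
      have d: "d = - (a + b) - c" if "a + b + c + d = 0" for c d
        using that by (metis add.commute add_diff_cancel_left' diff_0 diff_diff_eq)
      show "inj_on (\<lambda>(a, b, c, d). c) {x\<in>?T. ?f x = (a, b)}" by (auto intro!: inj_onI dest!: d)
      show "(\<lambda>(a, b, c, d). c) ` {x\<in>?T. ?f x = (a, b)} \<subseteq> {l\<in>L. - (a + b) - l \<in> L}"
        using d by (auto; metis)
      show "finite {l\<in>L. - (a + b) - l \<in> L}" using fin by simp
    qed
  qed
  let ?Z = "{(a, b). a \<in> L \<and> b \<in> L \<and> a + b = 0}"
  have finZ: "finite ?Z" by (rule finite_subset[of _ "L \<times> L"]) (use fin in auto)
  have cardZ: "card ?Z \<le> card L"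
  proof (rule card_inj_on_le[OF _ _ fin])
    show "inj_on fst ?Z" by (auto intro!: inj_onI) (metis add_left_imp_eq)
  qed auto
  have "card {x\<in>?T. ?f x \<in> ?Z} \<le> card L * card ?Z"
  proof (rule card_le_fibers(2)[OF finZ])
    fix p assume p: "p \<in> ?Z"
    obtain a b where ab: "p = (a, b)" by force
    have "{x \<in> {x\<in>?T. ?f x \<in> ?Z}. ?f x = (a, b)} \<subseteq> {x\<in>?T. ?f x = (a, b)}" by blast
    moreover have "card {l\<in>L. - (a + b) - l \<in> L} \<le> card L" using fin by (intro card_mono) auto
    ultimately show "finite {x \<in> {x\<in>?T. ?f x \<in> ?Z}. ?f x = p} \<and> card {x \<in> {x\<in>?T. ?f x \<in> ?Z}. ?f x = p} \<le> card L"
      unfolding ab using fiber[of a b] by (meson card_mono finite_subset order_trans)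
  qed (drule CollectD, erule conjunct2)
  also have "\<dots> \<le> card L * card L" using cardZ by simp
  finally have 1: "card {x\<in>?T. ?f x \<in> ?Z} \<le> card L * card L" .
  have "card {x\<in>?T. ?f x \<notin> ?Z} \<le> M * card (L \<times> L)"
  proof (rule card_le_fibers(2))
    show "finite (L \<times> L)" using fin by simp
    show "?f x \<in> L \<times> L" if "x \<in> {x\<in>?T. ?f x \<notin> ?Z}" for x using that by auto
    fix p assume p: "p \<in> L \<times> L"
    obtain a b where ab: "p = (a, b)" by force
    show "finite {x \<in> {x\<in>?T. ?f x \<notin> ?Z}. ?f x = p} \<and> card {x \<in> {x\<in>?T. ?f x \<notin> ?Z}. ?f x = p} \<le> M"
    proof (cases "a + b = 0")
      case True
      then have "{x \<in> {x\<in>?T. ?f x \<notin> ?Z}. ?f x = p} = {}" using p ab by auto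
      then show ?thesis by (simp only: card.empty finite.emptyI) simp
    next
      case False
      then have "- (a + b) \<noteq> 0" by (metis neg_equal_0_iff_equal)
      then have "card {l\<in>L. - (a + b) - l \<in> L} \<le> M" by (rule M)
      moreover have "{x \<in> {x\<in>?T. ?f x \<notin> ?Z}. ?f x = (a, b)} \<subseteq> {x\<in>?T. ?f x = (a, b)}" by blast
      ultimately show ?thesis
        unfolding ab using fiber[of a b] by (meson card_mono finite_subset order_trans)
    qed
  qed
  then have 2: "card {x\<in>?T. ?f x \<notin> ?Z} \<le> M * (card L * card L)" by (simp add: card_cartesian_product)
  have split: "T = {x\<in>T. P x} \<union> {x\<in>T. \<not> P x}" for T :: "'b set" and P by blast
  have "card ?T \<le> card {x\<in>?T. ?f x \<in> ?Z} + card {x\<in>?T. ?f x \<notin> ?Z}"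
    by (subst split[of ?T "\<lambda>x. ?f x \<in> ?Z"]) (rule card_Un_le)
  then show ?thesis using 1 2 by (simp add: additive_energy_def power2_eq_square algebra_simps)
qed

section \<open>Representations of a vector as a sum of two frequencies\<close>

lemma frequencies_Ints: "l \<in> frequencies E \<Longrightarrow> l $ i \<in> \<int>"
  by (simp add: frequencies_def)

lemma frequencies_norm: "l \<in> frequencies E \<Longrightarrow> (norm l)\<^sup>2 = real E"
  by (simp add: frequencies_def)

lemma norm_eq_sum_squares: "(norm (x::real^'n))\<^sup>2 = (\<Sum>i\<in>UNIV. (x $ i)\<^sup>2)"
  unfolding power2_norm_eq_inner by (simp add: inner_vec_def power2_eq_square)

text \<open>l is equidistant from 0 and v, so it lies on their perpendicular bisector.\<close>

lemma frequencies_difference_inner: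
  fixes v l :: "real ^ 'n"
  assumes "l \<in> frequencies E" "v - l \<in> frequencies E"
  shows "2 * (l \<bullet> v) = (norm v)\<^sup>2"
proof -
  have "(norm (v - l))\<^sup>2 = (norm l)\<^sup>2" using assms by (simp add: frequencies_def)
  then show ?thesis unfolding power2_norm_eq_inner by (simp add: inner_diff inner_commute)
qed

text \<open>In the basis formed by v and its rotation through a right angle, the first coordinate of
  l is fixed by the bisector and the square of the second, \<open>w l\<close>, by the Lagrange
  identity; only a sign is free.\<close>

lemma card_frequencies_difference_planar:
  assumes d: "CARD('n::finite) = 2" and v: "(v :: real ^ 'n) \<noteq> 0"
  shows "card {l\<in>frequencies E. v - l \<in> frequencies E} \<le> 2"
proof -
  let ?S = "{l\<in>frequencies E. v - l \<in> frequencies E}"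
  obtain i j where ij: "(UNIV :: 'n set) = {i, j}" "i \<noteq> j" using d by (metis card_2_iff)
  define w where "w = (\<lambda>l::real^'n. l $ i * v $ j - l $ j * v $ i)"
  have nv: "(norm v)\<^sup>2 = (v $ i)\<^sup>2 + (v $ j)\<^sup>2"
    unfolding norm_eq_sum_squares ij(1) using ij(2) by simp
  have inn: "l $ i * v $ i + l $ j * v $ j = (norm v)\<^sup>2 / 2" if "l \<in> ?S" for l
    using frequencies_difference_inner[of l E v] that ij(2) unfolding inner_vec_def ij(1) by simp
  have w: "(w l)\<^sup>2 = real E * (norm v)\<^sup>2 - ((norm v)\<^sup>2 / 2)\<^sup>2" if "l \<in> ?S" for l
  proof -
    have "(l $ i)\<^sup>2 + (l $ j)\<^sup>2 = real E"
      using frequencies_norm[of l E] that ij(2) unfolding norm_eq_sum_squares ij(1) by simp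
    then have "real E * (norm v)\<^sup>2 = ((l $ i)\<^sup>2 + (l $ j)\<^sup>2) * ((v $ i)\<^sup>2 + (v $ j)\<^sup>2)" using nv by simp
    moreover have "\<dots> = (w l)\<^sup>2 + (l $ i * v $ i + l $ j * v $ j)\<^sup>2"
      unfolding w_def by (simp add: algebra_simps power2_eq_square)
    ultimately show ?thesis using inn[OF that] by simp
  qed
  have "inj_on (\<lambda>l. w l \<ge> 0) ?S"
  proof (rule inj_onI)
    fix l l' assume l: "l \<in> ?S" and l': "l' \<in> ?S" and sg: "(w l \<ge> 0) = (w l' \<ge> 0)"
    have "(w l)\<^sup>2 = (w l')\<^sup>2" using w[OF l] w[OF l'] by simp
    then have ww: "w l = w l'" using sg by (auto simp: power2_eq_iff)
    have f: "(l $ i * v $ i + l $ j * v $ j) * v $ i + w l * v $ j = (norm v)\<^sup>2 * l $ i"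
      "(l $ i * v $ i + l $ j * v $ j) * v $ j - w l * v $ i = (norm v)\<^sup>2 * l $ j" for l
      unfolding nv w_def by (simp_all add: algebra_simps power2_eq_square)
    have "(norm v)\<^sup>2 * l $ i = (norm v)\<^sup>2 * l' $ i" "(norm v)\<^sup>2 * l $ j = (norm v)\<^sup>2 * l' $ j"
      unfolding f[symmetric] inn[OF l] inn[OF l'] ww by simp_all
    then have "l $ i = l' $ i" "l $ j = l' $ j" using v by simp_all
    then have "l $ k = l' $ k" for k using ij(1) by (metis UNIV_I insertE singletonD)
    then show "l = l'" by (simp add: vec_eq_iff)
  qed
  then have "card ?S \<le> card (UNIV :: bool set)" by (rule card_inj_on_le) auto
  then show ?thesis by simp
qed

text \<open>Both summands have norm sqrt E, which gives |v|^2 \<le> 4 E. The componentwise floor,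
  faithful on integral vectors, transfers the hyperplane count to \<open>real ^ 'n\<close>.\<close>

lemma card_frequencies_difference_le:
  fixes e :: real
  assumes "e > 0" and dim: "CARD('n::finite) \<ge> 3"
  obtains C where "C > 0"
    "\<And>E (v :: real ^ 'n). E \<ge> 1 \<Longrightarrow> v \<noteq> 0 \<Longrightarrow>
       real (card {l\<in>frequencies E. v - l \<in> frequencies E}) \<le> C * real E powr ((real CARD('n) - 3) / 2 + e)"
proof -
  obtain C where C: "C > 0"
    "\<And>E (v :: int ^ 'n) c. E \<ge> 1 \<Longrightarrow> v \<noteq> 0 \<Longrightarrow> (\<Sum>i\<in>UNIV. (v $ i)\<^sup>2) \<le> 4 * int E \<Longrightarrow>
       finite {l :: int ^ 'n. (\<Sum>i\<in>UNIV. (l $ i)\<^sup>2) = int E \<and> (\<Sum>i\<in>UNIV. l $ i * v $ i) = c} \<and>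
       real (card {l :: int ^ 'n. (\<Sum>i\<in>UNIV. (l $ i)\<^sup>2) = int E \<and> (\<Sum>i\<in>UNIV. l $ i * v $ i) = c})
         \<le> C * real E powr ((real CARD('n) - 3) / 2 + e)"
    by (rule hyperplane_section_bound[OF assms], rule that)
  have "real (card {l\<in>frequencies E. v - l \<in> frequencies E}) \<le> C * real E powr ((real CARD('n) - 3) / 2 + e)"
    if E: "E \<ge> 1" and v: "v \<noteq> 0" for E and v :: "real ^ 'n"
  proof (cases "{l\<in>frequencies E. v - l \<in> frequencies E} = {}")
    case True
    show ?thesis by (simp only: True) (use C in simp)
  next
    case False
    let ?S = "{l\<in>frequencies E. v - l \<in> frequencies E}"
    define g where "g = (\<lambda>x::real^'n. (\<chi> i. \<lfloor>x $ i\<rfloor>))"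
    have g: "real_of_int (g x $ i) = x $ i" if "\<And>i. x $ i \<in> \<int>" for x i
      using that[of i] by (auto simp: g_def Ints_def)
    obtain l0 where l0: "l0 \<in> ?S" using False by blast
    \<comment> \<open>The integrality of v comes from a member of the set, which is why the empty
      set is treated apart.\<close>
    have vI: "v $ i \<in> \<int>" for i
      using frequencies_Ints[of "v - l0" E i] frequencies_Ints[of l0 E i] l0 Ints_add by fastforce
    \<comment> \<open>All members have the same inner product with v, half of |v|^2; reading it off
      from l0 provides it as an integer.\<close>
    define c where "c = (\<Sum>i\<in>UNIV. g l0 $ i * g v $ i)"
    have sq: "real_of_int (\<Sum>i\<in>UNIV. (g x $ i)\<^sup>2) = (norm x)\<^sup>2" if "\<And>i. x $ i \<in> \<int>" for x
      unfolding norm_eq_sum_squares using g[OF that] by simp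
    have ip: "real_of_int (\<Sum>i\<in>UNIV. g x $ i * g v $ i) = x \<bullet> v" if "\<And>i. x $ i \<in> \<int>" for x
      unfolding inner_vec_def using g[OF that] g[OF vI] by simp
    let ?T = "{l :: int ^ 'n. (\<Sum>i\<in>UNIV. (l $ i)\<^sup>2) = int E \<and> (\<Sum>i\<in>UNIV. l $ i * g v $ i) = c}"
    have "g v \<noteq> 0"
    proof
      assume "g v = 0"
      then have "v $ i = 0" for i using g[OF vI, of i] by simp
      then show False using v by (simp add: vec_eq_iff)
    qed
    moreover have "(\<Sum>i\<in>UNIV. (g v $ i)\<^sup>2) \<le> 4 * int E"
    proof -
      have "norm v \<le> norm l0 + norm (v - l0)" by (metis add.commute diff_add_cancel norm_triangle_ineq)
      also have "\<dots> = 2 * sqrt (real E)"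
      proof -
        have "norm x = sqrt (real E)" if "x \<in> frequencies E" for x :: "real ^ 'n"
          using frequencies_norm[OF that] by (metis norm_ge_zero real_sqrt_unique)
        then show ?thesis using l0 by simp
      qed
      finally have "(norm v)\<^sup>2 \<le> (2 * sqrt (real E))\<^sup>2" by (rule power_mono) simp
      then have "real_of_int (\<Sum>i\<in>UNIV. (g v $ i)\<^sup>2) \<le> real_of_int (4 * int E)"
        unfolding sq[OF vI] by (simp add: power_mult_distrib)
      then show ?thesis by (simp only: of_int_le_iff)
    qed
    ultimately have T: "finite ?T \<and> real (card ?T) \<le> C * real E powr ((real CARD('n) - 3) / 2 + e)"
      using C(2)[OF E] by blast
    have "card ?S \<le> card ?T"
    proof (rule card_inj_on_le)
      show "finite ?T" using T by blast
      show "inj_on g ?S"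
      proof (rule inj_onI)
        fix x y assume "x \<in> ?S" "y \<in> ?S" "g x = g y"
        then have "x $ i = y $ i" for i using g[of x i] g[of y i] frequencies_Ints by fastforce
        then show "x = y" by (simp add: vec_eq_iff)
      qed
      show "g ` ?S \<subseteq> ?T"
      proof (rule image_subsetI)
        fix x assume x: "x \<in> ?S"
        have xI: "x $ i \<in> \<int>" "l0 $ i \<in> \<int>" for i using x l0 frequencies_Ints by blast+
        have "real_of_int (\<Sum>i\<in>UNIV. (g x $ i)\<^sup>2) = real_of_int (int E)"
          using sq[OF xI(1)] x frequencies_norm by auto
        moreover have "real_of_int (\<Sum>i\<in>UNIV. g x $ i * g v $ i) = real_of_int c"
          unfolding c_def ip[OF xI(1)] ip[OF xI(2)]
          using frequencies_difference_inner[of x E v] frequencies_difference_inner[of l0 E v] x l0 by simp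
        ultimately show "g x \<in> ?T" by (simp only: of_int_eq_iff mem_Collect_eq)
      qed
    qed
    then show ?thesis using T by linarith
  qed
  then show ?thesis using that C(1) by blast
qed

section \<open>The torus and the covariance function\<close>

definition torus :: "(real ^ 'n) measure" where
  "torus = restrict_space lborel fundamental_cube"

lemma fundamental_cube_borel [measurable]: "(fundamental_cube :: (real ^ 'n) set) \<in> sets borel"
  unfolding fundamental_cube_def by measurable

lemma fundamental_cube_sets [simp]: "(fundamental_cube :: (real ^ 'n) set) \<inter> space lborel \<in> sets lborel"
  using fundamental_cube_borel by simp

lemma space_torus [simp]: "space torus = fundamental_cube"
  by (simp add: torus_def space_restrict_space)

lemma nn_integral_torus:
  "(\<integral>\<^sup>+x. f x \<partial>torus) = (\<integral>\<^sup>+x. f x * indicator fundamental_cube x \<partial>lborel)"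
  unfolding torus_def by (rule nn_integral_restrict_space) simp

lemma measurable_torus: "f \<in> borel_measurable borel \<Longrightarrow> f \<in> borel_measurable torus"
  unfolding torus_def by (intro measurable_restrict_space1) simp

lemma emeasure_fundamental_cube: "emeasure lborel (fundamental_cube :: (real ^ 'n) set) = 1"
proof -
  have b: "box 0 (1 :: real ^ 'n) \<subseteq> fundamental_cube" "fundamental_cube \<subseteq> cbox 0 (1 :: real ^ 'n)"
    by (auto simp: fundamental_cube_def mem_box_cart less_imp_le)
  have "prod ((\<bullet>) (1 :: real ^ 'n)) Basis = 1"
    by (rule prod.neutral) (auto simp: Basis_vec_def inner_axis)
  moreover have "\<forall>b\<in>Basis. 0 \<bullet> b \<le> (1 :: real ^ 'n) \<bullet> b" by (auto simp: Basis_vec_def inner_axis)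
  ultimately have "emeasure lborel (box 0 (1 :: real ^ 'n)) = 1" "emeasure lborel (cbox 0 (1 :: real ^ 'n)) = 1"
    by (simp_all add: emeasure_lborel_box_eq emeasure_lborel_cbox_eq)
  then show ?thesis
    using emeasure_mono[OF b(1), of lborel] emeasure_mono[OF b(2), of lborel] by simp
qed

lemma prob_space_torus: "prob_space torus"
  by (rule prob_spaceI) (simp add: torus_def emeasure_restrict_space space_restrict_space emeasure_fundamental_cube)

section \<open>Translation invariance of integrals over the torus\<close>

definition integer_vectors :: "(real ^ 'n) set" where
  "integer_vectors = {k. \<forall>i. k $ i \<in> \<int>}"

lemma countable_integer_vectors: "countable (integer_vectors :: (real ^ 'n) set)"
proof -
  have "integer_vectors = (\<lambda>z :: int ^ 'n. (\<chi> i. real_of_int (z $ i)) :: real ^ 'n) ` UNIV"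
  proof (intro set_eqI iffI)
    fix k :: "real ^ 'n" assume k: "k \<in> integer_vectors"
    have "k = (\<chi> i. real_of_int ((\<chi> i. \<lfloor>k $ i\<rfloor>) $ i))"
      using k by (auto simp: vec_eq_iff integer_vectors_def Ints_def)
    then show "k \<in> (\<lambda>z :: int ^ 'n. (\<chi> i. real_of_int (z $ i)) :: real ^ 'n) ` UNIV" by blast
  qed (auto simp: integer_vectors_def)
  moreover have "countable (UNIV :: (int ^ 'n) set)"
  proof -
    have "inj (vec_nth :: int ^ 'n \<Rightarrow> 'n \<Rightarrow> int)" by (rule injI) (simp add: vec_eq_iff)
    moreover have "countable (UNIV :: ('n \<Rightarrow> int) set)" by simp
    ultimately show ?thesis by (meson countable_image_inj_on countable_subset subset_UNIV)
  qed
  ultimately show ?thesis by (metis countable_image)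
qed

lemma ex1_integer_translate:
  fixes z :: "real ^ 'n"
  shows "{k \<in> integer_vectors. z - k \<in> fundamental_cube} = {\<chi> i. real_of_int \<lfloor>z $ i\<rfloor>}"
proof (intro set_eqI iffI)
  fix k assume k: "k \<in> {k \<in> integer_vectors. z - k \<in> fundamental_cube}"
  have "k $ i = real_of_int \<lfloor>z $ i\<rfloor>" for i
  proof -
    obtain m where m: "k $ i = real_of_int m" using k by (auto simp: integer_vectors_def Ints_def)
    have "0 \<le> z $ i - k $ i" "z $ i - k $ i < 1" using k by (auto simp: fundamental_cube_def)
    then have "\<lfloor>z $ i\<rfloor> = m" using m by (intro floor_unique) auto
    then show ?thesis using m by simp
  qed
  then show "k \<in> {\<chi> i. real_of_int \<lfloor>z $ i\<rfloor>}" by (simp add: vec_eq_iff)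
qed (auto simp: integer_vectors_def fundamental_cube_def, linarith+)

text \<open>The integer translates of the half-open cube tile the space without overlap. Written as
  an integral over a counting measure, this partition of unity can be inserted under another
  integral and interchanged with it.\<close>

lemma nn_integral_integer_translates:
  fixes z :: "real ^ 'n"
  shows "(\<integral>\<^sup>+k. indicator fundamental_cube (z - k) \<partial>count_space integer_vectors) = 1"
proof -
  have "(\<integral>\<^sup>+k. indicator fundamental_cube (z - k) \<partial>count_space integer_vectors)
      = (\<integral>\<^sup>+k. indicator {k \<in> integer_vectors. z - k \<in> fundamental_cube} k \<partial>count_space integer_vectors)"
    by (intro nn_integral_cong) (auto simp: indicator_def)
  also have "\<dots> = emeasure (count_space integer_vectors) {k \<in> integer_vectors. z - k \<in> fundamental_cube}"
    by (rule nn_integral_indicator) auto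
  also have "\<dots> = 1"
  proof -
    have "{k \<in> integer_vectors. z - k \<in> fundamental_cube} \<subseteq> integer_vectors" by blast
    then show ?thesis unfolding ex1_integer_translate by (subst emeasure_count_space) auto
  qed
  finally show ?thesis .
qed

lemma nn_integral_lborel_translate:
  fixes h :: "'a::euclidean_space \<Rightarrow> ennreal"
  assumes [measurable]: "h \<in> borel_measurable borel"
  shows "(\<integral>\<^sup>+x. h (c + x) \<partial>lborel) = (\<integral>\<^sup>+x. h x \<partial>lborel)"
  by (subst (2) lborel_distr_plus[symmetric, of c]) (simp add: nn_integral_distr)

text \<open>The cube and its translate are two fundamental domains of one lattice: cut the
  translated cube by the integer translates of the unit cube, move each piece back by periodicity
  and reassemble. For nonnegative functions Tonelli justifies the interchanges.\<close>

lemma nn_integral_torus_translate: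
  fixes h :: "real ^ 'n \<Rightarrow> ennreal"
  assumes [measurable]: "h \<in> borel_measurable borel"
    and per: "\<And>x k. k \<in> integer_vectors \<Longrightarrow> h (x + k) = h x"
  shows "(\<integral>\<^sup>+x. h (x + y) \<partial>torus) = (\<integral>\<^sup>+x. h x \<partial>torus)"
proof -
  let ?C = "fundamental_cube :: (real ^ 'n) set" and ?Z = "integer_vectors :: (real ^ 'n) set"
  have "(\<integral>\<^sup>+x. h (x + y) \<partial>torus) = (\<integral>\<^sup>+x. h (y + x) * indicator ?C ((y + x) - y) \<partial>lborel)"
    by (simp add: nn_integral_torus add.commute)
  also have "\<dots> = (\<integral>\<^sup>+x. h x * indicator ?C (x - y) \<partial>lborel)"
    by (rule nn_integral_lborel_translate[where h = "\<lambda>x. h x * indicator ?C (x - y)"]) measurable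
  also have "\<dots> = (\<integral>\<^sup>+x. (\<integral>\<^sup>+k. h x * indicator ?C (x - y) * indicator ?C (x - k) \<partial>count_space ?Z) \<partial>lborel)"
    by (subst nn_integral_cmult) (simp_all add: nn_integral_integer_translates)
  also have "\<dots> = (\<integral>\<^sup>+k. (\<integral>\<^sup>+x. h x * indicator ?C (x - y) * indicator ?C (x - k) \<partial>lborel) \<partial>count_space ?Z)"
    by (rule nn_integral_count_space_nn_integral[OF countable_integer_vectors]) measurable
  also have "\<dots> = (\<integral>\<^sup>+k. (\<integral>\<^sup>+x. h x * indicator ?C x * indicator ?C (k + x - y) \<partial>lborel) \<partial>count_space ?Z)"
  proof (rule nn_integral_cong)
    fix k assume "k \<in> space (count_space ?Z)"
    then have k: "k \<in> ?Z" by simp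
    have "(\<integral>\<^sup>+x. h x * indicator ?C (x - y) * indicator ?C (x - k) \<partial>lborel)
        = (\<integral>\<^sup>+x. h (k + x) * indicator ?C (k + x - y) * indicator ?C (k + x - k) \<partial>lborel)"
      by (rule nn_integral_lborel_translate[symmetric, where h = "\<lambda>x. h x * indicator ?C (x - y) * indicator ?C (x - k)"])
        measurable
    also have "\<dots> = (\<integral>\<^sup>+x. h x * indicator ?C x * indicator ?C (k + x - y) \<partial>lborel)"
      using per[OF k] by (intro nn_integral_cong) (simp add: add.commute mult_ac)
    finally show "(\<integral>\<^sup>+x. h x * indicator ?C (x - y) * indicator ?C (x - k) \<partial>lborel)
        = (\<integral>\<^sup>+x. h x * indicator ?C x * indicator ?C (k + x - y) \<partial>lborel)" .
  qed
  also have "\<dots> = (\<integral>\<^sup>+x. (\<integral>\<^sup>+k. h x * indicator ?C x * indicator ?C (k + x - y) \<partial>count_space ?Z) \<partial>lborel)"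
    by (rule nn_integral_count_space_nn_integral[OF countable_integer_vectors, symmetric]) measurable
  also have "\<dots> = (\<integral>\<^sup>+x. h x * indicator ?C x * (\<integral>\<^sup>+k. indicator ?C (k + x - y) \<partial>count_space ?Z) \<partial>lborel)"
    by (intro nn_integral_cong nn_integral_cmult) simp
  also have "\<dots> = (\<integral>\<^sup>+x. h x * indicator ?C x \<partial>lborel)"
  proof -
    have "(\<integral>\<^sup>+k. indicator ?C (k + x - y) \<partial>count_space ?Z) = 1" for x
    proof -
      have bij: "bij_betw uminus ?Z ?Z"
        by (rule bij_betw_byWitness[where f' = uminus]) (auto simp: integer_vectors_def)
      have "(\<integral>\<^sup>+k. indicator ?C (k + x - y) \<partial>count_space ?Z) = (\<integral>\<^sup>+k. indicator ?C (- k + x - y) \<partial>count_space ?Z)"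
        by (rule nn_integral_bij_count_space[OF bij, symmetric])
      also have "\<dots> = (\<integral>\<^sup>+k. indicator ?C ((x - y) - k) \<partial>count_space ?Z)"
        by (simp add: algebra_simps)
      also have "\<dots> = 1" by (rule nn_integral_integer_translates)
      finally show ?thesis .
    qed
    then show ?thesis by simp
  qed
  finally show ?thesis by (simp add: nn_integral_torus)
qed

lemma integer_vectors_inner: "k \<in> integer_vectors \<Longrightarrow> l \<in> integer_vectors \<Longrightarrow> k \<bullet> l \<in> \<int>"
  by (auto simp: integer_vectors_def inner_vec_def intro!: Ints_sum Ints_mult)

lemma cos_integer_period:
  assumes "m \<in> \<int>" shows "cos (2 * pi * (t + m)) = cos (2 * pi * t)"
proof -
  obtain n where "m = of_int n" using assms by (auto simp: Ints_def)
  then have "2 * pi * (t + m) = 2 * pi * t + (2 * pi) * of_int n" by (simp add: algebra_simps)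
  then show ?thesis by (simp only: cos_add cos_int_2pin sin_int_2pin mult_1_right mult_zero_right diff_zero)
qed

lemma bounded_integrable_torus:
  fixes f :: "real ^ 'n \<Rightarrow> real"
  assumes "f \<in> borel_measurable borel" "\<And>x. \<bar>f x\<bar> \<le> B"
  shows "integrable torus f"
proof -
  interpret prob_space "torus :: (real ^ 'n) measure" by (rule prob_space_torus)
  show ?thesis using assms by (intro integrable_const_bound[of f B]) (auto intro: measurable_torus)
qed

text \<open>For k \<noteq> 0 a shift by y with \<open>k \<bullet> y = 1 / 2\<close> changes the sign
  of the cosine. The translation rule speaks of nonnegative integrands, so it is applied to 1 +
  cos.\<close>

lemma integral_torus_cos:
  fixes k :: "real ^ 'n"
  assumes k: "k \<in> integer_vectors"
  shows "(\<integral>x. cos (2 * pi * (k \<bullet> x)) \<partial>torus) = of_bool (k = 0)"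
proof (cases "k = 0")
  case True
  interpret prob_space "torus :: (real ^ 'n) measure" by (rule prob_space_torus)
  show ?thesis using True prob_space by simp
next
  case False
  interpret prob_space "torus :: (real ^ 'n) measure" by (rule prob_space_torus)
  obtain i where i: "k $ i \<noteq> 0" using False by (auto simp: vec_eq_iff)
  define y where "y = axis i (1 / (2 * k $ i))"
  have ky: "k \<bullet> y = 1 / 2" using i by (simp add: y_def inner_axis)
  let ?f = "\<lambda>x. cos (2 * pi * (k \<bullet> x))"
  have int: "integrable torus ?f" by (rule bounded_integrable_torus[of _ 1]) auto
  have shift: "?f (x + y) = - ?f x" for x
    by (simp add: inner_add_right ky distrib_left)
  have "(\<integral>\<^sup>+x. ennreal (1 + ?f (x + y)) \<partial>torus) = (\<integral>\<^sup>+x. ennreal (1 + ?f x) \<partial>torus)"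
  proof (rule nn_integral_torus_translate)
    show "ennreal (1 + ?f (x + l)) = ennreal (1 + ?f x)" if "l \<in> integer_vectors" for x l
      using cos_integer_period[OF integer_vectors_inner[OF k that], of "k \<bullet> x"]
      by (simp add: inner_add_right)
  qed measurable
  then have "(\<integral>\<^sup>+x. ennreal (1 - ?f x) \<partial>torus) = (\<integral>\<^sup>+x. ennreal (1 + ?f x) \<partial>torus)"
    unfolding shift by simp
  moreover have "1 - ?f x \<ge> 0" "1 + ?f x \<ge> 0" for x
    using cos_le_one[of "2 * pi * (k \<bullet> x)"] cos_ge_minus_one[of "2 * pi * (k \<bullet> x)"] by linarith+
  ultimately have "ennreal (\<integral>x. 1 - ?f x \<partial>torus) = ennreal (\<integral>x. 1 + ?f x \<partial>torus)"
    using int by (simp add: nn_integral_eq_integral)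
  then have "(\<integral>x. 1 - ?f x \<partial>torus) = (\<integral>x. 1 + ?f x \<partial>torus)"
    using \<open>\<And>x. 1 - ?f x \<ge> 0\<close> \<open>\<And>x. 1 + ?f x \<ge> 0\<close>
    by (subst (asm) ennreal_inj) (auto intro: integral_nonneg)
  then have "(\<integral>x. ?f x \<partial>torus) = 0" using int prob_space by simp
  then show ?thesis using False by simp
qed

section \<open>Moments of the covariance function\<close>

definition covariance :: "(real ^ 'n) set \<Rightarrow> real ^ 'n \<Rightarrow> real" where
  "covariance L x = (\<Sum>l\<in>L. cos (2 * pi * (l \<bullet> x))) / real (card L)"

lemma covariance_measurable [measurable]: "covariance L \<in> borel_measurable borel"
  unfolding covariance_def[abs_def] by measurable

lemma covariance_periodic:
  assumes "L \<subseteq> integer_vectors" "k \<in> integer_vectors"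
  shows "covariance L (x + k) = covariance L x"
  unfolding covariance_def
  using cos_integer_period[OF integer_vectors_inner] assms
  by (auto simp: inner_add_right intro!: sum.cong arg_cong2[where f = "(/)"])

lemma abs_covariance_le_1: "\<bar>covariance L x\<bar> \<le> 1"
proof (cases "finite L \<and> L \<noteq> {}")
  case True
  have "\<bar>\<Sum>l\<in>L. cos (2 * pi * (l \<bullet> x))\<bar> \<le> (\<Sum>l\<in>L. \<bar>cos (2 * pi * (l \<bullet> x))\<bar>)" by (rule sum_abs)
  also have "\<dots> \<le> (\<Sum>l\<in>L. 1)" by (intro sum_mono) simp
  finally show ?thesis using True by (simp add: covariance_def card_gt_0_iff)
qed (auto simp: covariance_def)

text \<open>The sine sum over a symmetric set vanishes, so only the cosine part of the addition
  formula survives. Iterated, this expands powers of the covariance into single cosines.\<close>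

lemma cos_mult_symmetric_sum:
  fixes L :: "(real ^ 'n) set"
  assumes sym: "uminus ` L = L"
  shows "cos (2 * pi * (a \<bullet> x)) * (\<Sum>l\<in>L. cos (2 * pi * (l \<bullet> x))) = (\<Sum>l\<in>L. cos (2 * pi * ((a + l) \<bullet> x)))"
proof -
  have "(\<Sum>l\<in>L. sin (2 * pi * (l \<bullet> x))) = (\<Sum>l\<in>uminus ` L. sin (2 * pi * (l \<bullet> x)))" using sym by simp
  also have "\<dots> = - (\<Sum>l\<in>L. sin (2 * pi * (l \<bullet> x)))"
    by (subst sum.reindex) (auto simp: sum_negf)
  finally have "(\<Sum>l\<in>L. sin (2 * pi * (l \<bullet> x))) = 0" by simp
  then show ?thesis
    by (simp add: inner_add_left distrib_left cos_add sum_subtractf flip: sum_distrib_left)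
qed

lemma integral_covariance_power2:
  fixes L :: "(real ^ 'n) set"
  assumes fin: "finite L" and ne: "L \<noteq> {}" and sym: "uminus ` L = L" and int: "L \<subseteq> integer_vectors"
  shows "(\<integral>x. (covariance L x)\<^sup>2 \<partial>torus) = 1 / real (card L)"
proof -
  have exp: "(covariance L x)\<^sup>2 = (\<Sum>a\<in>L. \<Sum>b\<in>L. cos (2 * pi * ((a + b) \<bullet> x))) / (real (card L))\<^sup>2" for x
    unfolding covariance_def power_divide power2_eq_square[of "sum _ _"] sum_distrib_right
    by (simp add: cos_mult_symmetric_sum[OF sym])
  have "a + b \<in> integer_vectors" if "a \<in> L" "b \<in> L" for a b
    using that int by (auto simp: integer_vectors_def subset_iff intro!: Ints_add)
  then have "(\<integral>x. (covariance L x)\<^sup>2 \<partial>torus) = (\<Sum>a\<in>L. \<Sum>b\<in>L. of_bool (a + b = 0)) / (real (card L))\<^sup>2"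
    unfolding exp
    by (simp add: integral_torus_cos Bochner_Integration.integral_sum bounded_integrable_torus[of _ 1]
        Bochner_Integration.integrable_sum)
  also have "(\<Sum>a\<in>L. \<Sum>b\<in>L. of_bool (a + b = 0)) = real (card L)"
  proof -
    have "(\<Sum>b\<in>L. of_bool (a + b = 0)) = (1::real)" if "a \<in> L" for a
    proof -
      have "(\<Sum>b\<in>L. of_bool (a + b = 0)) = (\<Sum>b\<in>L. if b = - a then 1 else (0::real))"
        by (intro sum.cong) (auto simp: add_eq_0_iff)
      then show ?thesis using fin that sym by (auto simp: image_iff)
    qed
    then show ?thesis by simp
  qed
  finally show ?thesis using fin ne by (simp add: power2_eq_square)
qed

lemma integral_covariance_power4:
  fixes L :: "(real ^ 'n) set"
  assumes fin: "finite L" and sym: "uminus ` L = L" and int: "L \<subseteq> integer_vectors"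
  shows "(\<integral>x. (covariance L x) ^ 4 \<partial>torus)
    = real (additive_energy L) / real (card L) ^ 4"
proof -
  have exp: "(covariance L x) ^ 4 = (\<Sum>a\<in>L. \<Sum>b\<in>L. \<Sum>c\<in>L. \<Sum>d\<in>L. cos (2 * pi * ((a + b + c + d) \<bullet> x))) / (real (card L)) ^ 4" for x
  proof -
    let ?s = "\<Sum>l\<in>L. cos (2 * pi * (l \<bullet> x))"
    have "?s ^ 4 = ?s * ?s * ?s * ?s" by (simp add: eval_nat_numeral)
    also have "\<dots> = (\<Sum>a\<in>L. \<Sum>b\<in>L. \<Sum>c\<in>L. \<Sum>d\<in>L. cos (2 * pi * ((a + b + c + d) \<bullet> x)))"
      by (simp only: sum_distrib_right cos_mult_symmetric_sum[OF sym])
    finally show ?thesis by (simp add: covariance_def power_divide)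
  qed
  have "a + b + c + d \<in> integer_vectors" if "a \<in> L" "b \<in> L" "c \<in> L" "d \<in> L" for a b c d
    using that int by (auto simp: integer_vectors_def subset_iff intro!: Ints_add)
  then have "(\<integral>x. (covariance L x) ^ 4 \<partial>torus)
      = (\<Sum>a\<in>L. \<Sum>b\<in>L. \<Sum>c\<in>L. \<Sum>d\<in>L. of_bool (a + b + c + d = 0)) / (real (card L)) ^ 4"
    unfolding exp
    by (simp add: integral_torus_cos Bochner_Integration.integral_sum bounded_integrable_torus[of _ 1]
        Bochner_Integration.integrable_sum)
  also have "(\<Sum>a\<in>L. \<Sum>b\<in>L. \<Sum>c\<in>L. \<Sum>d\<in>L. of_bool (a + b + c + d = 0))
      = (\<Sum>(a, b, c, d)\<in>L \<times> L \<times> L \<times> L. of_bool (a + b + c + d = 0) :: real)"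
    by (simp add: sum.cartesian_product split_def)
  also have "\<dots> = (\<Sum>p\<in>L \<times> L \<times> L \<times> L. if p \<in> {(a, b, c, d). a + b + c + d = 0} then 1 else (0::real))"
    by (intro sum.cong) auto
  also have "\<dots> = real (card ((L \<times> L \<times> L \<times> L) \<inter> {(a, b, c, d). a + b + c + d = 0}))"
    using fin by (subst sum.inter_restrict[symmetric]) auto
  also have "(L \<times> L \<times> L \<times> L) \<inter> {(a, b, c, d). a + b + c + d = 0}
     = {(a, b, c, d). a \<in> L \<and> b \<in> L \<and> c \<in> L \<and> d \<in> L \<and> a + b + c + d = 0}" by auto
  finally show ?thesis unfolding additive_energy_def .
qed

section \<open>The singular set\<close>

lemma bij_betw_frequencies_involution:
  assumes "\<And>l. \<phi> (\<phi> l) = l" "\<And>l. l \<in> frequencies E \<Longrightarrow> \<phi> l \<in> frequencies E"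
  shows "bij_betw \<phi> (frequencies E) (frequencies E)"
  by (rule bij_betw_byWitness[where f' = \<phi>]) (use assms in auto)

text \<open>The frequencies are permuted by sign changes of one coordinate and by transpositions of
  two. The former kill the mixed second moments, the latter make the pure ones equal, and the pure
  ones add up to N E.\<close>

lemma sum_inner_square_frequencies:
  fixes e :: "real ^ 'n"
  shows "(\<Sum>l\<in>frequencies E. (l \<bullet> e)\<^sup>2)
    = real (card (frequencies E :: (real ^ 'n) set)) * real E / real CARD('n) * (norm e)\<^sup>2"
proof -
  let ?L = "frequencies E :: (real ^ 'n) set"
  have nsq: "(norm x)\<^sup>2 = (\<Sum>i\<in>UNIV. (x $ i)\<^sup>2)" for x :: "real ^ 'n"
    unfolding power2_norm_eq_inner by (simp add: inner_vec_def power2_eq_square)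
  have off: "(\<Sum>l\<in>?L. l $ i * l $ j) = 0" if "i \<noteq> j" for i j
  proof -
    define \<phi> where "\<phi> = (\<lambda>l::real^'n. \<chi> k. if k = i then - (l $ k) else l $ k)"
    have b: "bij_betw \<phi> ?L ?L"
    proof (rule bij_betw_frequencies_involution)
      show "\<phi> (\<phi> l) = l" for l by (simp add: \<phi>_def vec_eq_iff)
      show "\<phi> l \<in> ?L" if "l \<in> ?L" for l
      proof -
        have "(norm (\<phi> l))\<^sup>2 = (norm l)\<^sup>2" unfolding nsq by (intro sum.cong) (auto simp: \<phi>_def)
        then show ?thesis using that by (auto simp: frequencies_def \<phi>_def)
      qed
    qed
    have "(\<Sum>l\<in>?L. l $ i * l $ j) = (\<Sum>l\<in>?L. \<phi> l $ i * \<phi> l $ j)"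
      by (rule sum.reindex_bij_betw[OF b, symmetric])
    also have "\<dots> = - (\<Sum>l\<in>?L. l $ i * l $ j)" using that by (simp add: \<phi>_def sum_negf)
    finally show ?thesis by simp
  qed
  have diag: "(\<Sum>l\<in>?L. (l $ i)\<^sup>2) = (\<Sum>l\<in>?L. (l $ j)\<^sup>2)" for i j
  proof -
    define \<phi> where "\<phi> = (\<lambda>l::real^'n. \<chi> k. l $ (Transposition.transpose i j k))"
    have b: "bij_betw \<phi> ?L ?L"
    proof (rule bij_betw_frequencies_involution)
      show "\<phi> (\<phi> l) = l" for l by (simp add: \<phi>_def vec_eq_iff)
      show "\<phi> l \<in> ?L" if "l \<in> ?L" for l
      proof -
        have "(norm (\<phi> l))\<^sup>2 = (\<Sum>k\<in>UNIV. (l $ (Transposition.transpose i j k))\<^sup>2)"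
          unfolding nsq by (simp add: \<phi>_def)
        also have "\<dots> = (\<Sum>k\<in>UNIV. (l $ k)\<^sup>2)"
          by (rule sum.reindex_bij_betw[OF bij_transpose, where g = "\<lambda>k. (l $ k)\<^sup>2"])
        finally have "(norm (\<phi> l))\<^sup>2 = (norm l)\<^sup>2" unfolding nsq .
        then show ?thesis using that by (auto simp: frequencies_def \<phi>_def)
      qed
    qed
    have "(\<Sum>l\<in>?L. (l $ j)\<^sup>2) = (\<Sum>l\<in>?L. (\<phi> l $ j)\<^sup>2)"
      by (rule sum.reindex_bij_betw[OF b, symmetric])
    also have "\<dots> = (\<Sum>l\<in>?L. (l $ i)\<^sup>2)" by (simp add: \<phi>_def)
    finally show ?thesis by simp
  qed
  have S: "(\<Sum>l\<in>?L. (l $ i)\<^sup>2) = real (card ?L) * real E / real CARD('n)" for i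
  proof -
    have "real CARD('n) * (\<Sum>l\<in>?L. (l $ i)\<^sup>2) = (\<Sum>j\<in>UNIV. \<Sum>l\<in>?L. (l $ j)\<^sup>2)"
    proof -
      have "(\<Sum>j\<in>UNIV. \<Sum>l\<in>?L. (l $ j)\<^sup>2) = (\<Sum>j\<in>(UNIV::'n set). \<Sum>l\<in>?L. (l $ i)\<^sup>2)"
        by (rule sum.cong[OF refl diag])
      then show ?thesis by simp
    qed
    also have "\<dots> = (\<Sum>l\<in>?L. (norm l)\<^sup>2)" unfolding nsq by (rule sum.swap)
    also have "\<dots> = real (card ?L) * real E" by (simp add: frequencies_def)
    finally show ?thesis by (simp add: field_simps)
  qed
  have "(\<Sum>l\<in>?L. (l \<bullet> e)\<^sup>2) = (\<Sum>l\<in>?L. \<Sum>i\<in>UNIV. \<Sum>j\<in>UNIV. (l $ i * l $ j) * (e $ i * e $ j))"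
    by (intro sum.cong) (auto simp: inner_vec_def power2_eq_square sum_product mult_ac)
  also have "\<dots> = (\<Sum>i\<in>UNIV. \<Sum>j\<in>UNIV. (\<Sum>l\<in>?L. l $ i * l $ j) * (e $ i * e $ j))"
    unfolding sum_distrib_right
    by (subst sum.swap, intro sum.cong refl, subst sum.swap) (rule refl)
  also have "\<dots> = (\<Sum>i\<in>UNIV. (\<Sum>l\<in>?L. (l $ i)\<^sup>2) * (e $ i)\<^sup>2)"
  proof (intro sum.cong refl)
    fix i
    have "(\<Sum>j\<in>UNIV. (\<Sum>l\<in>?L. l $ i * l $ j) * (e $ i * e $ j))
      = (\<Sum>j\<in>UNIV. if j = i then (\<Sum>l\<in>?L. (l $ i)\<^sup>2) * (e $ i)\<^sup>2 else 0)"
      by (intro sum.cong) (auto simp: off power2_eq_square)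
    then show "(\<Sum>j\<in>UNIV. (\<Sum>l\<in>?L. l $ i * l $ j) * (e $ i * e $ j)) = (\<Sum>l\<in>?L. (l $ i)\<^sup>2) * (e $ i)\<^sup>2"
      by simp
  qed
  also have "\<dots> = real (card ?L) * real E / real CARD('n) * (norm e)\<^sup>2"
    unfolding S nsq by (rule sum_distrib_left[symmetric])
  finally show ?thesis .
qed

text \<open>The right side is -s times the second derivative of the covariance along
  \<open>y\<close>. If all cosines equalled s, it would be 4 pi^2 (E / d) |y|^2 by isotropy; the
  deviation is at most 4 pi^2 E |y|^2 (1 - s u), and the threshold 1 / (2 d) lets it consume only
  half of that.\<close>

lemma covariance_concave_near_extremum:
  fixes x y :: "real ^ 'n"
  assumes fin: "finite (frequencies E :: (real ^ 'n) set)" and ne: "(frequencies E :: (real ^ 'n) set) \<noteq> {}"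
    and s: "s = 1 \<or> s = - 1"
    and x: "1 - 1 / (2 * real CARD('n)) \<le> s * covariance (frequencies E) x"
  shows "2 * pi\<^sup>2 * real E / real CARD('n) * (norm y)\<^sup>2
    \<le> s / real (card (frequencies E :: (real ^ 'n) set)) *
        (\<Sum>l\<in>frequencies E. (2 * pi * (l \<bullet> y))\<^sup>2 * cos (2 * pi * (l \<bullet> x)))"
proof -
  let ?L = "frequencies E :: (real ^ 'n) set" and ?d = "real CARD('n)"
  define N where "N = real (card ?L)"
  have N: "N > 0" using fin ne by (simp add: N_def card_gt_0_iff)
  define c where "c = (\<lambda>l. cos (2 * pi * (l \<bullet> x)))"
  have sc: "1 - s * c l \<ge> 0" for l
    using s cos_le_one[of "2 * pi * (l \<bullet> x)"] cos_ge_minus_one[of "2 * pi * (l \<bullet> x)"] by (auto simp: c_def)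
  have "(\<Sum>l\<in>?L. (l \<bullet> y)\<^sup>2 * (1 - s * c l)) \<le> (\<Sum>l\<in>?L. (real E * (norm y)\<^sup>2) * (1 - s * c l))"
  proof (intro sum_mono mult_right_mono sc)
    fix l assume "l \<in> ?L"
    then have "(norm l)\<^sup>2 = real E" by (simp add: frequencies_def)
    then show "(l \<bullet> y)\<^sup>2 \<le> real E * (norm y)\<^sup>2"
      using power_mono[OF Cauchy_Schwarz_ineq2[of l y], of 2] by (simp add: power_mult_distrib)
  qed
  also have "\<dots> = real E * (norm y)\<^sup>2 * (N * (1 - s * covariance ?L x))"
    using N by (simp add: covariance_def c_def N_def[symmetric] sum_subtractf algebra_simps flip: sum_distrib_left)
  also have "\<dots> \<le> real E * (norm y)\<^sup>2 * (N * (1 / (2 * ?d)))"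
    using x N by (intro mult_left_mono) auto
  finally have 1: "(\<Sum>l\<in>?L. (l \<bullet> y)\<^sup>2 * (1 - s * c l)) \<le> real E * (norm y)\<^sup>2 * (N * (1 / (2 * ?d)))" .
  have 2: "(\<Sum>l\<in>?L. (l \<bullet> y)\<^sup>2 * (s * c l)) = (\<Sum>l\<in>?L. (l \<bullet> y)\<^sup>2) - (\<Sum>l\<in>?L. (l \<bullet> y)\<^sup>2 * (1 - s * c l))"
    by (simp add: right_diff_distrib sum_subtractf)
  have "N * (real E / (2 * ?d) * (norm y)\<^sup>2) = N * real E / ?d * (norm y)\<^sup>2 - real E * (norm y)\<^sup>2 * (N * (1 / (2 * ?d)))"
    by (simp add: field_simps)
  also have "\<dots> \<le> (\<Sum>l\<in>?L. (l \<bullet> y)\<^sup>2 * (s * c l))"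
    unfolding 2 sum_inner_square_frequencies N_def[symmetric] by (rule diff_left_mono[OF 1])
  finally have "4 * pi\<^sup>2 / N * (N * (real E / (2 * ?d) * (norm y)\<^sup>2))
      \<le> 4 * pi\<^sup>2 / N * (\<Sum>l\<in>?L. (l \<bullet> y)\<^sup>2 * (s * c l))"
    using N by (intro mult_left_mono) auto
  also have "\<dots> = s / N * (\<Sum>l\<in>?L. (2 * pi * (l \<bullet> y))\<^sup>2 * c l)"
    unfolding sum_distrib_left by (intro sum.cong) (auto simp: power_mult_distrib)
  finally have "4 * pi\<^sup>2 / N * (N * (real E / (2 * ?d) * (norm y)\<^sup>2)) \<le> s / N * (\<Sum>l\<in>?L. (2 * pi * (l \<bullet> y))\<^sup>2 * c l)" .
  moreover have "4 * pi\<^sup>2 / N * (N * (real E / (2 * ?d) * (norm y)\<^sup>2)) = 2 * pi\<^sup>2 * real E / ?d * (norm y)\<^sup>2"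
    using N by (simp add: field_simps)
  ultimately show ?thesis by (simp only: N_def c_def)
qed

lemma continuous_on_covariance: "continuous_on S (covariance L)"
  unfolding covariance_def[abs_def] by (cases "card L = 0") (auto intro!: continuous_intros)

text \<open>\<open>z\<close> minimises 1 - s u on S. Taylor's formula along the segment from z to x
  uses only that the value and the first derivative at z are nonnegative, so S need not contain a
  point with |u| = 1.\<close>

lemma quadratic_gap_near_extremum:
  fixes S :: "(real ^ 'n) set"
  assumes fin: "finite (frequencies E :: (real ^ 'n) set)" and ne: "(frequencies E :: (real ^ 'n) set) \<noteq> {}"
    and s: "s = 1 \<or> s = - 1"
    and S: "compact S" "convex S" "S \<noteq> {}"
    and u: "\<And>x. x \<in> S \<Longrightarrow> 1 - 1 / (2 * real CARD('n)) \<le> s * covariance (frequencies E) x"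
  obtains z where "z \<in> S"
    "\<And>x. x \<in> S \<Longrightarrow> pi\<^sup>2 * real E / real CARD('n) * (norm (x - z))\<^sup>2 \<le> 1 - s * covariance (frequencies E) x"
proof -
  let ?L = "frequencies E :: (real ^ 'n) set" and ?d = "real CARD('n)"
  define g where "g = (\<lambda>x. 1 - s * covariance ?L x)"
  have "continuous_on S g" unfolding g_def by (intro continuous_intros continuous_on_covariance)
  then obtain z where z: "z \<in> S" "\<And>x. x \<in> S \<Longrightarrow> g z \<le> g x"
    using continuous_attains_inf[OF S(1,3)] by blast
  have g0: "g x \<ge> 0" for x
    using s abs_covariance_le_1[of ?L x] by (auto simp: g_def abs_le_iff)
  have "pi\<^sup>2 * real E / ?d * (norm (x - z))\<^sup>2 \<le> g x" if x: "x \<in> S" for x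
  proof -
    define y where "y = x - z"
    define k where "k = s / real (card ?L)"
    define p where "p = (\<lambda>t::real. z + t *\<^sub>R y)"
    \<comment> \<open>The restriction of 1 - s u to the segment and its first two derivatives,
      indexed as \<open>Maclaurin\<close> expects them.\<close>
    define D where "D = (\<lambda>m::nat. if m = 0 then (\<lambda>t. 1 - k * (\<Sum>l\<in>?L. cos (2 * pi * (l \<bullet> p t))))
      else if m = 1 then (\<lambda>t. k * (\<Sum>l\<in>?L. (2 * pi * (l \<bullet> y)) * sin (2 * pi * (l \<bullet> p t))))
      else (\<lambda>t. k * (\<Sum>l\<in>?L. (2 * pi * (l \<bullet> y))\<^sup>2 * cos (2 * pi * (l \<bullet> p t)))))"
    have pS: "p t \<in> S" if "0 \<le> t" "t \<le> 1" for t
    proof -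
      have "p t = (1 - t) *\<^sub>R z + t *\<^sub>R x" by (simp add: p_def y_def algebra_simps)
      then show ?thesis using convexD_alt[OF S(2) z(1) x that] by simp
    qed
    have D0: "D 0 t = g (p t)" for t by (simp add: D_def g_def covariance_def k_def)
    have der: "DERIV (D m) t :> D (Suc m) t" if "m < 2" for m t
    proof -
      have m: "m = 0 \<or> m = 1" using that by auto
      have lin: "((\<lambda>t. l \<bullet> p t) has_real_derivative l \<bullet> y) (at t)" for l
        unfolding p_def inner_add_right inner_scaleR_right
        by (auto intro!: derivative_eq_intros)
      show ?thesis using m
      proof
        assume "m = 0"
        then show ?thesis unfolding D_def
          by (auto intro!: derivative_eq_intros lin simp: sum_negf mult_ac)
      next
        assume "m = 1"
        then show ?thesis unfolding D_def
          by (auto intro!: derivative_eq_intros lin simp: power2_eq_square mult_ac)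
      qed
    qed
    have "\<exists>t>0. t < 1 \<and> D 0 1 = (\<Sum>m<2. D m 0 / fact m * 1 ^ m) + D 2 t / fact 2 * 1 ^ 2"
      by (rule Maclaurin) (use der in auto)
    then obtain t where t: "0 < t" "t < 1" and tay: "D 0 1 = D 0 0 + D 1 0 + D 2 t / 2"
      by (auto simp: numeral_2_eq_2)
    \<comment> \<open>z may lie on the boundary of S, so only the sign of the derivative in the
      direction into S is available.\<close>
    have "D 1 0 \<ge> 0"
    proof (rule ccontr)
      assume "\<not> D 1 0 \<ge> 0"
      then have "D 1 0 < 0" by simp
      moreover have "DERIV (D 0) 0 :> D 1 0" using der[of 0 0] by simp
      ultimately obtain r where r: "r > 0" "\<And>h. h > 0 \<Longrightarrow> h < r \<Longrightarrow> D 0 (0 + h) < D 0 0"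
        using DERIV_neg_dec_right by blast
      define h where "h = min (r / 2) 1"
      have h: "h > 0" "h < r" "h \<le> 1" using r by (auto simp: h_def)
      then have "g (p h) < g (p 0)" using r(2)[of h] by (simp add: D0)
      moreover have "g (p 0) \<le> g (p h)" using z(2)[OF pS[of h]] h by (simp add: p_def)
      ultimately show False by simp
    qed
    moreover have "D 0 0 \<ge> 0" using D0 g0 by simp
    moreover have "2 * pi\<^sup>2 * real E / ?d * (norm y)\<^sup>2 \<le> D 2 t"
      using covariance_concave_near_extremum[OF fin ne s u[OF pS[of t]], of y] t
      by (simp add: D_def k_def)
    ultimately have "2 * pi\<^sup>2 * real E / ?d * (norm y)\<^sup>2 / 2 \<le> D 0 1"
      unfolding tay by (metis (no_types, opaque_lifting) add_increasing add_nonneg_nonneg divide_right_mono zero_le_numeral)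
    moreover have "D 0 1 = g x" by (simp add: D0 p_def y_def)
    ultimately show ?thesis by (simp add: y_def)
  qed
  then show ?thesis using that z(1) by (simp add: g_def)
qed

lemma covariance_Lipschitz:
  fixes x y :: "real ^ 'n"
  assumes fin: "finite (frequencies E :: (real ^ 'n) set)" and ne: "(frequencies E :: (real ^ 'n) set) \<noteq> {}"
  shows "\<bar>covariance (frequencies E) x - covariance (frequencies E) y\<bar> \<le> 2 * pi * sqrt (real E) * norm (x - y)"
proof -
  let ?L = "frequencies E :: (real ^ 'n) set"
  have N: "real (card ?L) > 0" using fin ne by (simp add: card_gt_0_iff)
  have cosL: "\<bar>cos a - cos b\<bar> \<le> \<bar>a - b\<bar>" for a b :: real
  proof -
    have "cos a - cos b = 2 * sin ((a + b) / 2) * sin ((b - a) / 2)" by (rule cos_diff_cos)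
    then have "\<bar>cos a - cos b\<bar> = 2 * (\<bar>sin ((a + b) / 2)\<bar> * \<bar>sin ((b - a) / 2)\<bar>)" by (simp add: abs_mult)
    also have "\<dots> \<le> 2 * (1 * \<bar>(b - a) / 2\<bar>)"
      by (intro mult_left_mono mult_mono abs_sin_x_le_abs_x) auto
    finally show ?thesis by simp
  qed
  have "\<bar>\<Sum>l\<in>?L. cos (2 * pi * (l \<bullet> x)) - cos (2 * pi * (l \<bullet> y))\<bar>
      \<le> (\<Sum>l\<in>?L. \<bar>cos (2 * pi * (l \<bullet> x)) - cos (2 * pi * (l \<bullet> y))\<bar>)" by (rule sum_abs)
  also have "\<dots> \<le> (\<Sum>l\<in>?L. 2 * pi * sqrt (real E) * norm (x - y))"
  proof (rule sum_mono)
    fix l assume "l \<in> ?L"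
    then have nl: "norm l = sqrt (real E)" by (auto simp: frequencies_def intro!: real_sqrt_unique[symmetric])
    have "\<bar>cos (2 * pi * (l \<bullet> x)) - cos (2 * pi * (l \<bullet> y))\<bar> \<le> \<bar>2 * pi * (l \<bullet> x) - 2 * pi * (l \<bullet> y)\<bar>" by (rule cosL)
    also have "\<dots> = 2 * pi * \<bar>l \<bullet> (x - y)\<bar>"
      by (simp add: inner_diff_right abs_mult flip: right_diff_distrib)
    also have "\<dots> \<le> 2 * pi * (norm l * norm (x - y))"
      by (intro mult_left_mono Cauchy_Schwarz_ineq2) auto
    finally show "\<bar>cos (2 * pi * (l \<bullet> x)) - cos (2 * pi * (l \<bullet> y))\<bar> \<le> 2 * pi * sqrt (real E) * norm (x - y)"
      by (simp add: nl)
  qed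
  finally show ?thesis using N
    by (simp add: covariance_def sum_subtractf abs_divide pos_divide_le_eq mult.commute flip: diff_divide_distrib)
qed

text \<open>A majorant of product type, so that the integral over a cube factors into
  one-dimensional ones: |y| dominates each coordinate, and the exponent is shared equally among the
  d coordinates. The value \<top> at a zero coordinate is essential because \<open>0 powr _\<close>
  is 0.\<close>

lemma norm_powr_le_prod:
  fixes y :: "real ^ 'n" and p :: real
  assumes "y \<noteq> 0" "p \<ge> 0"
  shows "ennreal (norm y powr (- p)) \<le>
    (\<Prod>i\<in>UNIV. if y $ i = 0 then \<top> else ennreal (\<bar>y $ i\<bar> powr (- (p / real CARD('n)))))"
proof -
  have "ennreal (norm y powr (- p)) = (\<Prod>i\<in>(UNIV :: 'n set). ennreal (norm y powr (- (p / real CARD('n)))))"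
  proof -
    have "norm y powr (- p) = (norm y powr (- (p / real CARD('n)))) powr real CARD('n)"
      by (simp add: powr_powr)
    also have "\<dots> = (norm y powr (- (p / real CARD('n)))) ^ CARD('n)"
      using assms by (subst powr_realpow) auto
    finally show ?thesis by (simp add: ennreal_power)
  qed
  also have "\<dots> \<le> (\<Prod>i\<in>UNIV. if y $ i = 0 then \<top> else ennreal (\<bar>y $ i\<bar> powr (- (p / real CARD('n)))))"
  proof (rule prod_mono_ennreal)
    fix i
    show "ennreal (norm y powr (- (p / real CARD('n)))) \<le>
      (if y $ i = 0 then \<top> else ennreal (\<bar>y $ i\<bar> powr (- (p / real CARD('n)))))"
      using component_le_norm_cart[of y i] assms by (auto intro!: ennreal_leI powr_mono2')
  qed
  finally show ?thesis .
qed

text \<open>Each side of q contributes at most h^(1 - a) / (1 - a), and 1 / (1 - a) \<le> 4. The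
  point t = q, where the integrand is infinite, is a null set.\<close>

lemma nn_integral_powr_singularity:
  fixes a h q :: real
  assumes a: "0 \<le> a" "a \<le> 3 / 4" and h: "h > 0" and q: "c \<le> q" "q \<le> c + h"
  shows "(\<integral>\<^sup>+t. indicator {c..c + h} t * (if t - q = 0 then \<top> else ennreal (\<bar>t - q\<bar> powr (- a))) \<partial>lborel)
    \<le> ennreal (8 * h powr (1 - a))"
proof -
  let ?g = "\<lambda>t. indicator {0..h} t * ennreal (t powr (- a))"
  have g: "(\<integral>\<^sup>+t. ?g t \<partial>lborel) = ennreal (h powr (1 - a) / (1 - a))"
  proof -
    have "(\<integral>\<^sup>+t. ?g t \<partial>lborel) = (\<integral>\<^sup>+t. ennreal (indicator {0..h} t * t powr (- a)) \<partial>lborel)"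
      by (intro nn_integral_cong) (simp add: indicator_def)
    then show ?thesis
      using nn_integral_has_integral_lebesgue[OF _ has_integral_powr_from_0[of "- a" h]] a h
      by (simp add: add.commute)
  qed
  have "(\<integral>\<^sup>+t. indicator {c..c + h} t * (if t - q = 0 then \<top> else ennreal (\<bar>t - q\<bar> powr (- a))) \<partial>lborel)
     \<le> (\<integral>\<^sup>+t. ?g (t - q) + ?g (q - t) \<partial>lborel)"
  proof (rule nn_integral_mono_AE)
    have "AE t in lborel. t \<noteq> q" by (rule AE_lborel_singleton)
    then show "AE t in lborel. indicator {c..c + h} t * (if t - q = 0 then \<top> else ennreal (\<bar>t - q\<bar> powr (- a)))
        \<le> ?g (t - q) + ?g (q - t)"
    proof eventually_elim
      case (elim t)
      then show ?case using q by (auto simp: indicator_def abs_if)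
    qed
  qed
  also have "\<dots> = (\<integral>\<^sup>+t. ?g (t - q) \<partial>lborel) + (\<integral>\<^sup>+t. ?g (q - t) \<partial>lborel)"
    by (rule nn_integral_add) measurable
  also have "(\<integral>\<^sup>+t. ?g (t - q) \<partial>lborel) = (\<integral>\<^sup>+t. ?g t \<partial>lborel)"
    using nn_integral_real_affine[of ?g 1 "- q"] by simp
  also have "(\<integral>\<^sup>+t. ?g (q - t) \<partial>lborel) = (\<integral>\<^sup>+t. ?g t \<partial>lborel)"
    using nn_integral_real_affine[of ?g "-1" q] by simp
  also have "(\<integral>\<^sup>+t. ?g t \<partial>lborel) + (\<integral>\<^sup>+t. ?g t \<partial>lborel) = ennreal (2 * (h powr (1 - a) / (1 - a)))"
    unfolding g using a by (subst ennreal_plus[symmetric]) auto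
  also have "\<dots> \<le> ennreal (8 * h powr (1 - a))"
  proof (rule ennreal_leI)
    have "h powr (1 - a) / (1 - a) \<le> h powr (1 - a) / (1 / 4)"
      using a by (intro divide_left_mono) auto
    then show "2 * (h powr (1 - a) / (1 - a)) \<le> 8 * h powr (1 - a)" by simp
  qed
  finally show ?thesis .
qed

lemma nn_integral_norm_singularity:
  fixes z c :: "real ^ 'n"
  assumes d: "CARD('n) \<ge> 2" and h: "h > 0" and z: "\<And>i. c $ i \<le> z $ i \<and> z $ i \<le> c $ i + h"
  shows "(\<integral>\<^sup>+x. indicator {x. \<forall>i. c $ i \<le> x $ i \<and> x $ i \<le> c $ i + h} x *
       (if x = z then \<top> else ennreal (norm (x - z) powr (- (3 / 2)))) \<partial>lborel)
    \<le> ennreal (8 ^ CARD('n) * h powr (real CARD('n) - 3 / 2))"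
proof -
  \<comment> \<open>For d \<ge> 2 the exponent per coordinate is at most 3/4, safely below 1; here
    the dimension enters the integrability of |x|^(-3/2).\<close>
  define a where "a = 3 / 2 / real CARD('n)"
  have a: "0 \<le> a" "a \<le> 3 / 4" using d by (auto simp: a_def field_simps)
  define f where "f = (\<lambda>i t. indicator {c $ i..c $ i + h} t *
      (if t - z $ i = 0 then \<top> else ennreal (\<bar>t - z $ i\<bar> powr (- a))))"
  have [measurable]: "f i \<in> borel_measurable borel" for i unfolding f_def by measurable
  have Basis_prod: "(\<Prod>b\<in>(Basis :: (real ^ 'n) set). F b) = (\<Prod>i\<in>UNIV. F (axis i 1))" for F :: "real ^ 'n \<Rightarrow> ennreal"
  proof -
    have "(Basis :: (real ^ 'n) set) = (\<lambda>i. axis i 1) ` UNIV" by (auto simp: Basis_vec_def)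
    moreover have "inj (\<lambda>i::'n. axis i (1::real))" by (rule injI) (simp add: axis_eq_axis)
    ultimately show ?thesis by (subst prod.reindex_cong[of "\<lambda>i. axis i 1" UNIV]) auto
  qed
  \<comment> \<open>Recovers the coordinate from a basis vector, since the product rule for
    \<open>lborel\<close> is indexed by \<open>Basis\<close>.\<close>
  define ix where "ix = (\<lambda>b :: real ^ 'n. THE i. b = axis i 1)"
  have ix: "ix (axis i 1) = i" for i unfolding ix_def by (rule the_equality) (auto simp: axis_eq_axis)
  have "indicator {x. \<forall>i. c $ i \<le> x $ i \<and> x $ i \<le> c $ i + h} x *
       (if x = z then \<top> else ennreal (norm (x - z) powr (- (3 / 2)))) \<le> (\<Prod>i\<in>UNIV. f i (x $ i))" for x
  proof (cases "\<forall>i. c $ i \<le> x $ i \<and> x $ i \<le> c $ i + h")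
    case True
    then have "(\<Prod>i\<in>UNIV. f i (x $ i)) = (\<Prod>i\<in>UNIV. if (x - z) $ i = 0 then \<top> else ennreal (\<bar>(x - z) $ i\<bar> powr (- a)))"
      by (intro prod.cong) (auto simp: f_def)
    moreover have "(\<Prod>i\<in>(UNIV::'n set). (\<top>::ennreal)) = \<top>" by simp
    ultimately show ?thesis
      using norm_powr_le_prod[of "x - z" "3 / 2", folded a_def] True by (auto simp: indicator_def)
  qed (auto simp: indicator_def)
  then have "(\<integral>\<^sup>+x. indicator {x. \<forall>i. c $ i \<le> x $ i \<and> x $ i \<le> c $ i + h} x *
       (if x = z then \<top> else ennreal (norm (x - z) powr (- (3 / 2)))) \<partial>lborel)
     \<le> (\<integral>\<^sup>+x. (\<Prod>i\<in>UNIV. f i (x $ i)) \<partial>lborel)" by (intro nn_integral_mono)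
  also have "\<dots> = (\<integral>\<^sup>+x. (\<Prod>b\<in>Basis. f (ix b) (x \<bullet> b)) \<partial>lborel)"
    by (simp add: Basis_prod ix inner_axis)
  also have "\<dots> = (\<Prod>b\<in>(Basis :: (real ^ 'n) set). \<integral>\<^sup>+t. f (ix b) t \<partial>lborel)"
    by (rule nn_integral_lborel_prod) auto
  also have "\<dots> = (\<Prod>i\<in>UNIV. \<integral>\<^sup>+t. f i t \<partial>lborel)" by (simp add: Basis_prod ix)
  also have "\<dots> \<le> (\<Prod>i\<in>(UNIV :: 'n set). ennreal (8 * h powr (1 - a)))"
    unfolding f_def using z nn_integral_powr_singularity[OF a h] by (intro prod_mono_ennreal) auto
  also have "\<dots> = ennreal ((8 * h powr (1 - a)) ^ CARD('n))" by (simp add: ennreal_power)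
  also have "(8 * h powr (1 - a)) ^ CARD('n) = 8 ^ CARD('n) * h powr (real CARD('n) - 3 / 2)"
  proof -
    have "(h powr (1 - a)) ^ CARD('n) = h powr ((1 - a) * real CARD('n))"
      using h by (subst powr_realpow[symmetric]) (auto simp: powr_powr)
    also have "(1 - a) * real CARD('n) = real CARD('n) - 3 / 2" using d by (simp add: a_def field_simps)
    finally show ?thesis by (simp add: power_mult_distrib)
  qed
  finally show ?thesis .
qed

text \<open>The value \<open>\<top>\<close> replaces the junk value \<open>0 powr (- (3 / 4)) = 0\<close>, so that finiteness of an integral
  also shows \<open>\<bar>r\<bar> < 1\<close> almost everywhere.\<close>

definition sing_weight :: "real \<Rightarrow> ennreal" where
  "sing_weight r = (if \<bar>r\<bar> \<ge> 1 then \<top> else ennreal ((1 - r\<^sup>2) powr (- (3 / 4))))"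

lemma sing_weight_measurable [measurable]: "sing_weight \<in> borel_measurable borel"
  unfolding sing_weight_def[abs_def] by measurable

lemma sing_weight_le:
  assumes "0 < e" "e \<le> 1 - \<bar>r\<bar>" "e \<le> 1"
  shows "sing_weight r \<le> ennreal (e powr (- (3 / 4)))"
proof -
  have "e * 1 \<le> (1 - \<bar>r\<bar>) * (1 + \<bar>r\<bar>)" using assms by (intro mult_mono) auto
  also have "\<dots> = 1 - r\<^sup>2" by (simp add: algebra_simps power2_eq_square)
  finally show ?thesis using assms by (auto simp: sing_weight_def intro!: ennreal_leI powr_mono2')
qed

text \<open>\<open>hE\<close> limits the oscillation of u on the cell to 1 / (4 d). Either |u| \<le>
  1 - 1 / (4 d) throughout and the weight is bounded, or this fails at some point; then u keeps one
  sign with |u| \<ge> 1 - 1 / (2 d) on the whole cell, and the quadratic gap applies.\<close>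

lemma sing_weight_cell_bound:
  fixes c :: "real ^ 'n"
  assumes d: "CARD('n) \<ge> 2" and E: "E \<ge> 1"
    and fin: "finite (frequencies E :: (real ^ 'n) set)" and ne: "(frequencies E :: (real ^ 'n) set) \<noteq> {}"
    and h: "h > 0" and hE: "2 * pi * sqrt (real E) * (real CARD('n) * h) \<le> 1 / (4 * real CARD('n))"
  defines "Q \<equiv> {x :: real ^ 'n. \<forall>i. c $ i \<le> x $ i \<and> x $ i \<le> c $ i + h}"
  obtains "\<And>x. x \<in> Q \<Longrightarrow> sing_weight (covariance (frequencies E) x) \<le> ennreal (4 * real CARD('n))"
  | "\<And>x. x \<in> Q \<Longrightarrow> \<bar>covariance (frequencies E) x\<bar> \<ge> 1 / 2"
    "(\<integral>\<^sup>+x. indicator Q x * sing_weight (covariance (frequencies E) x) \<partial>lborel)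
      \<le> ennreal (8 ^ CARD('n) * (real CARD('n) / real E) powr (3 / 4) * h powr (real CARD('n) - 3 / 2))"
proof -
  let ?u = "covariance (frequencies E) :: real ^ 'n \<Rightarrow> real" and ?d = "real CARD('n)"
  have d0: "?d \<ge> 2" using d by simp
  have Qcbox: "Q = cbox c (\<chi> i. c $ i + h)" by (auto simp: Q_def mem_box_cart)
  have var: "\<bar>?u x - ?u y\<bar> \<le> 1 / (4 * ?d)" if "x \<in> Q" "y \<in> Q" for x y
  proof -
    have "norm (x - y) \<le> (\<Sum>i\<in>UNIV. \<bar>(x - y) $ i\<bar>)" by (rule norm_le_l1_cart)
    also have "\<dots> \<le> (\<Sum>i\<in>(UNIV::'n set). h)"
    proof (rule sum_mono)
      fix i
      have "c $ i \<le> x $ i" "x $ i \<le> c $ i + h" "c $ i \<le> y $ i" "y $ i \<le> c $ i + h" using that by (auto simp: Q_def)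
      then show "\<bar>(x - y) $ i\<bar> \<le> h" by (simp add: abs_le_iff)
    qed
    finally have "norm (x - y) \<le> ?d * h" by simp
    then have "2 * pi * sqrt (real E) * norm (x - y) \<le> 2 * pi * sqrt (real E) * (?d * h)"
      by (intro mult_left_mono) auto
    then show ?thesis using covariance_Lipschitz[OF fin ne, of x y] hE by linarith
  qed
  show ?thesis
  proof (cases "\<forall>x\<in>Q. \<bar>?u x\<bar> \<le> 1 - 1 / (4 * ?d)")
    case True
    have "sing_weight (?u x) \<le> ennreal (4 * ?d)" if "x \<in> Q" for x
    proof -
      have "sing_weight (?u x) \<le> ennreal ((1 / (4 * ?d)) powr (- (3 / 4)))"
      proof (rule sing_weight_le)
        show "1 / (4 * ?d) \<le> 1 - \<bar>?u x\<bar>" using True that by fastforce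
      qed (use d0 in auto)
      also have "(1 / (4 * ?d)) powr (- (3 / 4)) = (4 * ?d) powr (3 / 4)"
        by (simp add: powr_minus powr_divide)
      also have "\<dots> \<le> (4 * ?d) powr 1" using d0 by (intro powr_mono) auto
      finally show ?thesis using d0 by (simp add: ennreal_leI)
    qed
    then show ?thesis using that(1) by blast
  next
    case False
    then obtain x0 where x0: "x0 \<in> Q" "\<bar>?u x0\<bar> > 1 - 1 / (4 * ?d)" by force
    define s :: real where "s = (if ?u x0 \<ge> 0 then 1 else - 1)"
    have s: "s = 1 \<or> s = - 1" by (simp add: s_def)
    have sx0: "s * ?u x0 = \<bar>?u x0\<bar>" by (simp add: s_def)
    have su: "1 - 1 / (2 * ?d) \<le> s * ?u x" if "x \<in> Q" for x
    proof -
      have "\<bar>s * ?u x0 - s * ?u x\<bar> \<le> 1 / (4 * ?d)" using var[OF x0(1) that] s by (auto simp: abs_minus_commute)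
      moreover have "1 / (2 * ?d) = 1 / (4 * ?d) + 1 / (4 * ?d)" by (simp add: field_simps)
      ultimately show ?thesis using x0(2) sx0 by linarith
    qed
    have half: "s * ?u x \<ge> 1 / 2" if "x \<in> Q" for x
    proof -
      have "1 / (2 * ?d) \<le> 1 / 2" using d0 by (simp add: field_simps)
      then show ?thesis using su[OF that] by linarith
    qed
    have abs: "\<bar>?u x\<bar> = s * ?u x" if "x \<in> Q" for x using half[OF that] s by auto
    have "compact Q" "convex Q" "Q \<noteq> {}" using x0 unfolding Qcbox by auto
    then obtain z where z: "z \<in> Q" "\<And>x. x \<in> Q \<Longrightarrow> pi\<^sup>2 * real E / ?d * (norm (x - z))\<^sup>2 \<le> 1 - s * ?u x"
      using quadratic_gap_near_extremum[OF fin ne s _ _ _ su] by metis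
    \<comment> \<open>The gap gives 1 - |u| \<ge> (E / d) |x - z|^2, and \<open>K\<close> is the
      constant that the power -3/4 leaves.\<close>
    define K where "K = (?d / real E) powr (3 / 4)"
    have K: "K > 0" using E d0 by (simp add: K_def)
    have le: "indicator Q x * sing_weight (?u x)
        \<le> ennreal K * (indicator Q x * (if x = z then \<top> else ennreal (norm (x - z) powr (- (3 / 2)))))" for x
    proof (cases "x \<in> Q \<and> x \<noteq> z")
      case True
      define e where "e = real E / ?d * (norm (x - z))\<^sup>2"
      have e0: "e > 0" using True E d0 by (simp add: e_def)
      have "1 \<le> pi\<^sup>2" using pi_ge_two by (intro one_le_power) linarith
      then have "1 * e \<le> pi\<^sup>2 * e" using e0 by (intro mult_right_mono) auto
      then have e1: "e \<le> 1 - \<bar>?u x\<bar>" using z(2)[of x] True abs[of x] by (simp add: e_def)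
      have "sing_weight (?u x) \<le> ennreal (e powr (- (3 / 4)))"
        by (rule sing_weight_le) (use e0 e1 in auto)
      also have "e powr (- (3 / 4)) = K * norm (x - z) powr (- (3 / 2))"
      proof -
        have "((norm (x - z))\<^sup>2) powr (- (3 / 4)) = norm (x - z) powr (- (3 / 2))"
          using True powr_realpow[of "norm (x - z)" 2, symmetric] by (simp add: powr_powr del: powr_numeral)
        moreover have "(real E / ?d) powr (- (3 / 4)) = K"
          by (simp add: K_def powr_minus_divide powr_divide)
        ultimately show ?thesis unfolding e_def by (subst powr_mult) simp_all
      qed
      finally show ?thesis using True K by (simp add: ennreal_mult)
    next
      case False
      show ?thesis
      proof (cases "x \<in> Q")
        case True
        have "ennreal K * \<top> = \<top>" using K by (simp add: ennreal_mult_eq_top_iff)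
        moreover have "x = z" using False True by simp
        ultimately show ?thesis using True by simp
      qed simp
    qed
    have "(\<integral>\<^sup>+x. indicator Q x * sing_weight (?u x) \<partial>lborel)
      \<le> (\<integral>\<^sup>+x. ennreal K * (indicator Q x * (if x = z then \<top> else ennreal (norm (x - z) powr (- (3 / 2))))) \<partial>lborel)"
      by (rule nn_integral_mono) (rule le)
    also have "\<dots> = ennreal K * (\<integral>\<^sup>+x. indicator Q x * (if x = z then \<top> else ennreal (norm (x - z) powr (- (3 / 2)))) \<partial>lborel)"
    proof (rule nn_integral_cmult)
      have [measurable]: "Q \<in> sets borel" unfolding Qcbox by simp
      show "(\<lambda>x. indicator Q x * (if x = z then \<top> else ennreal (norm (x - z) powr (- (3 / 2))))) \<in> borel_measurable lborel"
        by measurable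
    qed
    also have "\<dots> \<le> ennreal K * ennreal (8 ^ CARD('n) * h powr (?d - 3 / 2))"
      unfolding Q_def using z(1) by (intro mult_left_mono nn_integral_norm_singularity d h) (auto simp: Q_def)
    also have "\<dots> = ennreal (8 ^ CARD('n) * K * h powr (?d - 3 / 2))"
      using K by (simp add: ennreal_mult[symmetric] mult_ac)
    finally show ?thesis using that(2) half abs by (auto simp: K_def)
  qed
qed

text \<open>The cell of x is read off from the floors of m x; half-open cells partition the
  half-open cube exactly, so integrals split without boundary terms.\<close>

lemma fundamental_cube_cells:
  fixes m :: nat
  assumes m: "m > 0"
  defines "cell \<equiv> \<lambda>z :: 'n \<Rightarrow> nat. {x :: real ^ 'n. \<forall>i. real (z i) / real m \<le> x $ i \<and> x $ i < (real (z i) + 1) / real m}"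
  shows "indicator fundamental_cube x = (\<Sum>z\<in>PiE UNIV (\<lambda>_. {..<m}). indicator (cell z) x :: ennreal)"
proof -
  let ?Z = "PiE UNIV (\<lambda>_. {..<m}) :: ('n \<Rightarrow> nat) set"
  have finZ: "finite ?Z" by (intro finite_PiE) auto
  have cell: "x \<in> cell z \<longleftrightarrow> (\<forall>i. real (z i) \<le> real m * x $ i \<and> real m * x $ i < real (z i) + 1)" for z
    using m by (auto simp: cell_def field_simps)
  show ?thesis
  proof (cases "x \<in> fundamental_cube")
    case True
    define z0 where "z0 = (\<lambda>i. nat \<lfloor>real m * x $ i\<rfloor>)"
    have x: "0 \<le> real m * x $ i" "real m * x $ i < real m" for i
      using True m by (auto simp: fundamental_cube_def)
    have z0: "z0 \<in> ?Z" using x by (auto simp: z0_def nat_less_iff floor_less_iff)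
    have iff: "x \<in> cell z \<longleftrightarrow> z = z0" for z
    proof
      assume "x \<in> cell z"
      then have "\<lfloor>real m * x $ i\<rfloor> = int (z i)" for i unfolding cell by (intro floor_unique) auto
      then show "z = z0" by (auto simp: z0_def)
    next
      assume "z = z0"
      moreover have "real (z0 i) = of_int \<lfloor>real m * x $ i\<rfloor>" for i using x(1)[of i] by (simp add: z0_def)
      ultimately show "x \<in> cell z" unfolding cell
        by (metis floor_correct of_int_add of_int_1)
    qed
    have "(\<Sum>z\<in>?Z. indicator (cell z) x :: ennreal) = (\<Sum>z\<in>?Z. if z = z0 then 1 else 0)"
      by (intro sum.cong) (auto simp: indicator_def iff)
    then show ?thesis using z0 finZ True by simp
  next
    case False
    have "x \<notin> cell z" if "z \<in> ?Z" for z
    proof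
      assume "x \<in> cell z"
      have "0 \<le> x $ i \<and> x $ i < 1" for i
      proof -
        have "real (z i) \<le> real m * x $ i" "real m * x $ i < real (z i) + 1" using \<open>x \<in> cell z\<close> unfolding cell by auto
        moreover have "z i < m" using that by (auto simp: PiE_def Pi_def)
        then have "real (z i + 1) \<le> real m" by (intro of_nat_mono) simp
        then have "real (z i) + 1 \<le> real m" by simp
        ultimately have "0 \<le> real m * x $ i" "real m * x $ i < real m * 1" by linarith+
        then show ?thesis using m by (simp only: zero_le_mult_iff mult_less_cancel_left) auto
      qed
      then show False using False by (simp add: fundamental_cube_def)
    qed
    then show ?thesis using False by (simp add: indicator_def)
  qed
qed

text \<open>With h of order E^(-1/2), the bound E^(-3/4) h^(d - 3/2) for a bad cell is a constant
  times its volume h^d, uniformly in E, and summation over the cells gives the first estimate. For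
  the second, each bad cell is charged to itself: there u^4 \<ge> 1/16, so its volume is at most 16
  times its share of the integral of u^4.\<close>

lemma covariance_sing_weight_bound:
  assumes d: "CARD('n::finite) \<ge> 2"
  obtains C where "C > 0"
    "\<And>E. E \<ge> 1 \<Longrightarrow> finite (frequencies E :: (real ^ 'n) set) \<Longrightarrow> (frequencies E :: (real ^ 'n) set) \<noteq> {} \<Longrightarrow>
      (\<integral>\<^sup>+x. sing_weight (covariance (frequencies E :: (real ^ 'n) set) x) \<partial>torus) \<le> ennreal C"
    "\<And>E. E \<ge> 1 \<Longrightarrow> finite (frequencies E :: (real ^ 'n) set) \<Longrightarrow> (frequencies E :: (real ^ 'n) set) \<noteq> {} \<Longrightarrow>
      (\<integral>\<^sup>+x. ennreal (covariance (frequencies E :: (real ^ 'n) set) x ^ 4) * sing_weight (covariance (frequencies E) x) \<partial>torus)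
        \<le> ennreal C * (\<integral>\<^sup>+x. ennreal (covariance (frequencies E :: (real ^ 'n) set) x ^ 4) \<partial>torus)"
proof -
  let ?d = "real CARD('n)"
  \<comment> \<open>m will be the ceiling of 8 pi d^2 sqrt E, the least number of subdivisions that
    the oscillation bound permits; the extra 1 absorbs the rounding because sqrt E \<ge> 1.\<close>
  define c where "c = 8 * pi * ?d\<^sup>2 + 1"
  define C1 where "C1 = 8 ^ CARD('n) * ?d powr (3 / 4) * c powr (3 / 2)"
  \<comment> \<open>4 d serves the cells on which |u| stays away from 1, and 16 C1 the
    others.\<close>
  define C where "C = 4 * ?d + 16 * C1"
  have c0: "c > 0" unfolding c_def by (intro add_nonneg_pos) auto
  have C1: "C1 > 0" using c0 by (simp add: C1_def)
  have main: "(\<integral>\<^sup>+x. sing_weight (u x) \<partial>torus) \<le> ennreal C \<and>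
      (\<integral>\<^sup>+x. ennreal (u x ^ 4) * sing_weight (u x) \<partial>torus) \<le> ennreal C * (\<integral>\<^sup>+x. ennreal (u x ^ 4) \<partial>torus)"
    if E: "E \<ge> 1" and fin: "finite (frequencies E :: (real ^ 'n) set)" and ne: "(frequencies E :: (real ^ 'n) set) \<noteq> {}"
      and u: "u = covariance (frequencies E :: (real ^ 'n) set)" for E u
  proof -
    define m where "m = nat \<lceil>8 * pi * ?d\<^sup>2 * sqrt (real E)\<rceil>"
    have sE: "sqrt (real E) \<ge> 1" using E by simp
    have pos: "8 * pi * ?d\<^sup>2 * sqrt (real E) > 0" using E by simp
    have mge: "8 * pi * ?d\<^sup>2 * sqrt (real E) \<le> real m" unfolding m_def by (rule real_nat_ceiling_ge)
    have m0: "m > 0" using mge pos by (intro Nat.gr0I) simp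
    have "real m \<le> 8 * pi * ?d\<^sup>2 * sqrt (real E) + 1"
      using pos unfolding m_def by (simp add: of_nat_nat ceiling_le_iff)
    also have "\<dots> \<le> c * sqrt (real E)" using sE by (simp add: c_def algebra_simps)
    finally have mle: "real m \<le> c * sqrt (real E)" .
    define h where "h = 1 / real m"
    have h: "h > 0" using m0 by (simp add: h_def)
    have hE: "2 * pi * sqrt (real E) * (?d * h) \<le> 1 / (4 * ?d)"
      using mge m0 by (simp add: h_def field_simps power2_eq_square)
    let ?Z = "PiE UNIV (\<lambda>_. {..<m}) :: ('n \<Rightarrow> nat) set"
    have finZ: "finite ?Z" by (intro finite_PiE) auto
    have cardZ: "card ?Z = m ^ CARD('n)" by (simp add: card_PiE)
    define cell where "cell = (\<lambda>z :: 'n \<Rightarrow> nat. {x :: real ^ 'n. \<forall>i. real (z i) / real m \<le> x $ i \<and> x $ i < (real (z i) + 1) / real m})"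
    have cell_meas[measurable]: "cell z \<in> sets borel" for z unfolding cell_def by measurable
    have u_meas[measurable]: "u \<in> borel_measurable borel" unfolding u by (rule covariance_measurable)
    have decomp: "(\<integral>\<^sup>+x. f x \<partial>torus) = (\<Sum>z\<in>?Z. \<integral>\<^sup>+x. indicator (cell z) x * f x \<partial>lborel)"
      if [measurable]: "f \<in> borel_measurable borel" for f :: "real ^ 'n \<Rightarrow> ennreal"
    proof -
      have "indicator fundamental_cube x = (\<Sum>z\<in>?Z. indicator (cell z) x :: ennreal)" for x
        unfolding cell_def by (rule fundamental_cube_cells[OF m0])
      then have "(\<integral>\<^sup>+x. f x \<partial>torus) = (\<integral>\<^sup>+x. (\<Sum>z\<in>?Z. indicator (cell z) x * f x) \<partial>lborel)"
        by (simp add: nn_integral_torus sum_distrib_left mult.commute)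
      also have "\<dots> = (\<Sum>z\<in>?Z. \<integral>\<^sup>+x. indicator (cell z) x * f x \<partial>lborel)"
        by (rule nn_integral_sum) measurable
      finally show ?thesis .
    qed
    have cell_box: "emeasure lborel (cell z) = ennreal (h ^ CARD('n))" for z
    proof -
      define a b where "a = (\<chi> i. real (z i) / real m)" and "b = (\<chi> i. (real (z i) + 1) / real m)"
      have ab: "a $ i \<le> b $ i" "b $ i - a $ i = h" for i by (auto simp: a_def b_def h_def divide_right_mono add_divide_distrib)
      have sub: "box a b \<subseteq> cell z" "cell z \<subseteq> cbox a b"
        by (auto simp: cell_def a_def b_def mem_box_cart less_imp_le)
      have "prod ((\<bullet>) (b - a)) Basis = (\<Prod>b\<in>(Basis :: (real^'n) set). h)"
        by (rule prod.cong) (auto simp: Basis_vec_def inner_axis ab)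
      then have "prod ((\<bullet>) (b - a)) Basis = h ^ CARD('n)" by simp
      moreover have "\<forall>i\<in>Basis. a \<bullet> i \<le> b \<bullet> i" using ab by (auto simp: Basis_vec_def inner_axis)
      ultimately have "emeasure lborel (box a b) = ennreal (h ^ CARD('n))" "emeasure lborel (cbox a b) = ennreal (h ^ CARD('n))"
        by (simp_all add: emeasure_lborel_box_eq emeasure_lborel_cbox_eq)
      then show ?thesis
        using emeasure_mono[OF sub(1), of lborel] emeasure_mono[OF sub(2), of lborel] by simp
    qed
    have K: "8 ^ CARD('n) * (?d / real E) powr (3 / 4) * h powr (?d - 3 / 2) \<le> C1 * h ^ CARD('n)"
    proof -
      have "h powr (?d - 3 / 2) = h ^ CARD('n) * real m powr (3 / 2)"
        using m0 h by (simp add: powr_diff powr_realpow h_def powr_divide power_divide)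
      also have "\<dots> \<le> h ^ CARD('n) * (c * sqrt (real E)) powr (3 / 2)"
        using mle h by (intro mult_left_mono powr_mono2) auto
      also have "(c * sqrt (real E)) powr (3 / 2) = c powr (3 / 2) * real E powr (3 / 4)"
        by (simp add: powr_mult powr_half_sqrt[symmetric] powr_powr)
      finally have "8 ^ CARD('n) * (?d / real E) powr (3 / 4) * h powr (?d - 3 / 2)
        \<le> 8 ^ CARD('n) * (?d / real E) powr (3 / 4) * (h ^ CARD('n) * (c powr (3 / 2) * real E powr (3 / 4)))"
        by (intro mult_left_mono) auto
      also have "\<dots> = C1 * h ^ CARD('n)" using E by (simp add: C1_def powr_divide)
      finally show ?thesis .
    qed
    have each: "(\<integral>\<^sup>+x. indicator (cell z) x * sing_weight (u x) \<partial>lborel) \<le> ennreal (C * h ^ CARD('n)) \<and>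
        (\<integral>\<^sup>+x. indicator (cell z) x * (ennreal (u x ^ 4) * sing_weight (u x)) \<partial>lborel)
          \<le> ennreal C * (\<integral>\<^sup>+x. indicator (cell z) x * ennreal (u x ^ 4) \<partial>lborel)" for z
    proof -
      let ?c = "(\<chi> i. real (z i) / real m) :: real ^ 'n"
      let ?Q = "{x :: real ^ 'n. \<forall>i. ?c $ i \<le> x $ i \<and> x $ i \<le> ?c $ i + h}"
      have sub: "cell z \<subseteq> ?Q" by (auto simp: cell_def h_def add_divide_distrib less_imp_le)
      have dC: "ennreal (4 * ?d) \<le> ennreal C" using C1 by (intro ennreal_leI) (simp add: C_def)
      from sing_weight_cell_bound[OF d E fin ne h hE, of ?c]
      show ?thesis
      proof cases
        case 1
        then have w: "sing_weight (u x) \<le> ennreal C" if "x \<in> cell z" for x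
          using that sub dC unfolding u by (meson order_trans subsetD)
        have "(\<integral>\<^sup>+x. indicator (cell z) x * sing_weight (u x) \<partial>lborel) \<le> (\<integral>\<^sup>+x. ennreal C * indicator (cell z) x \<partial>lborel)"
          using w by (intro nn_integral_mono) (auto simp: indicator_def)
        also have "\<dots> = ennreal C * ennreal (h ^ CARD('n))"
          by (subst nn_integral_cmult_indicator) (auto simp: cell_box)
        also have "\<dots> = ennreal (C * h ^ CARD('n))" using h by (simp add: ennreal_mult'')
        finally have A: "(\<integral>\<^sup>+x. indicator (cell z) x * sing_weight (u x) \<partial>lborel) \<le> ennreal (C * h ^ CARD('n))" .
        have "(\<integral>\<^sup>+x. indicator (cell z) x * (ennreal (u x ^ 4) * sing_weight (u x)) \<partial>lborel)
            \<le> (\<integral>\<^sup>+x. ennreal C * (indicator (cell z) x * ennreal (u x ^ 4)) \<partial>lborel)"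
          using w by (intro nn_integral_mono) (auto simp: indicator_def mult.commute[of "ennreal (u _ ^ 4)"] intro!: mult_right_mono)
        also have "\<dots> = ennreal C * (\<integral>\<^sup>+x. indicator (cell z) x * ennreal (u x ^ 4) \<partial>lborel)"
          by (rule nn_integral_cmult) measurable
        finally show ?thesis using A by blast
      next
        case 2
        have "(\<integral>\<^sup>+x. indicator (cell z) x * sing_weight (u x) \<partial>lborel) \<le> (\<integral>\<^sup>+x. indicator ?Q x * sing_weight (u x) \<partial>lborel)"
          using sub by (intro nn_integral_mono mult_right_mono) (auto simp: indicator_def)
        also have "\<dots> \<le> ennreal (C1 * h ^ CARD('n))"
          using 2(2) ennreal_leI[OF K] unfolding u by (rule order_trans)
        finally have A: "(\<integral>\<^sup>+x. indicator (cell z) x * sing_weight (u x) \<partial>lborel) \<le> ennreal (C1 * h ^ CARD('n))" .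
        have low: "ennreal (h ^ CARD('n)) \<le> 16 * (\<integral>\<^sup>+x. indicator (cell z) x * ennreal (u x ^ 4) \<partial>lborel)"
        proof -
          have "ennreal (h ^ CARD('n)) = (\<integral>\<^sup>+x. indicator (cell z) x \<partial>lborel)" by (simp add: cell_box)
          also have "\<dots> \<le> (\<integral>\<^sup>+x. 16 * (indicator (cell z) x * ennreal (u x ^ 4)) \<partial>lborel)"
          proof (intro nn_integral_mono)
            fix x
            show "indicator (cell z) x \<le> 16 * (indicator (cell z) x * ennreal (u x ^ 4))"
            proof (cases "x \<in> cell z")
              case True
              then have "1 / 2 \<le> \<bar>u x\<bar>" using 2(1) sub unfolding u by blast
              then have "(1 / 2) ^ 4 \<le> \<bar>u x\<bar> ^ 4" by (intro power_mono) auto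
              then have "1 \<le> 16 * u x ^ 4" by (simp add: power_divide)
              then have "ennreal 1 \<le> ennreal (16 * u x ^ 4)" by (rule ennreal_leI)
              also have "\<dots> = 16 * ennreal (u x ^ 4)" by (subst ennreal_mult) auto
              finally show ?thesis using True by simp
            qed simp
          qed
          also have "\<dots> = 16 * (\<integral>\<^sup>+x. indicator (cell z) x * ennreal (u x ^ 4) \<partial>lborel)"
            by (rule nn_integral_cmult) measurable
          finally show ?thesis .
        qed
        have "(\<integral>\<^sup>+x. indicator (cell z) x * (ennreal (u x ^ 4) * sing_weight (u x)) \<partial>lborel)
            \<le> (\<integral>\<^sup>+x. indicator (cell z) x * sing_weight (u x) \<partial>lborel)"
        proof (intro nn_integral_mono)
          fix x
          have "\<bar>u x\<bar> ^ 4 \<le> 1" using abs_covariance_le_1[of _ x] unfolding u by (intro power_le_one) auto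
          then have "ennreal (u x ^ 4) \<le> 1" by simp
          then have "ennreal (u x ^ 4) * sing_weight (u x) \<le> 1 * sing_weight (u x)" by (rule mult_right_mono) simp
          then show "indicator (cell z) x * (ennreal (u x ^ 4) * sing_weight (u x)) \<le> indicator (cell z) x * sing_weight (u x)"
            by (simp add: indicator_def)
        qed
        also note A
        also have "ennreal (C1 * h ^ CARD('n)) = ennreal C1 * ennreal (h ^ CARD('n))"
          using h by (simp add: ennreal_mult'')
        also have "\<dots> \<le> ennreal C1 * (16 * (\<integral>\<^sup>+x. indicator (cell z) x * ennreal (u x ^ 4) \<partial>lborel))"
          by (intro mult_left_mono low) simp
        also have "\<dots> = ennreal (16 * C1) * (\<integral>\<^sup>+x. indicator (cell z) x * ennreal (u x ^ 4) \<partial>lborel)"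
          using C1 by (simp add: ennreal_mult mult_ac)
        also have "\<dots> \<le> ennreal C * (\<integral>\<^sup>+x. indicator (cell z) x * ennreal (u x ^ 4) \<partial>lborel)"
          by (intro mult_right_mono ennreal_leI) (auto simp: C_def)
        finally have B: "(\<integral>\<^sup>+x. indicator (cell z) x * (ennreal (u x ^ 4) * sing_weight (u x)) \<partial>lborel)
          \<le> ennreal C * (\<integral>\<^sup>+x. indicator (cell z) x * ennreal (u x ^ 4) \<partial>lborel)" .
        have "C1 * h ^ CARD('n) \<le> C * h ^ CARD('n)"
          using h C1 by (intro mult_right_mono) (auto simp: C_def)
        then show ?thesis using A B by (meson ennreal_leI order_trans)
      qed
    qed
    have "(\<integral>\<^sup>+x. sing_weight (u x) \<partial>torus) = (\<Sum>z\<in>?Z. \<integral>\<^sup>+x. indicator (cell z) x * sing_weight (u x) \<partial>lborel)"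
      by (rule decomp) measurable
    also have "\<dots> \<le> (\<Sum>z\<in>?Z. ennreal (C * h ^ CARD('n)))"
      by (rule sum_mono) (rule conjunct1[OF each])
    also have "\<dots> = ennreal C"
    proof -
      have "(\<Sum>z\<in>?Z. ennreal (C * h ^ CARD('n))) = ennreal (real (card ?Z) * (C * h ^ CARD('n)))"
        by (subst sum_ennreal) (use h C1 in \<open>auto simp: C_def\<close>)
      also have "real (card ?Z) * (C * h ^ CARD('n)) = C"
        using m0 by (simp add: cardZ h_def power_divide)
      finally show ?thesis .
    qed
    finally have 1: "(\<integral>\<^sup>+x. sing_weight (u x) \<partial>torus) \<le> ennreal C" .
    have "(\<integral>\<^sup>+x. ennreal (u x ^ 4) * sing_weight (u x) \<partial>torus)
       = (\<Sum>z\<in>?Z. \<integral>\<^sup>+x. indicator (cell z) x * (ennreal (u x ^ 4) * sing_weight (u x)) \<partial>lborel)"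
      by (rule decomp) measurable
    also have "\<dots> \<le> (\<Sum>z\<in>?Z. ennreal C * (\<integral>\<^sup>+x. indicator (cell z) x * ennreal (u x ^ 4) \<partial>lborel))"
      by (rule sum_mono) (rule conjunct2[OF each])
    also have "\<dots> = ennreal C * (\<Sum>z\<in>?Z. \<integral>\<^sup>+x. indicator (cell z) x * ennreal (u x ^ 4) \<partial>lborel)"
      by (rule sum_distrib_left[symmetric])
    also have "(\<Sum>z\<in>?Z. \<integral>\<^sup>+x. indicator (cell z) x * ennreal (u x ^ 4) \<partial>lborel) = (\<integral>\<^sup>+x. ennreal (u x ^ 4) \<partial>torus)"
      by (rule decomp[symmetric]) measurable
    finally show ?thesis using 1 by blast
  qed
  have "C > 0" using C1 by (simp add: C_def add_nonneg_pos)
  then show ?thesis using main[OF _ _ _ refl] by (intro that[of C]) blast+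
qed

section \<open>Pairs of Gaussian linear forms\<close>

abbreviation std_normal :: "real measure" where
  "std_normal \<equiv> density lborel std_normal_density"

interpretation std_normal: prob_space std_normal
  by (rule prob_space_normal_density) simp

interpretation std_normal_pair: pair_sigma_finite std_normal std_normal ..

text \<open>A rotation with c \<noteq> 0 factors into two affine substitutions in one variable each,
  whose factors 1 / |c| and |c| cancel. A quarter turn, c = 0, swaps the variables up to
  signs.\<close>

lemma nn_integral_lborel_rotate:
  fixes H :: "real \<Rightarrow> real \<Rightarrow> ennreal"
  assumes [measurable]: "case_prod H \<in> borel_measurable (borel \<Otimes>\<^sub>M borel)"
    and cs: "c\<^sup>2 + s\<^sup>2 = 1"
  shows "(\<integral>\<^sup>+x. \<integral>\<^sup>+y. H (c * x - s * y) (s * x + c * y) \<partial>lborel \<partial>lborel) = (\<integral>\<^sup>+x. \<integral>\<^sup>+y. H x y \<partial>lborel \<partial>lborel)"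
proof (cases "c = 0")
  case False
  have 1: "(\<integral>\<^sup>+y. H (c * x - s * y) (s * x + c * y) \<partial>lborel)
      = ennreal (1 / \<bar>c\<bar>) * (\<integral>\<^sup>+y. H ((x - s * y) / c) y \<partial>lborel)" for x
  proof -
    have e: "(x - s * (s * x + c * y)) / c = c * x - s * y" for y
    proof -
      have "x - s * (s * x + c * y) = x * (1 - s\<^sup>2) - s * c * y" by (simp add: algebra_simps power2_eq_square)
      also have "1 - s\<^sup>2 = c\<^sup>2" using cs by simp
      finally show ?thesis using False by (simp add: field_simps power2_eq_square)
    qed
    have "(\<integral>\<^sup>+y. H ((x - s * y) / c) y \<partial>lborel)
      = ennreal \<bar>c\<bar> * (\<integral>\<^sup>+y. H ((x - s * (s * x + c * y)) / c) (s * x + c * y) \<partial>lborel)"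
      by (rule nn_integral_real_affine[OF _ False]) measurable
    then show ?thesis using False
      by (simp add: e ennreal_mult[symmetric] mult.assoc[symmetric])
  qed
  have 2: "(\<integral>\<^sup>+x. H ((x - s * y) / c) y \<partial>lborel) = ennreal \<bar>c\<bar> * (\<integral>\<^sup>+x. H x y \<partial>lborel)" for y
  proof -
    have "(\<integral>\<^sup>+x. H x y \<partial>lborel) = ennreal \<bar>1 / c\<bar> * (\<integral>\<^sup>+x. H (- s * y / c + 1 / c * x) y \<partial>lborel)"
      by (rule nn_integral_real_affine) (use False in auto)
    moreover have "- s * y / c + 1 / c * x = (x - s * y) / c" for x using False by (simp add: field_simps)
    ultimately show ?thesis using False
      by (simp add: ennreal_mult[symmetric] mult.assoc[symmetric])
  qed
  have "(\<integral>\<^sup>+x. \<integral>\<^sup>+y. H (c * x - s * y) (s * x + c * y) \<partial>lborel \<partial>lborel)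
      = ennreal (1 / \<bar>c\<bar>) * (\<integral>\<^sup>+x. \<integral>\<^sup>+y. H ((x - s * y) / c) y \<partial>lborel \<partial>lborel)"
    unfolding 1 by (rule nn_integral_cmult) measurable
  also have "(\<integral>\<^sup>+x. \<integral>\<^sup>+y. H ((x - s * y) / c) y \<partial>lborel \<partial>lborel) = (\<integral>\<^sup>+y. \<integral>\<^sup>+x. H ((x - s * y) / c) y \<partial>lborel \<partial>lborel)"
    by (rule lborel_pair.Fubini'[symmetric]) measurable
  also have "\<dots> = ennreal \<bar>c\<bar> * (\<integral>\<^sup>+y. \<integral>\<^sup>+x. H x y \<partial>lborel \<partial>lborel)"
    unfolding 2 by (rule nn_integral_cmult) measurable
  also have "(\<integral>\<^sup>+y. \<integral>\<^sup>+x. H x y \<partial>lborel \<partial>lborel) = (\<integral>\<^sup>+x. \<integral>\<^sup>+y. H x y \<partial>lborel \<partial>lborel)"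
    by (rule lborel_pair.Fubini') measurable
  finally show ?thesis using False by (simp add: ennreal_mult[symmetric] mult.assoc[symmetric])
next
  case True
  then have s: "\<bar>s\<bar> = 1" "s \<noteq> 0" using cs by (auto simp: power2_eq_1_iff)
  have "(\<integral>\<^sup>+x. \<integral>\<^sup>+y. H (c * x - s * y) (s * x + c * y) \<partial>lborel \<partial>lborel)
      = (\<integral>\<^sup>+x. \<integral>\<^sup>+y. H (0 + (- s) * y) (s * x) \<partial>lborel \<partial>lborel)" using True by simp
  also have "\<dots> = (\<integral>\<^sup>+x. \<integral>\<^sup>+y. H y (s * x) \<partial>lborel \<partial>lborel)"
  proof (rule nn_integral_cong)
    fix x
    show "(\<integral>\<^sup>+y. H (0 + (- s) * y) (s * x) \<partial>lborel) = (\<integral>\<^sup>+y. H y (s * x) \<partial>lborel)"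
      using nn_integral_real_affine[of "\<lambda>y. H y (s * x)" "- s" 0] s by simp
  qed
  also have "\<dots> = (\<integral>\<^sup>+y. \<integral>\<^sup>+x. H y (0 + s * x) \<partial>lborel \<partial>lborel)"
    by (simp, rule lborel_pair.Fubini'[symmetric]) measurable
  also have "\<dots> = (\<integral>\<^sup>+y. \<integral>\<^sup>+x. H y x \<partial>lborel \<partial>lborel)"
  proof (rule nn_integral_cong)
    fix y
    show "(\<integral>\<^sup>+x. H y (0 + s * x) \<partial>lborel) = (\<integral>\<^sup>+x. H y x \<partial>lborel)"
      using nn_integral_real_affine[of "\<lambda>x. H y x" s 0] s by simp
  qed
  finally show ?thesis .
qed

lemma nn_integral_std_normal2:
  fixes F :: "real \<Rightarrow> real \<Rightarrow> ennreal"
  assumes [measurable]: "case_prod F \<in> borel_measurable (borel \<Otimes>\<^sub>M borel)"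
  shows "(\<integral>\<^sup>+x. \<integral>\<^sup>+y. F x y \<partial>std_normal \<partial>std_normal)
    = (\<integral>\<^sup>+x. \<integral>\<^sup>+y. ennreal (exp (- (x\<^sup>2 + y\<^sup>2) / 2) / (2 * pi)) * F x y \<partial>lborel \<partial>lborel)"
proof -
  have e: "exp (- (x\<^sup>2 + y\<^sup>2) / 2) / (2 * pi) = std_normal_density x * std_normal_density y" for x y
    by (simp add: std_normal_density_def exp_add[symmetric] add_divide_distrib real_sqrt_mult[symmetric])
  have "(\<integral>\<^sup>+x. \<integral>\<^sup>+y. F x y \<partial>std_normal \<partial>std_normal)
      = (\<integral>\<^sup>+x. ennreal (std_normal_density x) * (\<integral>\<^sup>+y. F x y \<partial>std_normal) \<partial>lborel)"
    by (rule nn_integral_density) measurable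
  also have "\<dots> = (\<integral>\<^sup>+x. ennreal (std_normal_density x) * (\<integral>\<^sup>+y. ennreal (std_normal_density y) * F x y \<partial>lborel) \<partial>lborel)"
    by (simp add: nn_integral_density)
  also have "\<dots> = (\<integral>\<^sup>+x. \<integral>\<^sup>+y. ennreal (exp (- (x\<^sup>2 + y\<^sup>2) / 2) / (2 * pi)) * F x y \<partial>lborel \<partial>lborel)"
    unfolding e by (simp add: nn_integral_cmult[symmetric] ennreal_mult mult.assoc)
  finally show ?thesis .
qed

lemma nn_integral_std_normal_rotate:
  fixes F :: "real \<Rightarrow> real \<Rightarrow> ennreal"
  assumes [measurable]: "case_prod F \<in> borel_measurable (borel \<Otimes>\<^sub>M borel)"
    and cs: "c\<^sup>2 + s\<^sup>2 = 1"
  shows "(\<integral>\<^sup>+x. \<integral>\<^sup>+y. F (c * x - s * y) (s * x + c * y) \<partial>std_normal \<partial>std_normal) = (\<integral>\<^sup>+x. \<integral>\<^sup>+y. F x y \<partial>std_normal \<partial>std_normal)"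
proof -
  have e: "(c * x - s * y)\<^sup>2 + (s * x + c * y)\<^sup>2 = x\<^sup>2 + y\<^sup>2" for x y
  proof -
    have "(c * x - s * y)\<^sup>2 + (s * x + c * y)\<^sup>2 = (c\<^sup>2 + s\<^sup>2) * (x\<^sup>2 + y\<^sup>2)" by (simp add: algebra_simps power2_eq_square)
    then show ?thesis using cs by simp
  qed
  have "(\<integral>\<^sup>+x. \<integral>\<^sup>+y. F (c * x - s * y) (s * x + c * y) \<partial>std_normal \<partial>std_normal)
    = (\<integral>\<^sup>+x. \<integral>\<^sup>+y. ennreal (exp (- ((c * x - s * y)\<^sup>2 + (s * x + c * y)\<^sup>2) / 2) / (2 * pi)) * F (c * x - s * y) (s * x + c * y) \<partial>lborel \<partial>lborel)"
    unfolding e by (rule nn_integral_std_normal2) measurable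
  also have "\<dots> = (\<integral>\<^sup>+x. \<integral>\<^sup>+y. ennreal (exp (- (x\<^sup>2 + y\<^sup>2) / 2) / (2 * pi)) * F x y \<partial>lborel \<partial>lborel)"
    by (rule nn_integral_lborel_rotate[where H = "\<lambda>x y. ennreal (exp (- (x\<^sup>2 + y\<^sup>2) / 2) / (2 * pi)) * F x y", OF _ cs])
      measurable
  also have "\<dots> = (\<integral>\<^sup>+x. \<integral>\<^sup>+y. F x y \<partial>std_normal \<partial>std_normal)"
    by (rule nn_integral_std_normal2[symmetric]) measurable
  finally show ?thesis .
qed

text \<open>Triangular normal form of a centred Gaussian pair: variances \<alpha>^2 and \<beta>^2 +
  \<gamma>^2, covariance \<alpha> \<beta>. Degenerate pairs are included.\<close>

definition gauss2 :: "(real \<Rightarrow> real \<Rightarrow> ennreal) \<Rightarrow> real \<Rightarrow> real \<Rightarrow> real \<Rightarrow> ennreal" where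
  "gauss2 h \<alpha> \<beta> \<gamma> = (\<integral>\<^sup>+x. \<integral>\<^sup>+y. h (\<alpha> * x) (\<beta> * x + \<gamma> * y) \<partial>std_normal \<partial>std_normal)"

lemma unit_vector_along:
  fixes a b :: real
  obtains c s where "c\<^sup>2 + s\<^sup>2 = 1" "a = c * sqrt (a\<^sup>2 + b\<^sup>2)" "b = s * sqrt (a\<^sup>2 + b\<^sup>2)"
    "c * a + s * b = sqrt (a\<^sup>2 + b\<^sup>2)"
proof (cases "a = 0 \<and> b = 0")
  case True then show ?thesis using that[of 1 0] by simp
next
  case False
  define r where "r = sqrt (a\<^sup>2 + b\<^sup>2)"
  have r: "r > 0" "r * r = a\<^sup>2 + b\<^sup>2" using False by (auto simp: r_def add_nonneg_eq_0_iff less_le)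
  then have "(a / r)\<^sup>2 + (b / r)\<^sup>2 = 1"
    using False by (simp add: power_divide add_divide_distrib[symmetric] power2_eq_square[of r])
  moreover have "a / r * a + b / r * b = r"
    using r by (simp add: add_divide_distrib[symmetric] power2_eq_square[symmetric] field_simps)
  ultimately show ?thesis using that[of "a / r" "b / r"] r by (simp add: r_def)
qed

text \<open>Rotating first in the plane of the first and third coordinates and then in the plane of the
  second and third coordinates removes the third coordinate.\<close>

lemma gauss2_absorb:
  fixes \<alpha> \<beta> \<gamma> a b :: real
  obtains \<alpha>' \<beta>' \<gamma>' where "\<alpha>' \<ge> 0" "\<gamma>' \<ge> 0" "\<alpha>'\<^sup>2 = \<alpha>\<^sup>2 + a\<^sup>2" "\<alpha>' * \<beta>' = \<alpha> * \<beta> + a * b"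
    "\<beta>'\<^sup>2 + \<gamma>'\<^sup>2 = \<beta>\<^sup>2 + \<gamma>\<^sup>2 + b\<^sup>2"
    "\<And>h. case_prod h \<in> borel_measurable (borel \<Otimes>\<^sub>M borel) \<Longrightarrow>
      (\<integral>\<^sup>+z. gauss2 (\<lambda>p q. h (p + a * z) (q + b * z)) \<alpha> \<beta> \<gamma> \<partial>std_normal) = gauss2 h \<alpha>' \<beta>' \<gamma>'"
proof -
  define r where "r = sqrt (\<alpha>\<^sup>2 + a\<^sup>2)"
  obtain c s where cs: "c\<^sup>2 + s\<^sup>2 = 1" "\<alpha> = c * r" "a = s * r"
    unfolding r_def by (rule unit_vector_along[of \<alpha> a])
  \<comment> \<open>Coefficients of the second form after the first rotation; the second rotation
    then merges \<gamma> and \<open>b'\<close> into one coefficient.\<close>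
  define \<beta>' b' where "\<beta>' = c * \<beta> + s * b" and "b' = c * b - s * \<beta>"
  define r' where "r' = sqrt (\<gamma>\<^sup>2 + b'\<^sup>2)"
  obtain c' s' where cs': "c'\<^sup>2 + s'\<^sup>2 = 1" "\<gamma> = c' * r'" "b' = s' * r'" "c' * \<gamma> + s' * b' = r'"
    unfolding r'_def by (rule unit_vector_along[of \<gamma> b'])
  have sq: "\<beta>'\<^sup>2 + b'\<^sup>2 = \<beta>\<^sup>2 + b\<^sup>2"
  proof -
    have "\<beta>'\<^sup>2 + b'\<^sup>2 = (c\<^sup>2 + s\<^sup>2) * (\<beta>\<^sup>2 + b\<^sup>2)" by (simp add: \<beta>'_def b'_def algebra_simps power2_eq_square)
    then show ?thesis using cs by simp
  qed
  show ?thesis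
  proof (rule that[of r r' \<beta>'])
    show "r \<ge> 0" "r' \<ge> 0" "r\<^sup>2 = \<alpha>\<^sup>2 + a\<^sup>2" by (simp_all add: r_def r'_def)
    show "r * \<beta>' = \<alpha> * \<beta> + a * b" unfolding cs(2,3) \<beta>'_def by (simp add: algebra_simps)
    show "\<beta>'\<^sup>2 + r'\<^sup>2 = \<beta>\<^sup>2 + \<gamma>\<^sup>2 + b\<^sup>2" using sq by (simp add: r'_def)
    fix h :: "real \<Rightarrow> real \<Rightarrow> ennreal"
    assume [measurable]: "case_prod h \<in> borel_measurable (borel \<Otimes>\<^sub>M borel)"
    have "(\<integral>\<^sup>+z. gauss2 (\<lambda>p q. h (p + a * z) (q + b * z)) \<alpha> \<beta> \<gamma> \<partial>std_normal)
      = (\<integral>\<^sup>+x. \<integral>\<^sup>+z. \<integral>\<^sup>+y. h (\<alpha> * x + a * z) (\<beta> * x + \<gamma> * y + b * z) \<partial>std_normal \<partial>std_normal \<partial>std_normal)"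
      unfolding gauss2_def by (rule std_normal_pair.Fubini') measurable
    also have "\<dots> = (\<integral>\<^sup>+x. \<integral>\<^sup>+z. \<integral>\<^sup>+y. h (\<alpha> * (c * x - s * z) + a * (s * x + c * z))
        (\<beta> * (c * x - s * z) + \<gamma> * y + b * (s * x + c * z)) \<partial>std_normal \<partial>std_normal \<partial>std_normal)"
      by (rule nn_integral_std_normal_rotate[OF _ cs(1), symmetric,
            where F = "\<lambda>x z. \<integral>\<^sup>+y. h (\<alpha> * x + a * z) (\<beta> * x + \<gamma> * y + b * z) \<partial>std_normal"]) measurable
    also have "\<dots> = (\<integral>\<^sup>+x. \<integral>\<^sup>+z. \<integral>\<^sup>+y. h (r * x) (\<beta>' * x + (\<gamma> * y + b' * z)) \<partial>std_normal \<partial>std_normal \<partial>std_normal)"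
    proof -
      have 1: "\<alpha> * (c * x - s * z) + a * (s * x + c * z) = r * x" for x z
      proof -
        have "\<alpha> * (c * x - s * z) + a * (s * x + c * z) = r * ((c\<^sup>2 + s\<^sup>2) * x)"
          unfolding cs(2,3) by (simp add: algebra_simps power2_eq_square)
        then show ?thesis using cs(1) by simp
      qed
      have 2: "\<beta> * (c * x - s * z) + \<gamma> * y + b * (s * x + c * z) = \<beta>' * x + (\<gamma> * y + b' * z)" for x y z
        by (simp add: \<beta>'_def b'_def algebra_simps)
      show ?thesis unfolding 1 2 ..
    qed
    also have "\<dots> = (\<integral>\<^sup>+x. \<integral>\<^sup>+y. h (r * x) (\<beta>' * x + r' * y) \<partial>std_normal \<partial>std_normal)"
    proof (rule nn_integral_cong)
      fix x
      have "(\<integral>\<^sup>+z. \<integral>\<^sup>+y. h (r * x) (\<beta>' * x + (\<gamma> * y + b' * z)) \<partial>std_normal \<partial>std_normal)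
        = (\<integral>\<^sup>+y. \<integral>\<^sup>+z. h (r * x) (\<beta>' * x + (\<gamma> * y + b' * z)) \<partial>std_normal \<partial>std_normal)"
        by (rule std_normal_pair.Fubini') measurable
      also have "\<dots> = (\<integral>\<^sup>+y. \<integral>\<^sup>+z. h (r * x) (\<beta>' * x + (\<gamma> * (c' * y - s' * z) + b' * (s' * y + c' * z))) \<partial>std_normal \<partial>std_normal)"
        by (rule nn_integral_std_normal_rotate[OF _ cs'(1), symmetric,
            where F = "\<lambda>y z. h (r * x) (\<beta>' * x + (\<gamma> * y + b' * z))"]) measurable
      also have "\<dots> = (\<integral>\<^sup>+y. \<integral>\<^sup>+z. h (r * x) (\<beta>' * x + r' * y) \<partial>std_normal \<partial>std_normal)"
      proof -
        have "\<gamma> * (c' * y - s' * z) + b' * (s' * y + c' * z) = (c' * \<gamma> + s' * b') * y + (c' * b' - s' * \<gamma>) * z" for y z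
          by (simp add: algebra_simps)
        moreover have "c' * b' - s' * \<gamma> = 0" by (subst cs'(2), subst cs'(3)) simp
        ultimately show ?thesis unfolding cs'(4) by simp
      qed
      also have "\<dots> = (\<integral>\<^sup>+y. h (r * x) (\<beta>' * x + r' * y) \<partial>std_normal)"
        using std_normal.emeasure_space_1 by simp
      finally show "(\<integral>\<^sup>+z. \<integral>\<^sup>+y. h (r * x) (\<beta>' * x + (\<gamma> * y + b' * z)) \<partial>std_normal \<partial>std_normal)
        = (\<integral>\<^sup>+y. h (r * x) (\<beta>' * x + r' * y) \<partial>std_normal)" .
    qed
    finally show "(\<integral>\<^sup>+z. gauss2 (\<lambda>p q. h (p + a * z) (q + b * z)) \<alpha> \<beta> \<gamma> \<partial>std_normal) = gauss2 h r \<beta>' r'"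
      by (simp add: gauss2_def)
  qed
qed

text \<open>Induction over the coordinates, each absorbed by \<open>gauss2_absorb\<close>. The
  starting triple is arbitrary because it changes in every step, and because two product spaces can
  then be treated one after the other.\<close>

lemma gauss2_PiM:
  fixes a b :: "'i \<Rightarrow> real"
  assumes "finite I" "\<alpha> \<ge> 0" "\<gamma> \<ge> 0"
  shows "\<exists>\<alpha>' \<beta>' \<gamma>'. \<alpha>' \<ge> 0 \<and> \<gamma>' \<ge> 0 \<and> \<alpha>'\<^sup>2 = \<alpha>\<^sup>2 + (\<Sum>i\<in>I. (a i)\<^sup>2) \<and> \<alpha>' * \<beta>' = \<alpha> * \<beta> + (\<Sum>i\<in>I. a i * b i) \<and>
    \<beta>'\<^sup>2 + \<gamma>'\<^sup>2 = \<beta>\<^sup>2 + \<gamma>\<^sup>2 + (\<Sum>i\<in>I. (b i)\<^sup>2) \<and>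
    (\<forall>h. case_prod h \<in> borel_measurable (borel \<Otimes>\<^sub>M borel) \<longrightarrow>
      (\<integral>\<^sup>+\<omega>. gauss2 (\<lambda>p q. h (p + (\<Sum>i\<in>I. a i * \<omega> i)) (q + (\<Sum>i\<in>I. b i * \<omega> i))) \<alpha> \<beta> \<gamma> \<partial>(\<Pi>\<^sub>M i\<in>I. std_normal))
        = gauss2 h \<alpha>' \<beta>' \<gamma>')"
  using assms
proof (induction I arbitrary: \<alpha> \<beta> \<gamma> rule: finite_induct)
  case empty
  show ?case by (rule exI[of _ \<alpha>], rule exI[of _ \<beta>], rule exI[of _ \<gamma>]) (use empty in \<open>simp add: PiM_empty\<close>)
next
  case (insert j I)
  interpret product_sigma_finite "\<lambda>_::'i. std_normal" ..
  obtain \<alpha>1 \<beta>1 \<gamma>1 where 1: "\<alpha>1 \<ge> 0" "\<gamma>1 \<ge> 0" "\<alpha>1\<^sup>2 = \<alpha>\<^sup>2 + (a j)\<^sup>2" "\<alpha>1 * \<beta>1 = \<alpha> * \<beta> + a j * b j"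
    "\<beta>1\<^sup>2 + \<gamma>1\<^sup>2 = \<beta>\<^sup>2 + \<gamma>\<^sup>2 + (b j)\<^sup>2"
    "\<And>h. case_prod h \<in> borel_measurable (borel \<Otimes>\<^sub>M borel) \<Longrightarrow>
      (\<integral>\<^sup>+z. gauss2 (\<lambda>p q. h (p + a j * z) (q + b j * z)) \<alpha> \<beta> \<gamma> \<partial>std_normal) = gauss2 h \<alpha>1 \<beta>1 \<gamma>1"
    by (rule gauss2_absorb[of \<alpha> "a j" \<beta> "b j" \<gamma>], rule that)
  obtain \<alpha>' \<beta>' \<gamma>' where 2: "\<alpha>' \<ge> 0" "\<gamma>' \<ge> 0" "\<alpha>'\<^sup>2 = \<alpha>1\<^sup>2 + (\<Sum>i\<in>I. (a i)\<^sup>2)" "\<alpha>' * \<beta>' = \<alpha>1 * \<beta>1 + (\<Sum>i\<in>I. a i * b i)"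
    "\<beta>'\<^sup>2 + \<gamma>'\<^sup>2 = \<beta>1\<^sup>2 + \<gamma>1\<^sup>2 + (\<Sum>i\<in>I. (b i)\<^sup>2)"
    "\<And>h. case_prod h \<in> borel_measurable (borel \<Otimes>\<^sub>M borel) \<Longrightarrow>
      (\<integral>\<^sup>+\<omega>. gauss2 (\<lambda>p q. h (p + (\<Sum>i\<in>I. a i * \<omega> i)) (q + (\<Sum>i\<in>I. b i * \<omega> i))) \<alpha>1 \<beta>1 \<gamma>1 \<partial>(\<Pi>\<^sub>M i\<in>I. std_normal))
        = gauss2 h \<alpha>' \<beta>' \<gamma>'"
    using insert.IH[OF 1(1,2), of \<beta>1] by auto
  show ?case
  proof (rule exI[of _ \<alpha>'], rule exI[of _ \<beta>'], rule exI[of _ \<gamma>'], intro conjI allI impI)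
    show "\<alpha>' \<ge> 0" "\<gamma>' \<ge> 0" "\<alpha>'\<^sup>2 = \<alpha>\<^sup>2 + (\<Sum>i\<in>insert j I. (a i)\<^sup>2)" "\<alpha>' * \<beta>' = \<alpha> * \<beta> + (\<Sum>i\<in>insert j I. a i * b i)"
      "\<beta>'\<^sup>2 + \<gamma>'\<^sup>2 = \<beta>\<^sup>2 + \<gamma>\<^sup>2 + (\<Sum>i\<in>insert j I. (b i)\<^sup>2)"
      using 1 2 insert.hyps by simp_all
    fix h :: "real \<Rightarrow> real \<Rightarrow> ennreal"
    assume h[measurable]: "case_prod h \<in> borel_measurable (borel \<Otimes>\<^sub>M borel)"
    let ?g = "\<lambda>\<omega>. gauss2 (\<lambda>p q. h (p + (\<Sum>i\<in>insert j I. a i * \<omega> i)) (q + (\<Sum>i\<in>insert j I. b i * \<omega> i))) \<alpha> \<beta> \<gamma>"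
    have [measurable]: "?g \<in> borel_measurable (\<Pi>\<^sub>M i\<in>insert j I. std_normal)"
      unfolding gauss2_def by measurable
    have "(\<integral>\<^sup>+\<omega>. ?g \<omega> \<partial>(\<Pi>\<^sub>M i\<in>insert j I. std_normal)) = (\<integral>\<^sup>+\<omega>. (\<integral>\<^sup>+z. ?g (fun_upd \<omega> j z) \<partial>std_normal) \<partial>(\<Pi>\<^sub>M i\<in>I. std_normal))"
      by (intro product_nn_integral_insert insert.hyps) fact
    also have "\<dots> = (\<integral>\<^sup>+\<omega>. gauss2 (\<lambda>p q. h (p + (\<Sum>i\<in>I. a i * \<omega> i)) (q + (\<Sum>i\<in>I. b i * \<omega> i))) \<alpha>1 \<beta>1 \<gamma>1 \<partial>(\<Pi>\<^sub>M i\<in>I. std_normal))"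
    proof (rule nn_integral_cong)
      fix \<omega> :: "'i \<Rightarrow> real"
      let ?A = "\<Sum>i\<in>I. a i * \<omega> i" and ?B = "\<Sum>i\<in>I. b i * \<omega> i"
      have "(\<Sum>i\<in>insert j I. a i * (fun_upd \<omega> j z) i) = a j * z + ?A" "(\<Sum>i\<in>insert j I. b i * (fun_upd \<omega> j z) i) = b j * z + ?B" for z
        using insert.hyps by (auto intro!: sum.cong)
      then have "(\<integral>\<^sup>+z. ?g (fun_upd \<omega> j z) \<partial>std_normal)
          = (\<integral>\<^sup>+z. gauss2 (\<lambda>p q. (\<lambda>p q. h (p + ?A) (q + ?B)) (p + a j * z) (q + b j * z)) \<alpha> \<beta> \<gamma> \<partial>std_normal)"
        by (simp add: add.assoc)
      \<comment> \<open>With the other coordinates frozen, their contributions are constant shifts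
        of the arguments of \<open>h\<close>.\<close>
      also have "\<dots> = gauss2 (\<lambda>p q. h (p + ?A) (q + ?B)) \<alpha>1 \<beta>1 \<gamma>1" by (rule 1(6)) measurable
      finally show "(\<integral>\<^sup>+z. ?g (fun_upd \<omega> j z) \<partial>std_normal) = gauss2 (\<lambda>p q. h (p + ?A) (q + ?B)) \<alpha>1 \<beta>1 \<gamma>1" .
    qed
    also have "\<dots> = gauss2 h \<alpha>' \<beta>' \<gamma>'" by (rule 2(6)[OF h])
    finally show "(\<integral>\<^sup>+\<omega>. ?g \<omega> \<partial>(\<Pi>\<^sub>M i\<in>insert j I. std_normal)) = gauss2 h \<alpha>' \<beta>' \<gamma>'" .
  qed
qed

text \<open>The probability that a Gaussian pair with unit variances and correlation r falls into a
  box. Through \<open>gauss2\<close> it makes sense also for |r| = 1, where there is no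
  density.\<close>

definition box_prob :: "real \<Rightarrow> real \<Rightarrow> real \<Rightarrow> ennreal" where
  "box_prob e e' r = gauss2 (\<lambda>p q. indicator {- e<..<e} p * indicator {- e'<..<e'} q) 1 r (sqrt (1 - r\<^sup>2))"

lemma box_prob_measurable [measurable]: "box_prob e e' \<in> borel_measurable borel"
  unfolding box_prob_def[abs_def] gauss2_def by measurable

text \<open>The substitution t = r s + \<sigma> y in the inner integral turns s^2 + y^2 into the
  quadratic form of the correlated pair.\<close>

lemma box_prob_density:
  assumes r: "\<bar>r\<bar> < 1"
  defines "\<sigma> \<equiv> sqrt (1 - r\<^sup>2)"
  shows "box_prob e e' r = (\<integral>\<^sup>+s. \<integral>\<^sup>+t. ennreal (exp (- (s\<^sup>2 - 2 * r * s * t + t\<^sup>2) / (2 * \<sigma>\<^sup>2)) / (2 * pi * \<sigma>)) *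
     (indicator {- e<..<e} s * indicator {- e'<..<e'} t) \<partial>lborel \<partial>lborel)"
proof -
  have r2: "r\<^sup>2 < 1" using r by (simp add: abs_square_less_1)
  have \<sigma>: "\<sigma> > 0" "\<sigma>\<^sup>2 = 1 - r\<^sup>2" using r2 by (auto simp: \<sigma>_def)
  have "box_prob e e' r = (\<integral>\<^sup>+x. \<integral>\<^sup>+y. ennreal (exp (- (x\<^sup>2 + y\<^sup>2) / 2) / (2 * pi)) *
      (indicator {- e<..<e} x * indicator {- e'<..<e'} (r * x + \<sigma> * y)) \<partial>lborel \<partial>lborel)"
    unfolding box_prob_def gauss2_def \<sigma>_def[symmetric] mult_1_left
    by (rule nn_integral_std_normal2) measurable
  also have "\<dots> = (\<integral>\<^sup>+s. \<integral>\<^sup>+t. ennreal (exp (- (s\<^sup>2 - 2 * r * s * t + t\<^sup>2) / (2 * \<sigma>\<^sup>2)) / (2 * pi * \<sigma>)) *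
     (indicator {- e<..<e} s * indicator {- e'<..<e'} t) \<partial>lborel \<partial>lborel)"
  proof (rule nn_integral_cong)
    fix s
    let ?f = "\<lambda>t. ennreal (exp (- (s\<^sup>2 - 2 * r * s * t + t\<^sup>2) / (2 * \<sigma>\<^sup>2)) / (2 * pi * \<sigma>)) *
     (indicator {- e<..<e} s * indicator {- e'<..<e'} t)"
    have "(\<integral>\<^sup>+t. ?f t \<partial>lborel) = ennreal \<bar>\<sigma>\<bar> * (\<integral>\<^sup>+y. ?f (r * s + \<sigma> * y) \<partial>lborel)"
      by (rule nn_integral_real_affine) (use \<sigma> in \<open>measurable, simp\<close>)
    also have "\<dots> = (\<integral>\<^sup>+y. ennreal \<bar>\<sigma>\<bar> * ?f (r * s + \<sigma> * y) \<partial>lborel)"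
      by (rule nn_integral_cmult[symmetric]) measurable
    also have "\<dots> = (\<integral>\<^sup>+y. ennreal (exp (- (s\<^sup>2 + y\<^sup>2) / 2) / (2 * pi)) *
      (indicator {- e<..<e} s * indicator {- e'<..<e'} (r * s + \<sigma> * y)) \<partial>lborel)"
    proof (rule nn_integral_cong)
      fix y
      have "s\<^sup>2 - 2 * r * s * (r * s + \<sigma> * y) + (r * s + \<sigma> * y)\<^sup>2 = (1 - r\<^sup>2) * s\<^sup>2 + \<sigma>\<^sup>2 * y\<^sup>2"
        by (simp add: algebra_simps power2_eq_square)
      also have "\<dots> = \<sigma>\<^sup>2 * (s\<^sup>2 + y\<^sup>2)" unfolding \<sigma>(2) by (simp add: algebra_simps)
      finally have q: "s\<^sup>2 - 2 * r * s * (r * s + \<sigma> * y) + (r * s + \<sigma> * y)\<^sup>2 = \<sigma>\<^sup>2 * (s\<^sup>2 + y\<^sup>2)" .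
      have q2: "- (\<sigma>\<^sup>2 * (s\<^sup>2 + y\<^sup>2)) / (2 * \<sigma>\<^sup>2) = - (s\<^sup>2 + y\<^sup>2) / 2" using \<sigma>(1) by (simp add: field_simps)
      have "ennreal \<bar>\<sigma>\<bar> * ennreal (exp (- (s\<^sup>2 + y\<^sup>2) / 2) / (2 * pi * \<sigma>)) = ennreal (exp (- (s\<^sup>2 + y\<^sup>2) / 2) / (2 * pi))"
        using \<sigma>(1) by (subst ennreal_mult[symmetric]) auto
      then show "ennreal \<bar>\<sigma>\<bar> * ?f (r * s + \<sigma> * y) = ennreal (exp (- (s\<^sup>2 + y\<^sup>2) / 2) / (2 * pi)) *
        (indicator {- e<..<e} s * indicator {- e'<..<e'} (r * s + \<sigma> * y))"
        unfolding q q2 mult.assoc[symmetric] by simp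
    qed
    finally show "(\<integral>\<^sup>+y. ennreal (exp (- (s\<^sup>2 + y\<^sup>2) / 2) / (2 * pi)) *
      (indicator {- e<..<e} s * indicator {- e'<..<e'} (r * s + \<sigma> * y)) \<partial>lborel) = (\<integral>\<^sup>+t. ?f t \<partial>lborel)" ..
  qed
  finally show ?thesis .
qed

lemma nn_integral_box_const:
  assumes "e > 0" "e' > 0" "c \<ge> 0"
  shows "(\<integral>\<^sup>+s. \<integral>\<^sup>+t. ennreal c * (indicator {- e<..<e} s * indicator {- e'<..<e'} t) \<partial>lborel \<partial>lborel) = ennreal (4 * e * e' * c)"
proof -
  have "(\<integral>\<^sup>+t. ennreal c * (indicator {- e<..<e} s * indicator {- e'<..<e'} t) \<partial>lborel)
     = ennreal (2 * e' * c) * indicator {- e<..<e} s" for s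
  proof -
    have "(\<integral>\<^sup>+t. ennreal c * (indicator {- e<..<e} s * indicator {- e'<..<e'} t) \<partial>lborel)
      = (\<integral>\<^sup>+t. (ennreal c * indicator {- e<..<e} s) * indicator {- e'<..<e'} t \<partial>lborel)" by (simp add: mult.assoc)
    also have "\<dots> = (ennreal c * indicator {- e<..<e} s) * ennreal (2 * e')"
      using assms by (subst nn_integral_cmult_indicator) auto
    also have "\<dots> = (ennreal c * ennreal (2 * e')) * indicator {- e<..<e} s" by (simp add: mult_ac)
    also have "ennreal c * ennreal (2 * e') = ennreal (2 * e' * c)"
      using assms by (subst ennreal_mult[symmetric]) (auto simp: mult_ac)
    finally show ?thesis .
  qed
  then have "(\<integral>\<^sup>+s. \<integral>\<^sup>+t. ennreal c * (indicator {- e<..<e} s * indicator {- e'<..<e'} t) \<partial>lborel \<partial>lborel)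
     = (\<integral>\<^sup>+s. ennreal (2 * e' * c) * indicator {- e<..<e} s \<partial>lborel)" by simp
  also have "\<dots> = ennreal (2 * e' * c) * ennreal (2 * e)"
    using assms by (subst nn_integral_cmult_indicator) auto
  also have "\<dots> = ennreal (4 * e * e' * c)" using assms by (subst ennreal_mult[symmetric]) (auto simp: mult_ac)
  finally show ?thesis .
qed

text \<open>The density is largest at the origin, whence the upper bound. On the box the quadratic
  form is at most (2 \<delta>)^2, so the exponent is at least -v with v = 2 \<delta>^2 / \<sigma>^2.
  The loss v^(1/4) / (2 pi \<sigma>) is of order \<delta>^(1/2) \<sigma>^(-3/2), and \<sigma>^(-3/2)
  is the power -3/4 of 1 - r^2.\<close>

lemma box_prob_bounds:
  assumes e: "0 < e" "e \<le> \<delta>" and e': "0 < e'" "e' \<le> \<delta>" and r: "\<bar>r\<bar> < 1"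
  shows "box_prob e e' r \<le> ennreal (4 * e * e' * (1 / (2 * pi * sqrt (1 - r\<^sup>2))))"
    and "ennreal (4 * e * e' * (1 / (2 * pi * sqrt (1 - r\<^sup>2)) - sqrt \<delta> * (1 - r\<^sup>2) powr (- (3 / 4)))) \<le> box_prob e e' r"
proof -
  define \<sigma> where "\<sigma> = sqrt (1 - r\<^sup>2)"
  have r2: "r\<^sup>2 < 1" using r by (simp add: abs_square_less_1)
  have \<sigma>: "\<sigma> > 0" "\<sigma>\<^sup>2 = 1 - r\<^sup>2" using r2 by (auto simp: \<sigma>_def)
  define Q where "Q = (\<lambda>s t. s\<^sup>2 - 2 * r * s * t + t\<^sup>2)"
  have Q0: "Q s t \<ge> 0" for s t
  proof -
    have "Q s t = (s - r * t)\<^sup>2 + (1 - r\<^sup>2) * t\<^sup>2" by (simp add: Q_def algebra_simps power2_eq_square)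
    then show ?thesis using r2 by simp
  qed
  have dens: "box_prob e e' r = (\<integral>\<^sup>+s. \<integral>\<^sup>+t. ennreal (exp (- Q s t / (2 * \<sigma>\<^sup>2)) / (2 * pi * \<sigma>)) *
     (indicator {- e<..<e} s * indicator {- e'<..<e'} t) \<partial>lborel \<partial>lborel)"
    unfolding Q_def \<sigma>_def by (rule box_prob_density[OF r])
  have ub: "exp (- Q s t / (2 * \<sigma>\<^sup>2)) / (2 * pi * \<sigma>) \<le> 1 / (2 * pi * \<sigma>)" for s t
  proof -
    have "- Q s t / (2 * \<sigma>\<^sup>2) \<le> 0" using Q0[of s t] by (simp add: divide_nonpos_nonneg)
    then show ?thesis using \<sigma>(1) by (intro divide_right_mono) auto
  qed
  have "box_prob e e' r \<le> (\<integral>\<^sup>+s. \<integral>\<^sup>+t. ennreal (1 / (2 * pi * \<sigma>)) * (indicator {- e<..<e} s * indicator {- e'<..<e'} t) \<partial>lborel \<partial>lborel)"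
    unfolding dens by (intro nn_integral_mono mult_right_mono ennreal_leI ub) auto
  also have "\<dots> = ennreal (4 * e * e' * (1 / (2 * pi * \<sigma>)))" using e e' \<sigma> by (intro nn_integral_box_const) auto
  finally show "box_prob e e' r \<le> ennreal (4 * e * e' * (1 / (2 * pi * sqrt (1 - r\<^sup>2))))" by (simp add: \<sigma>_def)
  \<comment> \<open>Truncation at 0 makes the constant admissible for
    \<open>nn_integral_box_const\<close>; it stays a lower bound because the density is
    nonnegative.\<close>
  define lo where "lo = max 0 (1 / (2 * pi * \<sigma>) - sqrt \<delta> * (1 - r\<^sup>2) powr (- (3 / 4)))"
  have \<delta>: "\<delta> > 0" using e by simp
  have lo: "lo \<le> exp (- Q s t / (2 * \<sigma>\<^sup>2)) / (2 * pi * \<sigma>)" if "\<bar>s\<bar> < e" "\<bar>t\<bar> < e'" for s t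
  proof -
    define v where "v = 2 * \<delta>\<^sup>2 / \<sigma>\<^sup>2"
    have v0: "v > 0" unfolding v_def using \<delta> \<sigma>(1) by (intro divide_pos_pos) auto
    have "Q s t \<le> (2 * \<delta>)\<^sup>2"
    proof -
      have "Q s t \<le> s\<^sup>2 + 2 * (\<bar>r\<bar> * (\<bar>s\<bar> * \<bar>t\<bar>)) + t\<^sup>2"
        using abs_ge_minus_self[of "r * (s * t)"] by (simp add: Q_def abs_mult)
      also have "\<dots> \<le> s\<^sup>2 + 2 * (1 * (\<bar>s\<bar> * \<bar>t\<bar>)) + t\<^sup>2" using r by (intro add_mono mult_mono) auto
      also have "\<dots> = (\<bar>s\<bar> + \<bar>t\<bar>)\<^sup>2" by (simp add: algebra_simps power2_eq_square)
      also have "\<dots> \<le> (2 * \<delta>)\<^sup>2" using that e e' by (intro power_mono) auto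
      finally show ?thesis .
    qed
    then have Qv: "Q s t / (2 * \<sigma>\<^sup>2) \<le> v" using \<sigma> by (simp add: v_def power_mult_distrib divide_right_mono field_simps)
    have "1 - v powr (1 / 4) \<le> exp (- v)"
    proof (cases "v \<le> 1")
      case True
      then have "v powr 1 \<le> v powr (1 / 4)" using v0 by (intro powr_mono') auto
      then show ?thesis using exp_ge_add_one_self[of "- v"] v0 by simp
    next
      case False
      then have "1 \<le> v powr (1 / 4)" by (intro ge_one_powr_ge_zero) auto
      then show ?thesis using exp_ge_zero[of "- v"] by linarith
    qed
    also have "exp (- v) \<le> exp (- (Q s t / (2 * \<sigma>\<^sup>2)))" using Qv by simp
    finally have 1: "(1 - v powr (1 / 4)) / (2 * pi * \<sigma>) \<le> exp (- Q s t / (2 * \<sigma>\<^sup>2)) / (2 * pi * \<sigma>)"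
      using \<sigma> by (intro divide_right_mono) auto
    have "v powr (1 / 4) / (2 * pi * \<sigma>) \<le> sqrt \<delta> * (1 - r\<^sup>2) powr (- (3 / 4))"
    proof -
      have s1: "\<sigma> = (1 - r\<^sup>2) powr (1 / 2)" using r2 by (simp add: \<sigma>_def powr_half_sqrt)
      have "v powr (1 / 4) = 2 powr (1 / 4) * (\<delta> powr 2) powr (1 / 4) / (1 - r\<^sup>2) powr (1 / 4)"
        using \<delta> r2 by (simp add: v_def \<sigma>(2) powr_mult powr_divide)
      also have "(\<delta> powr 2) powr (1 / 4) = sqrt \<delta>" using \<delta> by (simp add: powr_powr powr_half_sqrt del: powr_numeral)
      finally have "v powr (1 / 4) / (2 * pi * \<sigma>) = 2 powr (1 / 4) / (2 * pi) * (sqrt \<delta> * (1 / ((1 - r\<^sup>2) powr (1 / 4) * (1 - r\<^sup>2) powr (1 / 2))))"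
        by (simp add: s1)
      also have "1 / ((1 - r\<^sup>2) powr (1 / 4) * (1 - r\<^sup>2) powr (1 / 2)) = (1 - r\<^sup>2) powr (- (3 / 4))"
        by (simp add: powr_add[symmetric] powr_minus_divide)
      also have "2 powr (1 / 4) / (2 * pi) * (sqrt \<delta> * (1 - r\<^sup>2) powr (- (3 / 4))) \<le> 1 * (sqrt \<delta> * (1 - r\<^sup>2) powr (- (3 / 4)))"
      proof (rule mult_right_mono)
        have "2 powr (1 / 4) \<le> (2::real) powr 1" by (rule powr_mono) auto
        also have "(2::real) powr 1 \<le> 2 * pi" using pi_ge_two by simp
        finally show "2 powr (1 / 4) / (2 * pi) \<le> 1" by simp
      qed (use \<delta> in simp)
      finally show ?thesis by simp
    qed
    then have "1 / (2 * pi * \<sigma>) - sqrt \<delta> * (1 - r\<^sup>2) powr (- (3 / 4)) \<le> exp (- Q s t / (2 * \<sigma>\<^sup>2)) / (2 * pi * \<sigma>)"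
      using 1 by (simp add: diff_divide_distrib)
    then show ?thesis using \<sigma> by (simp add: lo_def)
  qed
  have "ennreal (4 * e * e' * (1 / (2 * pi * \<sigma>) - sqrt \<delta> * (1 - r\<^sup>2) powr (- (3 / 4)))) \<le> ennreal (4 * e * e' * lo)"
    using e e' by (intro ennreal_leI mult_left_mono) (auto simp: lo_def)
  also have "\<dots> = (\<integral>\<^sup>+s. \<integral>\<^sup>+t. ennreal lo * (indicator {- e<..<e} s * indicator {- e'<..<e'} t) \<partial>lborel \<partial>lborel)"
    using e e' by (intro nn_integral_box_const[symmetric]) (auto simp: lo_def)
  also have "\<dots> \<le> box_prob e e' r"
    unfolding dens using lo by (intro nn_integral_mono) (auto simp: indicator_def intro!: ennreal_leI)
  finally show "ennreal (4 * e * e' * (1 / (2 * pi * sqrt (1 - r\<^sup>2)) - sqrt \<delta> * (1 - r\<^sup>2) powr (- (3 / 4)))) \<le> box_prob e e' r"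
    by (simp add: \<sigma>_def)
qed

lemma std_normal_interval_bounds:
  assumes "e > 0"
  shows "emeasure std_normal {- e<..<e} \<le> ennreal (2 * e * (1 / sqrt (2 * pi)))"
    and "ennreal (2 * e * (1 / sqrt (2 * pi) * (1 - e\<^sup>2 / 2))) \<le> emeasure std_normal {- e<..<e}"
proof -
  have em: "emeasure std_normal {- e<..<e} = (\<integral>\<^sup>+x. ennreal (std_normal_density x) * indicator {- e<..<e} x \<partial>lborel)"
    by (rule emeasure_density) measurable
  have c: "(\<integral>\<^sup>+x. ennreal k * indicator {- e<..<e} x \<partial>lborel) = ennreal (2 * e * k)" if "k \<ge> 0" for k
  proof -
    have "(\<integral>\<^sup>+x. ennreal k * indicator {- e<..<e} x \<partial>lborel) = ennreal k * ennreal (2 * e)"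
      using assms by (subst nn_integral_cmult_indicator) auto
    then show ?thesis using that assms by (simp add: ennreal_mult[symmetric] mult_ac)
  qed
  have "emeasure std_normal {- e<..<e} \<le> (\<integral>\<^sup>+x. ennreal (1 / sqrt (2 * pi)) * indicator {- e<..<e} x \<partial>lborel)"
    unfolding em by (intro nn_integral_mono mult_right_mono ennreal_leI)
      (auto simp: std_normal_density_def divide_right_mono)
  then show "emeasure std_normal {- e<..<e} \<le> ennreal (2 * e * (1 / sqrt (2 * pi)))" by (simp add: c)
  define k where "k = max 0 (1 / sqrt (2 * pi) * (1 - e\<^sup>2 / 2))"
  have k: "k \<le> std_normal_density x" if "\<bar>x\<bar> < e" for x
  proof -
    have "x\<^sup>2 \<le> e\<^sup>2" using that by (simp add: abs_le_square_iff[symmetric])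
    then have "1 - e\<^sup>2 / 2 \<le> exp (- x\<^sup>2 / 2)" using exp_ge_add_one_self[of "- x\<^sup>2 / 2"] by simp
    then have "1 / sqrt (2 * pi) * (1 - e\<^sup>2 / 2) \<le> std_normal_density x"
      unfolding std_normal_density_def by (intro mult_left_mono) auto
    then show ?thesis by (simp add: k_def)
  qed
  have "ennreal (2 * e * (1 / sqrt (2 * pi) * (1 - e\<^sup>2 / 2))) \<le> ennreal (2 * e * k)"
    using assms by (intro ennreal_leI mult_left_mono) (auto simp: k_def)
  also have "\<dots> = (\<integral>\<^sup>+x. ennreal k * indicator {- e<..<e} x \<partial>lborel)" by (rule c[symmetric]) (simp add: k_def)
  also have "\<dots> \<le> emeasure std_normal {- e<..<e}"
    unfolding em using k by (intro nn_integral_mono) (auto simp: indicator_def intro!: ennreal_leI)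
  finally show "ennreal (2 * e * (1 / sqrt (2 * pi) * (1 - e\<^sup>2 / 2))) \<le> emeasure std_normal {- e<..<e}" .
qed

text \<open>L splits into R and -R, which are disjoint because k = -k only for k = 0.\<close>

lemma sum_half_system:
  fixes L R :: "(real ^ 'n) set" and F :: "real ^ 'n \<Rightarrow> real"
  assumes hs: "half_system L R" and fin: "finite L" and nz: "0 \<notin> L" and sym: "uminus ` L = L"
    and even: "\<And>k. F (- k) = F k"
  shows "(\<Sum>k\<in>L. F k) = 2 * (\<Sum>k\<in>R. F k)"
proof -
  have RL: "R \<subseteq> L" and ex1: "\<And>k. k \<in> L \<Longrightarrow> \<exists>!l. l \<in> R \<and> (l = k \<or> l = - k)"
    using hs by (auto simp: half_system_def)
  have "L = R \<union> uminus ` R"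
  proof
    show "L \<subseteq> R \<union> uminus ` R"
    proof
      fix k assume "k \<in> L"
      then obtain l where "l \<in> R" "l = k \<or> l = - k" using ex1 by blast
      then show "k \<in> R \<union> uminus ` R" by (metis UnI1 UnI2 imageI minus_minus)
    qed
    show "R \<union> uminus ` R \<subseteq> L" using RL sym by blast
  qed
  moreover have "R \<inter> uminus ` R = {}"
  proof (rule ccontr)
    assume "R \<inter> uminus ` R \<noteq> {}"
    then obtain k where k: "k \<in> R" "- k \<in> R" by auto
    then have "k = - k" using ex1[of k] RL by blast
    then have "k = 0" by (simp add: vec_eq_iff)
    then show False using k RL nz by blast
  qed
  ultimately have "(\<Sum>k\<in>L. F k) = (\<Sum>k\<in>R. F k) + (\<Sum>k\<in>uminus ` R. F k)"
    using fin by (metis finite_Un sum.union_disjoint)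
  also have "(\<Sum>k\<in>uminus ` R. F k) = (\<Sum>k\<in>R. F k)" by (subst sum.reindex) (auto simp: even)
  finally show ?thesis by simp
qed

lemma gauss2_zero: "gauss2 h 0 0 0 = h 0 0"
  unfolding gauss2_def using std_normal.emeasure_space_1 by simp

text \<open>The second family of coefficients is absorbed first, starting from the zero form; the
  resulting triple is the start for the first family. The Gram conditions then leave only the triple
  (1, r, sqrt (1 - r^2)).\<close>

lemma nn_integral_coeff_space:
  fixes a b a' b' :: "real ^ 'n \<Rightarrow> real"
  assumes fin: "finite R" and h[measurable]: "case_prod h \<in> borel_measurable (borel \<Otimes>\<^sub>M borel)"
    and gram: "(\<Sum>k\<in>R. (a k)\<^sup>2 + (a' k)\<^sup>2) = 1" "(\<Sum>k\<in>R. (b k)\<^sup>2 + (b' k)\<^sup>2) = 1" "(\<Sum>k\<in>R. a k * b k + a' k * b' k) = r"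
  shows "(\<integral>\<^sup>+\<omega>. h ((\<Sum>k\<in>R. a k * fst \<omega> k) + (\<Sum>k\<in>R. a' k * snd \<omega> k)) ((\<Sum>k\<in>R. b k * fst \<omega> k) + (\<Sum>k\<in>R. b' k * snd \<omega> k))
      \<partial>coeff_space R) = gauss2 h 1 r (sqrt (1 - r\<^sup>2))"
proof -
  let ?M = "\<Pi>\<^sub>M k\<in>R. std_normal"
  interpret M: prob_space ?M by (rule prob_space_PiM) (rule std_normal.prob_space_axioms)
  obtain \<alpha> \<beta> \<gamma> where 1: "\<alpha> \<ge> 0" "\<gamma> \<ge> 0" "\<alpha>\<^sup>2 = (\<Sum>k\<in>R. (a' k)\<^sup>2)" "\<alpha> * \<beta> = (\<Sum>k\<in>R. a' k * b' k)"
    "\<beta>\<^sup>2 + \<gamma>\<^sup>2 = (\<Sum>k\<in>R. (b' k)\<^sup>2)"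
    "\<And>h. case_prod h \<in> borel_measurable (borel \<Otimes>\<^sub>M borel) \<Longrightarrow>
      (\<integral>\<^sup>+\<omega>. h (\<Sum>k\<in>R. a' k * \<omega> k) (\<Sum>k\<in>R. b' k * \<omega> k) \<partial>?M) = gauss2 h \<alpha> \<beta> \<gamma>"
    using gauss2_PiM[OF fin, of 0 0 a' 0 b'] by (auto simp: gauss2_zero)
  obtain \<alpha>' \<beta>' \<gamma>' where 2: "\<alpha>' \<ge> 0" "\<gamma>' \<ge> 0" "\<alpha>'\<^sup>2 = \<alpha>\<^sup>2 + (\<Sum>k\<in>R. (a k)\<^sup>2)" "\<alpha>' * \<beta>' = \<alpha> * \<beta> + (\<Sum>k\<in>R. a k * b k)"
    "\<beta>'\<^sup>2 + \<gamma>'\<^sup>2 = \<beta>\<^sup>2 + \<gamma>\<^sup>2 + (\<Sum>k\<in>R. (b k)\<^sup>2)"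
    "\<And>h. case_prod h \<in> borel_measurable (borel \<Otimes>\<^sub>M borel) \<Longrightarrow>
      (\<integral>\<^sup>+\<omega>. gauss2 (\<lambda>p q. h (p + (\<Sum>k\<in>R. a k * \<omega> k)) (q + (\<Sum>k\<in>R. b k * \<omega> k))) \<alpha> \<beta> \<gamma> \<partial>?M) = gauss2 h \<alpha>' \<beta>' \<gamma>'"
    using gauss2_PiM[OF fin 1(1,2), of a \<beta> b] by auto
  have "\<alpha>'\<^sup>2 = 1" using 2(3) 1(3) gram(1) by (simp add: sum.distrib)
  then have \<alpha>': "\<alpha>' = 1" using 2(1) by (simp add: power2_eq_1_iff)
  then have \<beta>': "\<beta>' = r" using 2(4) 1(4) gram(3) by (simp add: sum.distrib)
  have "\<gamma>'\<^sup>2 = 1 - r\<^sup>2" using 2(5) 1(5) gram(2) \<beta>' by (simp add: sum.distrib)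
  then have \<gamma>': "\<gamma>' = sqrt (1 - r\<^sup>2)" using 2(2) by (simp add: real_sqrt_unique)
  have "(\<integral>\<^sup>+\<omega>. h ((\<Sum>k\<in>R. a k * fst \<omega> k) + (\<Sum>k\<in>R. a' k * snd \<omega> k)) ((\<Sum>k\<in>R. b k * fst \<omega> k) + (\<Sum>k\<in>R. b' k * snd \<omega> k)) \<partial>coeff_space R)
    = (\<integral>\<^sup>+x. \<integral>\<^sup>+y. h ((\<Sum>k\<in>R. a k * x k) + (\<Sum>k\<in>R. a' k * y k)) ((\<Sum>k\<in>R. b k * x k) + (\<Sum>k\<in>R. b' k * y k)) \<partial>?M \<partial>?M)"
    unfolding coeff_space_def by (subst M.nn_integral_fst[symmetric]) simp_all
  also have "\<dots> = (\<integral>\<^sup>+x. gauss2 (\<lambda>p q. h (p + (\<Sum>k\<in>R. a k * x k)) (q + (\<Sum>k\<in>R. b k * x k))) \<alpha> \<beta> \<gamma> \<partial>?M)"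
  proof (rule nn_integral_cong)
    fix x :: "real ^ 'n \<Rightarrow> real"
    show "(\<integral>\<^sup>+y. h ((\<Sum>k\<in>R. a k * x k) + (\<Sum>k\<in>R. a' k * y k)) ((\<Sum>k\<in>R. b k * x k) + (\<Sum>k\<in>R. b' k * y k)) \<partial>?M)
      = gauss2 (\<lambda>p q. h (p + (\<Sum>k\<in>R. a k * x k)) (q + (\<Sum>k\<in>R. b k * x k))) \<alpha> \<beta> \<gamma>"
      by (subst 1(6)[symmetric]) (auto simp: add.commute)
  qed
  also have "\<dots> = gauss2 h \<alpha>' \<beta>' \<gamma>'" by (rule 2(6)[OF h])
  finally show ?thesis by (simp only: \<alpha>' \<beta>' \<gamma>')
qed

text \<open>The coefficient vectors at x and y have inner product cos cos + sin sin, the cosine of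
  the difference; over half the frequencies with weight 2 / N it sums to the covariance at x - y,
  which is 1 for x = y.\<close>

lemma nn_integral_eigenfunction_pair:
  fixes R :: "(real ^ 'n) set"
  assumes E: "E \<ge> 1" and fin: "finite (frequencies E :: (real ^ 'n) set)" and ne: "(frequencies E :: (real ^ 'n) set) \<noteq> {}"
    and hs: "half_system (frequencies E) R"
    and h[measurable]: "case_prod h \<in> borel_measurable (borel \<Otimes>\<^sub>M borel)"
  defines "u \<equiv> covariance (frequencies E)"
  shows "(\<integral>\<^sup>+\<omega>. h (eigenfunction E R \<omega> x) (eigenfunction E R \<omega> y) \<partial>coeff_space R)
    = gauss2 h 1 (u (x - y)) (sqrt (1 - (u (x - y))\<^sup>2))"
proof -
  let ?L = "frequencies E :: (real ^ 'n) set"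
  define N where "N = real (card ?L)"
  have N: "N > 0" using fin ne by (simp add: N_def card_gt_0_iff)
  have finR: "finite R" using hs fin by (auto simp: half_system_def intro: finite_subset)
  define a where "a = (\<lambda>x k. sqrt (2 / N) * cos (2 * pi * (k \<bullet> (x :: real ^ 'n))))"
  define a' where "a' = (\<lambda>x k. - sqrt (2 / N) * sin (2 * pi * (k \<bullet> (x :: real ^ 'n))))"
  have f: "eigenfunction E R \<omega> x = (\<Sum>k\<in>R. a x k * fst \<omega> k) + (\<Sum>k\<in>R. a' x k * snd \<omega> k)" for \<omega> x
    by (cases \<omega>) (simp add: eigenfunction_def a_def a'_def N_def sum_subtractf right_diff_distrib sum_distrib_left
        sum_negf mult_ac)
  have gram: "(\<Sum>k\<in>R. a x k * a y k + a' x k * a' y k) = u (x - y)" for x y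
  proof -
    have sym: "uminus ` ?L = ?L" by (force simp: frequencies_def image_iff intro: exI[of _ "- _"])
    have nz: "0 \<notin> ?L" using E by (simp add: frequencies_def)
    define q where "q = sqrt (2 / N)"
    have q: "q * q = 2 / N" using N by (simp add: q_def)
    have "a x k * a y k + a' x k * a' y k = 2 / N * cos (2 * pi * (k \<bullet> (x - y)))" for k
    proof -
      have "a x k * a y k + a' x k * a' y k = (q * q) * cos (2 * pi * (k \<bullet> x) - 2 * pi * (k \<bullet> y))"
        unfolding a_def a'_def q_def[symmetric] cos_diff by (simp add: algebra_simps)
      then show ?thesis by (simp add: q inner_diff_right right_diff_distrib)
    qed
    then have "(\<Sum>k\<in>R. a x k * a y k + a' x k * a' y k) = 1 / N * (2 * (\<Sum>k\<in>R. cos (2 * pi * (k \<bullet> (x - y)))))"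
      by (simp add: sum_distrib_left)
    also have "2 * (\<Sum>k\<in>R. cos (2 * pi * (k \<bullet> (x - y)))) = (\<Sum>k\<in>?L. cos (2 * pi * (k \<bullet> (x - y))))"
      by (rule sum_half_system[OF hs fin nz sym, symmetric]) simp
    finally show ?thesis by (simp add: u_def covariance_def N_def)
  qed
  have u0: "u 0 = 1" using N by (simp add: u_def covariance_def N_def)
  show ?thesis
    unfolding f
  proof (rule nn_integral_coeff_space[OF finR h])
    show "(\<Sum>k\<in>R. (a x k)\<^sup>2 + (a' x k)\<^sup>2) = 1" "(\<Sum>k\<in>R. (a y k)\<^sup>2 + (a' y k)\<^sup>2) = 1"
      using gram[of x x] gram[of y y] u0 by (simp_all add: power2_eq_square)
  qed (rule gram)
qed

section \<open>The limit defining the Leray measure\<close>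

text \<open>\<open>ennreal\<close> cuts off negative values, so the right side integrates the
  positive part. This serves a lower bound whose integrand may be negative.\<close>

lemma nn_integral_le_real_integral:
  fixes f :: "'a \<Rightarrow> real"
  assumes "integrable M f"
  shows "ennreal (\<integral>x. f x \<partial>M) \<le> (\<integral>\<^sup>+x. ennreal (f x) \<partial>M)"
proof -
  have "(\<integral>x. f x \<partial>M) \<le> (\<integral>x. max 0 (f x) \<partial>M)" using assms by (intro integral_mono) auto
  then have "ennreal (\<integral>x. f x \<partial>M) \<le> ennreal (\<integral>x. max 0 (f x) \<partial>M)" by (rule ennreal_leI)
  also have "\<dots> = (\<integral>\<^sup>+x. ennreal (max 0 (f x)) \<partial>M)"
    using assms by (intro nn_integral_eq_integral[symmetric]) auto
  also have "\<dots> = (\<integral>\<^sup>+x. ennreal (f x) \<partial>M)"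
    by (intro nn_integral_cong) (auto simp: max_def ennreal_neg)
  finally show ?thesis .
qed

text \<open>Upper and lower bounds on mixed second moments with the same \<open>W\<close> make the
  squared L2 distance of X i and X j at most 2 K / (i + 1)^4. Consecutive L1 distances are then
  summable, which gives almost sure convergence; Fatou's lemma makes the pointwise limit an L2
  limit, and both moments pass over.\<close>

lemma (in prob_space) L2_convergence:
  fixes X :: "nat \<Rightarrow> 'a \<Rightarrow> real"
  assumes X[measurable]: "\<And>k. X k \<in> borel_measurable M"
    and bd: "\<And>k. \<exists>B. \<forall>x\<in>space M. \<bar>X k x\<bar> \<le> B"
    and K: "K \<ge> 0"
    and up: "\<And>i j. i \<le> j \<Longrightarrow> expectation (\<lambda>x. X i x * X j x) \<le> W"
    and low: "\<And>i j. i \<le> j \<Longrightarrow> W - K / real (i + 1) ^ 4 \<le> expectation (\<lambda>x. X i x * X j x)"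
    and mean: "(\<lambda>k. expectation (X k)) \<longlonglongrightarrow> m"
  shows "integrable M (\<lambda>x. lim (\<lambda>k. X k x))" "integrable M (\<lambda>x. (lim (\<lambda>k. X k x))\<^sup>2)"
    "expectation (\<lambda>x. lim (\<lambda>k. X k x)) = m" "expectation (\<lambda>x. (lim (\<lambda>k. X k x))\<^sup>2) = W"
proof -
  define Y where "Y = (\<lambda>x. lim (\<lambda>k. X k x))"
  have Y[measurable]: "Y \<in> borel_measurable M" unfolding Y_def by measurable
  \<comment> \<open>The order of the L2 distance. As the weight in |z| \<le> (t + z^2 / t) / 2 it
    makes L1 distances O(t) without taking roots of expectations.\<close>
  define t where "t = (\<lambda>i::nat. 1 / real (i + 1) ^ 2)"
  have t0: "t i > 0" and t1: "t i \<le> 1" for i by (simp_all add: t_def)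
  have t4: "K / real (i + 1) ^ 4 = K * (t i)\<^sup>2" for i
    by (simp add: t_def power_divide power_mult[symmetric])
  have tlim: "t \<longlonglongrightarrow> 0"
  proof -
    have "(\<lambda>i. (1 / real (Suc i))\<^sup>2) \<longlonglongrightarrow> 0\<^sup>2" by (intro tendsto_power) (rule LIMSEQ_Suc, rule lim_1_over_n)
    then show ?thesis by (simp add: t_def[abs_def] power_divide add.commute)
  qed
  have intb: "integrable M f" if [measurable]: "f \<in> borel_measurable M" and "\<exists>B. \<forall>x\<in>space M. \<bar>f x\<bar> \<le> B" for f :: "'a \<Rightarrow> real"
    using that(2) by (auto intro!: integrable_const_bound AE_I2 that(1))
  have Xint: "integrable M (X k)" for k by (rule intb[OF X bd])
  have XXint: "integrable M (\<lambda>x. X i x * X j x)" for i j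
  proof (rule intb)
    obtain A B where "\<forall>x\<in>space M. \<bar>X i x\<bar> \<le> A" "\<forall>x\<in>space M. \<bar>X j x\<bar> \<le> B" using bd by blast
    then have "\<forall>x\<in>space M. \<bar>X i x * X j x\<bar> \<le> A * B"
      unfolding abs_mult by (intro ballI mult_mono') auto
    then show "\<exists>B. \<forall>x\<in>space M. \<bar>X i x * X j x\<bar> \<le> B" by blast
  qed measurable
  have X2int: "integrable M (\<lambda>x. (X i x)\<^sup>2)" for i using XXint[of i i] by (simp add: power2_eq_square)
  have D: "expectation (\<lambda>x. (X i x - X j x)\<^sup>2) \<le> 2 * K * (t i)\<^sup>2" and
    Dint: "integrable M (\<lambda>x. (X i x - X j x)\<^sup>2)" if "i \<le> j" for i j
  proof -
    have e: "(X i x - X j x)\<^sup>2 = X i x * X i x + X j x * X j x - 2 * (X i x * X j x)" for x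
      by (simp add: algebra_simps power2_eq_square)
    show "integrable M (\<lambda>x. (X i x - X j x)\<^sup>2)" unfolding e using XXint by auto
    have "expectation (\<lambda>x. (X i x - X j x)\<^sup>2)
      = expectation (\<lambda>x. X i x * X i x) + expectation (\<lambda>x. X j x * X j x) - 2 * expectation (\<lambda>x. X i x * X j x)"
      unfolding e using XXint by simp
    also have "\<dots> \<le> W + W - 2 * (W - K / real (i + 1) ^ 4)"
    proof -
      have "a + b - 2 * c \<le> W + W - 2 * (W - k)" if "a \<le> W" "b \<le> W" "W - k \<le> c" for a b c k :: real
      proof -
        have "2 * (W - k) \<le> 2 * c" using that(3) by simp
        then show ?thesis using add_mono[OF that(1,2)] by (intro diff_mono)
      qed
      then show ?thesis by this (fact up[OF order_refl] low[OF that])+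
    qed
    finally show "expectation (\<lambda>x. (X i x - X j x)\<^sup>2) \<le> 2 * K * (t i)\<^sup>2" unfolding t4 by simp
  qed
  have amgm: "\<bar>z\<bar> \<le> (s + z\<^sup>2 / s) / 2" if "s > 0" for s z :: real
  proof -
    have "0 \<le> (\<bar>z\<bar> - s)\<^sup>2" by simp
    then have "2 * \<bar>z\<bar> * s \<le> s\<^sup>2 + z\<^sup>2" by (simp add: power2_diff)
    then show ?thesis using that by (simp add: field_simps power2_eq_square)
  qed
  have conv: "AE x in M. (\<lambda>k. X k x) \<longlonglongrightarrow> Y x"
  proof -
    have each: "(\<integral>\<^sup>+x. ennreal \<bar>X k x - X (Suc k) x\<bar> \<partial>M) \<le> ennreal ((1 + 2 * K) / 2 * t k)" for k
    proof -
      have "(\<integral>\<^sup>+x. ennreal \<bar>X k x - X (Suc k) x\<bar> \<partial>M) = ennreal (expectation (\<lambda>x. \<bar>X k x - X (Suc k) x\<bar>))"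
        using Xint by (intro nn_integral_eq_integral) auto
      also have "expectation (\<lambda>x. \<bar>X k x - X (Suc k) x\<bar>) \<le> expectation (\<lambda>x. (t k + (X k x - X (Suc k) x)\<^sup>2 / t k) / 2)"
        using Xint Dint[of k "Suc k"] t0 by (intro integral_mono amgm) auto
      also have "\<dots> = (t k + expectation (\<lambda>x. (X k x - X (Suc k) x)\<^sup>2) / t k) / 2"
        using Dint[of k "Suc k"] prob_space by simp
      also have "\<dots> \<le> (t k + 2 * K * (t k)\<^sup>2 / t k) / 2"
        using D[of k "Suc k"] t0[of k] by (intro divide_right_mono add_left_mono) auto
      also have "\<dots> = (1 + 2 * K) / 2 * t k" using t0[of k] by (simp add: power2_eq_square algebra_simps add_divide_distrib)
      finally show ?thesis by (simp add: ennreal_leI)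
    qed
    have sumt: "summable t"
      using inverse_power_summable[of 2, where 'a = real, THEN summable_ignore_initial_segment, of 1]
      by (simp add: t_def[abs_def] inverse_eq_divide)
    \<comment> \<open>The expected total variation of the sequence is finite, so almost every path
      has finite variation and converges by telescoping.\<close>
    have "(\<integral>\<^sup>+x. (\<Sum>k. ennreal \<bar>X k x - X (Suc k) x\<bar>) \<partial>M) = (\<Sum>k. \<integral>\<^sup>+x. ennreal \<bar>X k x - X (Suc k) x\<bar> \<partial>M)"
      by (rule nn_integral_suminf) measurable
    also have "\<dots> \<le> (\<Sum>k. ennreal ((1 + 2 * K) / 2 * t k))" by (intro suminf_le each) auto
    also have "\<dots> = ennreal (\<Sum>k. (1 + 2 * K) / 2 * t k)"
      using sumt K t0 by (intro suminf_ennreal2) (auto simp: less_imp_le intro!: summable_mult mult_nonneg_nonneg)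
    also have "\<dots> < \<infinity>" by simp
    finally have "(\<integral>\<^sup>+x. (\<Sum>k. ennreal \<bar>X k x - X (Suc k) x\<bar>) \<partial>M) \<noteq> \<infinity>" by simp
    then have "AE x in M. (\<Sum>k. ennreal \<bar>X k x - X (Suc k) x\<bar>) \<noteq> \<infinity>"
      by (intro nn_integral_PInf_AE) auto
    then show ?thesis
    proof eventually_elim
      case (elim x)
      then have "summable (\<lambda>k. \<bar>X k x - X (Suc k) x\<bar>)" by (intro summable_suminf_not_top) auto
      then have "summable (\<lambda>k. X k x - X (Suc k) x)" by (rule summable_rabs_cancel)
      then have "(\<lambda>n. \<Sum>k<n. X k x - X (Suc k) x) \<longlonglongrightarrow> (\<Sum>k. X k x - X (Suc k) x)" by (rule summable_LIMSEQ)
      moreover have "(\<Sum>k<n. X k x - X (Suc k) x) = X 0 x - X n x" for n by (induction n) auto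
      ultimately have "(\<lambda>n. X 0 x - X n x) \<longlonglongrightarrow> (\<Sum>k. X k x - X (Suc k) x)" by simp
      then have "(\<lambda>n. X 0 x - (X 0 x - X n x)) \<longlonglongrightarrow> X 0 x - (\<Sum>k. X k x - X (Suc k) x)"
        by (intro tendsto_diff tendsto_const)
      then have "convergent (\<lambda>n. X n x)" by (auto simp: convergent_def)
      then show ?case by (simp add: Y_def convergent_LIMSEQ_iff)
    qed
  qed
  \<comment> \<open>Lets j tend to infinity in the bound for X i - X j; as a nonnegative integral
    this makes sense before Y is known to be integrable.\<close>
  have fatou: "(\<integral>\<^sup>+x. ennreal ((X i x - Y x)\<^sup>2) \<partial>M) \<le> ennreal (2 * K * (t i)\<^sup>2)" for i
  proof -
    have "(\<integral>\<^sup>+x. ennreal ((X i x - Y x)\<^sup>2) \<partial>M) = (\<integral>\<^sup>+x. liminf (\<lambda>j. ennreal ((X i x - X j x)\<^sup>2)) \<partial>M)"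
    proof (rule nn_integral_cong_AE)
      show "AE x in M. ennreal ((X i x - Y x)\<^sup>2) = liminf (\<lambda>j. ennreal ((X i x - X j x)\<^sup>2))"
        using conv
      proof eventually_elim
        case (elim x)
        then have "(\<lambda>j. ennreal ((X i x - X j x)\<^sup>2)) \<longlonglongrightarrow> ennreal ((X i x - Y x)\<^sup>2)"
          by (intro tendsto_ennrealI tendsto_power tendsto_diff tendsto_const)
        then show ?case by (intro lim_imp_Liminf[symmetric]) auto
      qed
    qed
    also have "\<dots> \<le> liminf (\<lambda>j. \<integral>\<^sup>+x. ennreal ((X i x - X j x)\<^sup>2) \<partial>M)"
      by (rule nn_integral_liminf) measurable
    also have "\<dots> \<le> ennreal (2 * K * (t i)\<^sup>2)"
    proof (rule Liminf_le)
      show "\<forall>\<^sub>F j in sequentially. (\<integral>\<^sup>+x. ennreal ((X i x - X j x)\<^sup>2) \<partial>M) \<le> ennreal (2 * K * (t i)\<^sup>2)"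
        using eventually_ge_at_top[of i]
      proof eventually_elim
        case (elim j)
        then show ?case using Dint[OF elim] D[OF elim] by (subst nn_integral_eq_integral) (auto intro: ennreal_leI)
      qed
    qed simp
    finally show ?thesis .
  qed
  have DYint: "integrable M (\<lambda>x. (X i x - Y x)\<^sup>2)" for i
    by (rule integrableI_bounded) (use fatou[of i] in \<open>auto simp: le_less_trans[OF _ ennreal_less_top]\<close>)
  have DY: "expectation (\<lambda>x. (X i x - Y x)\<^sup>2) \<le> 2 * K * (t i)\<^sup>2" for i
  proof -
    have "ennreal (expectation (\<lambda>x. (X i x - Y x)\<^sup>2)) \<le> ennreal (2 * K * (t i)\<^sup>2)"
      using fatou[of i] DYint[of i] by (subst (asm) nn_integral_eq_integral) auto
    then show ?thesis using K by (subst (asm) ennreal_le_iff) auto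
  qed
  have Y2int: "integrable M (\<lambda>x. (Y x)\<^sup>2)"
  proof (rule Bochner_Integration.integrable_bound)
    show "integrable M (\<lambda>x. 2 * (X 0 x - Y x)\<^sup>2 + 2 * (X 0 x)\<^sup>2)" using DYint X2int by auto
    have "y\<^sup>2 \<le> 2 * (x - y)\<^sup>2 + 2 * x\<^sup>2" for x y :: real
    proof -
      have "0 \<le> (2 * x - y)\<^sup>2" by simp
      then show ?thesis by (simp add: power2_eq_square algebra_simps)
    qed
    then show "AE x in M. norm ((Y x)\<^sup>2) \<le> norm (2 * (X 0 x - Y x)\<^sup>2 + 2 * (X 0 x)\<^sup>2)" by simp
  qed measurable
  have Yint: "integrable M Y" by (rule square_integrable_imp_integrable[OF Y Y2int])
  have 1: "\<bar>expectation Y - expectation (X i)\<bar> \<le> (1 + 2 * K) / 2 * t i" for i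
  proof -
    have "\<bar>expectation Y - expectation (X i)\<bar> = \<bar>expectation (\<lambda>x. X i x - Y x)\<bar>"
      using Yint Xint by (simp add: abs_minus_commute)
    also have "\<dots> \<le> expectation (\<lambda>x. \<bar>X i x - Y x\<bar>)" by (rule integral_abs_bound)
    also have "\<dots> \<le> expectation (\<lambda>x. (t i + (X i x - Y x)\<^sup>2 / t i) / 2)"
      using Yint Xint DYint t0 by (intro integral_mono amgm) auto
    also have "\<dots> = (t i + expectation (\<lambda>x. (X i x - Y x)\<^sup>2) / t i) / 2" using DYint prob_space by simp
    also have "\<dots> \<le> (t i + 2 * K * (t i)\<^sup>2 / t i) / 2"
      using DY[of i] t0[of i] by (intro divide_right_mono add_left_mono) auto
    also have "\<dots> = (1 + 2 * K) / 2 * t i" using t0[of i] by (simp add: power2_eq_square algebra_simps add_divide_distrib)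
    finally show ?thesis .
  qed
  have "(\<lambda>i. expectation Y - expectation (X i)) \<longlonglongrightarrow> 0"
  proof (rule Lim_null_comparison)
    show "(\<lambda>i. (1 + 2 * K) / 2 * t i) \<longlonglongrightarrow> 0" using tendsto_mult[OF tendsto_const tlim] by simp
  qed (use 1 in auto)
  moreover have "(\<lambda>i. expectation Y - expectation (X i)) \<longlonglongrightarrow> expectation Y - m" by (intro tendsto_diff tendsto_const mean)
  ultimately have m: "expectation Y = m" using LIMSEQ_unique by fastforce
  have 2: "\<bar>expectation (\<lambda>x. (Y x)\<^sup>2) - W\<bar> \<le> (W + 5 * K) * t i" for i
  proof -
    have W: "expectation (\<lambda>x. (X i x)\<^sup>2) \<le> W" "W - K * (t i)\<^sup>2 \<le> expectation (\<lambda>x. (X i x)\<^sup>2)"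
      using up[of i i] low[of i i] unfolding t4 by (simp_all add: power2_eq_square)
    \<comment> \<open>With s = t i every term on the right has expectation O(t i).\<close>
    have pt: "\<bar>y\<^sup>2 - x\<^sup>2\<bar> \<le> (x - y)\<^sup>2 + (x - y)\<^sup>2 / s + s * x\<^sup>2" if "s > 0" for x y s :: real
    proof -
      have "\<bar>2 * x * (y - x)\<bar> = 2 * (\<bar>x\<bar> * \<bar>x - y\<bar>)" by (simp add: abs_mult abs_minus_commute)
      also have "\<dots> \<le> (x - y)\<^sup>2 / s + s * x\<^sup>2"
      proof -
        have "0 \<le> (\<bar>x - y\<bar> - s * \<bar>x\<bar>)\<^sup>2" by simp
        moreover have "(A - s * B)\<^sup>2 = A\<^sup>2 - 2 * s * (B * A) + s * s * B\<^sup>2" for A B :: real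
          by (simp add: power2_eq_square algebra_simps)
        ultimately have "2 * s * (\<bar>x\<bar> * \<bar>x - y\<bar>) \<le> (x - y)\<^sup>2 + s * s * x\<^sup>2" by simp
        then show ?thesis using that by (simp add: field_simps)
      qed
      moreover have "y\<^sup>2 - x\<^sup>2 = (x - y)\<^sup>2 + 2 * x * (y - x)" by (simp add: algebra_simps power2_eq_square)
      ultimately show ?thesis using zero_le_power2[of "x - y"] by linarith
    qed
    have "\<bar>expectation (\<lambda>x. (Y x)\<^sup>2) - expectation (\<lambda>x. (X i x)\<^sup>2)\<bar> = \<bar>expectation (\<lambda>x. (Y x)\<^sup>2 - (X i x)\<^sup>2)\<bar>"
      using Y2int X2int by simp
    also have "\<dots> \<le> expectation (\<lambda>x. \<bar>(Y x)\<^sup>2 - (X i x)\<^sup>2\<bar>)" by (rule integral_abs_bound)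
    also have "\<dots> \<le> expectation (\<lambda>x. (X i x - Y x)\<^sup>2 + (X i x - Y x)\<^sup>2 / t i + t i * (X i x)\<^sup>2)"
      using Y2int X2int DYint t0 by (intro integral_mono pt) auto
    also have "\<dots> = expectation (\<lambda>x. (X i x - Y x)\<^sup>2) + expectation (\<lambda>x. (X i x - Y x)\<^sup>2) / t i + t i * expectation (\<lambda>x. (X i x)\<^sup>2)"
      using X2int DYint by simp
    also have "\<dots> \<le> 2 * K * (t i)\<^sup>2 + 2 * K * (t i)\<^sup>2 / t i + t i * W"
      using DY[of i] t0[of i] W by (intro add_mono divide_right_mono mult_left_mono) auto
    also have "2 * K * (t i)\<^sup>2 / t i = 2 * K * t i" using t0[of i] by (simp add: power2_eq_square)
    finally have 3: "\<bar>expectation (\<lambda>x. (Y x)\<^sup>2) - expectation (\<lambda>x. (X i x)\<^sup>2)\<bar> \<le> 2 * K * (t i)\<^sup>2 + 2 * K * t i + t i * W" .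
    have "K * (t i)\<^sup>2 \<le> K * t i" using K t0[of i] t1[of i] by (intro mult_left_mono) (auto simp: power2_eq_square mult_le_one intro: mult_left_le)
    then show ?thesis using 3 W by (simp add: algebra_simps abs_le_iff)
  qed
  have "(\<lambda>i::nat. expectation (\<lambda>x. (Y x)\<^sup>2) - W) \<longlonglongrightarrow> 0"
  proof (rule Lim_null_comparison)
    show "(\<lambda>i. (W + 5 * K) * t i) \<longlonglongrightarrow> 0" using tendsto_mult[OF tendsto_const tlim] by simp
  qed (use 2 in auto)
  then have "expectation (\<lambda>x. (Y x)\<^sup>2) = W" by (simp add: LIMSEQ_const_iff)
  then show "integrable M (\<lambda>x. lim (\<lambda>k. X k x))" "integrable M (\<lambda>x. (lim (\<lambda>k. X k x))\<^sup>2)"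
    "expectation (\<lambda>x. lim (\<lambda>k. X k x)) = m" "expectation (\<lambda>x. (lim (\<lambda>k. X k x))\<^sup>2) = W"
    using Yint Y2int m by (simp_all add: Y_def)
qed

text \<open>The power 8 makes \<open>sqrt (mesh k)\<close> equal to (k + 1)^(-4), the rate that
  \<open>L2_convergence\<close> asks for.\<close>

definition mesh :: "nat \<Rightarrow> real" where "mesh k = 1 / real (k + 1) ^ 8"

lemma mesh_pos: "mesh k > 0" by (simp add: mesh_def)

lemma mesh_antimono: "i \<le> j \<Longrightarrow> mesh j \<le> mesh i"
  unfolding mesh_def by (intro divide_left_mono power_mono) auto

lemma mesh_tendsto: "mesh \<longlonglongrightarrow> 0"
proof -
  have "(\<lambda>i. (1 / real (Suc i)) ^ 8) \<longlonglongrightarrow> 0 ^ 8" by (intro tendsto_power) (rule LIMSEQ_Suc, rule lim_1_over_n)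
  then show ?thesis by (simp add: mesh_def[abs_def] power_divide add.commute)
qed

text \<open>Consecutive meshes have ratio tending to 1, so monotonicity of the numerator lets the sequence
  control the continuous limit.\<close>

lemma tendsto_at_right_mesh_iff:
  fixes F :: "real \<Rightarrow> real"
  assumes mono: "\<And>a b. 0 < a \<Longrightarrow> a \<le> b \<Longrightarrow> F a \<le> F b" and nonneg: "\<And>a. F a \<ge> 0"
  shows "((\<lambda>e. 1 / (2 * e) * F e) \<longlongrightarrow> l) (at_right 0) \<longleftrightarrow> (\<lambda>k. 1 / (2 * mesh k) * F (mesh k)) \<longlonglongrightarrow> l"
    (is "(?G \<longlongrightarrow> l) _ \<longleftrightarrow> ?s \<longlonglongrightarrow> l")
proof
  assume "(?G \<longlongrightarrow> l) (at_right 0)"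
  moreover have "filterlim mesh (at_right 0) sequentially"
  proof -
    have "mesh k \<noteq> 0" for k using mesh_pos[of k] by simp
    then show ?thesis using mesh_tendsto mesh_pos by (auto simp: filterlim_at intro!: always_eventually)
  qed
  ultimately show "?s \<longlonglongrightarrow> l" by (rule filterlim_compose)
next
  assume s: "?s \<longlonglongrightarrow> l"
  \<comment> \<open>Index of the mesh interval containing e: e^(-1/8) lies between \<kappa> e + 1
    and \<kappa> e + 2, because \<open>mesh\<close> counts from k + 1. The truncated subtraction is
    exact for e \<le> 1.\<close>
  define \<kappa> where "\<kappa> = (\<lambda>e::real. nat \<lfloor>e powr (- (1 / 8))\<rfloor> - 1)"
  define q where "q = (\<lambda>k. mesh k / mesh (k + 1))"
  have qpos: "q k > 0" for k by (simp add: q_def mesh_pos)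
  have qlim: "q \<longlonglongrightarrow> 1"
  proof -
    have "(\<lambda>k. (1 + 1 / real (Suc k)) ^ 8) \<longlonglongrightarrow> (1 + 0) ^ 8"
      by (intro tendsto_power tendsto_add tendsto_const) (rule LIMSEQ_Suc, rule lim_1_over_n)
    moreover have "q k = (1 + 1 / real (Suc k)) ^ 8" for k
    proof -
      have "q k = (real (k + 2) / real (k + 1)) ^ 8" by (simp add: q_def mesh_def power_divide)
      also have "real (k + 2) / real (k + 1) = 1 + 1 / real (Suc k)" by (simp add: field_simps)
      finally show ?thesis .
    qed
    then have "q = (\<lambda>k. (1 + 1 / real (Suc k)) ^ 8)" by (rule ext)
    ultimately show ?thesis by simp
  qed
  have \<kappa>lim: "filterlim \<kappa> sequentially (at_right 0)"
    unfolding \<kappa>_def by real_asymp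
  have br: "mesh (\<kappa> e + 1) \<le> e \<and> e \<le> mesh (\<kappa> e)" if e: "0 < e" "e \<le> 1" for e
  proof -
    define y where "y = e powr (- (1 / 8))"
    have y1: "y \<ge> 1" using e powr_mono2'[of "- (1/8)" e 1] by (simp add: y_def)
    have y8: "e = 1 / y ^ 8"
    proof -
      have "y ^ 8 = y powr 8" using powr_realpow[of y 8] y1 by simp
      also have "\<dots> = e powr (- 1)" by (simp add: y_def powr_powr del: powr_numeral)
      finally show ?thesis using e by (simp add: powr_minus_divide)
    qed
    have "real (nat \<lfloor>y\<rfloor>) = of_int \<lfloor>y\<rfloor>" "nat \<lfloor>y\<rfloor> \<ge> 1" using y1 by (auto simp: le_nat_iff le_floor_iff)
    then have k: "real (\<kappa> e + 1) \<le> y" "y \<le> real (\<kappa> e + 1 + 1)"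
      unfolding \<kappa>_def y_def[symmetric] by (auto simp: of_nat_diff) linarith+
    have "1 / real (\<kappa> e + 1 + 1) ^ 8 \<le> 1 / y ^ 8" using k y1 by (intro divide_left_mono power_mono) auto
    moreover have "1 / y ^ 8 \<le> 1 / real (\<kappa> e + 1) ^ 8" using k y1 by (intro divide_left_mono power_mono) auto
    ultimately show ?thesis by (simp add: mesh_def y8)
  qed
  have ev: "\<forall>\<^sub>F e in at_right (0::real). 0 < e \<and> e \<le> 1"
    unfolding eventually_at_right_field by (intro exI[of _ 1]) auto
  show "(?G \<longlongrightarrow> l) (at_right 0)"
  proof (rule tendsto_sandwich)
    show "\<forall>\<^sub>F e in at_right 0. ?s (\<kappa> e + 1) / q (\<kappa> e) \<le> ?G e"
      using ev
    proof eventually_elim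
      case (elim e)
      then have b: "mesh (\<kappa> e + 1) \<le> e" "e \<le> mesh (\<kappa> e)" using br by auto
      have "?s (\<kappa> e + 1) / q (\<kappa> e) = F (mesh (\<kappa> e + 1)) / (2 * mesh (\<kappa> e))"
        using mesh_pos[of "\<kappa> e + 1"] by (simp add: q_def field_simps)
      also have "\<dots> \<le> F e / (2 * e)" using b elim nonneg mesh_pos by (intro frac_le mono) auto
      finally show ?case by simp
    qed
    show "\<forall>\<^sub>F e in at_right 0. ?G e \<le> ?s (\<kappa> e) * q (\<kappa> e)"
      using ev
    proof eventually_elim
      case (elim e)
      then have b: "mesh (\<kappa> e + 1) \<le> e" "e \<le> mesh (\<kappa> e)" using br by auto
      have "F e / (2 * e) \<le> F (mesh (\<kappa> e)) / (2 * mesh (\<kappa> e + 1))"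
        using b elim nonneg mesh_pos[of "\<kappa> e + 1"] by (intro frac_le mono) auto
      also have "\<dots> = ?s (\<kappa> e) * q (\<kappa> e)"
        using mesh_pos[of "\<kappa> e + 1"] mesh_pos[of "\<kappa> e"] by (simp add: q_def field_simps)
      finally show ?case by simp
    qed
    have "(\<lambda>k. ?s (k + 1) / q k) \<longlonglongrightarrow> l / 1" using LIMSEQ_ignore_initial_segment[OF s, of 1] qlim by (intro tendsto_divide) auto
    from filterlim_compose[OF this \<kappa>lim] show "((\<lambda>e. ?s (\<kappa> e + 1) / q (\<kappa> e)) \<longlongrightarrow> l) (at_right 0)" by simp
    have "(\<lambda>k. ?s k * q k) \<longlonglongrightarrow> l * 1" by (intro tendsto_mult s qlim)
    from filterlim_compose[OF this \<kappa>lim] show "((\<lambda>e. ?s (\<kappa> e) * q (\<kappa> e)) \<longlongrightarrow> l) (at_right 0)" by simp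
  qed
qed

section \<open>The variance of the Leray measure\<close>

text \<open>Finiteness of the singular integral is an assumption here, which separates the
  probabilistic argument from the geometry of the covariance.\<close>

locale random_wave =
  fixes E :: nat and R :: "(real ^ 'n) set"
  assumes E: "E \<ge> 1" and fin: "finite (frequencies E :: (real ^ 'n) set)"
    and ne: "(frequencies E :: (real ^ 'n) set) \<noteq> {}"
    and hs: "half_system (frequencies E) R"
    and sing: "(\<integral>\<^sup>+x. sing_weight (covariance (frequencies E :: (real ^ 'n) set) x) \<partial>torus) < \<infinity>"
begin

abbreviation L :: "(real ^ 'n) set" where "L \<equiv> frequencies E"
abbreviation u :: "real ^ 'n \<Rightarrow> real" where "u \<equiv> covariance L"
abbreviation P where "P \<equiv> coeff_space R"
abbreviation f where "f \<equiv> eigenfunction E R"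

sublocale T: prob_space "torus :: (real ^ 'n) measure" by (rule prob_space_torus)

lemma prob_space_P: "prob_space P"
proof -
  interpret M: prob_space "\<Pi>\<^sub>M k\<in>R. std_normal" by (rule prob_space_PiM) (rule std_normal.prob_space_axioms)
  interpret pair_prob_space "\<Pi>\<^sub>M k\<in>R. std_normal" "\<Pi>\<^sub>M k\<in>R. std_normal" ..
  show ?thesis unfolding coeff_space_def by (rule prob_space_axioms)
qed

sublocale P: prob_space P by (rule prob_space_P)

sublocale PT: pair_sigma_finite P "torus :: (real ^ 'n) measure" ..

lemma sym_L: "uminus ` L = L"
  by (force simp: frequencies_def image_iff intro: exI[of _ "- _"])

lemma L_integer: "L \<subseteq> integer_vectors"
  by (auto simp: frequencies_def integer_vectors_def)

lemma u_minus: "u (- x) = u x"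
  by (simp add: covariance_def)

lemma u_measurable_torus [measurable]: "u \<in> borel_measurable torus"
  by (rule measurable_torus) measurable

lemma f_eq: "f \<omega> x = sqrt (2 / real (card L)) * (\<Sum>k\<in>R. fst \<omega> k * cos (2 * pi * (k \<bullet> x)) - snd \<omega> k * sin (2 * pi * (k \<bullet> x)))"
  by (cases \<omega>) (simp add: eigenfunction_def)

lemma coefficient_measurable [measurable]:
  assumes "k \<in> R"
  shows "(\<lambda>\<omega>. fst \<omega> k) \<in> borel_measurable P" "(\<lambda>\<omega>. snd \<omega> k) \<in> borel_measurable P"
proof -
  have c: "(\<lambda>\<omega>. \<omega> k) \<in> borel_measurable (\<Pi>\<^sub>M k\<in>R. std_normal)"
    using measurable_component_singleton[OF assms, of "\<lambda>_. std_normal"] by simp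
  show "(\<lambda>\<omega>. fst \<omega> k) \<in> borel_measurable P" unfolding coeff_space_def
    by (rule measurable_compose[OF measurable_fst c])
  show "(\<lambda>\<omega>. snd \<omega> k) \<in> borel_measurable P" unfolding coeff_space_def
    by (rule measurable_compose[OF measurable_snd c])
qed

lemma f_joint_measurable [measurable]: "(\<lambda>p. f (fst p) (snd p)) \<in> borel_measurable (P \<Otimes>\<^sub>M torus)"
proof -
  have 1: "(\<lambda>p. fst (fst p) k) \<in> borel_measurable (P \<Otimes>\<^sub>M torus)" "(\<lambda>p. snd (fst p) k) \<in> borel_measurable (P \<Otimes>\<^sub>M torus)"
    if "k \<in> R" for k
    using measurable_compose[OF measurable_fst coefficient_measurable(1)[OF that]]
      measurable_compose[OF measurable_fst coefficient_measurable(2)[OF that]] by auto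
  have 2: "(\<lambda>p. g (snd p)) \<in> borel_measurable (P \<Otimes>\<^sub>M torus)" if "g \<in> borel_measurable borel" for g :: "real ^ 'n \<Rightarrow> real"
    by (rule measurable_compose[OF measurable_snd measurable_torus[OF that]])
  have 3: "(\<lambda>p. cos (2 * pi * (k \<bullet> snd p))) \<in> borel_measurable (P \<Otimes>\<^sub>M torus)"
    "(\<lambda>p. sin (2 * pi * (k \<bullet> snd p))) \<in> borel_measurable (P \<Otimes>\<^sub>M torus)" for k :: "real ^ 'n"
    using 2[of "\<lambda>x. cos (2 * pi * (k \<bullet> x))"] 2[of "\<lambda>x. sin (2 * pi * (k \<bullet> x))"] by simp_all
  show ?thesis unfolding f_eq
    by (intro borel_measurable_times borel_measurable_const borel_measurable_sum borel_measurable_diff 1 3) auto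
qed

lemma f_measurable_x [measurable]: "f \<omega> \<in> borel_measurable borel"
  unfolding f_eq[abs_def] by measurable

lemma f_measurable_torus [measurable]: "f \<omega> \<in> borel_measurable torus"
  by (rule measurable_torus) measurable

lemma f_measurable_\<omega> [measurable]: "(\<lambda>\<omega>. f \<omega> x) \<in> borel_measurable P"
  unfolding f_eq by (intro borel_measurable_times borel_measurable_const borel_measurable_sum borel_measurable_diff coefficient_measurable)

section \<open>Moments of the occupation measure\<close>

definition occ :: "real \<Rightarrow> (real ^ 'n \<Rightarrow> real) \<times> (real ^ 'n \<Rightarrow> real) \<Rightarrow> real" where
  "occ e \<omega> = measure lborel {x \<in> fundamental_cube. \<bar>f \<omega> x\<bar> < e}"

lemma occ_set [measurable]: "{x \<in> fundamental_cube. \<bar>f \<omega> x\<bar> < e} \<in> sets borel"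
proof -
  have "{x \<in> fundamental_cube. \<bar>f \<omega> x\<bar> < e} = {x \<in> space borel. x \<in> fundamental_cube \<and> \<bar>f \<omega> x\<bar> < e}" by simp
  also have "\<dots> \<in> sets borel" by measurable
  finally show ?thesis .
qed

lemma occ_finite: "emeasure lborel {x \<in> fundamental_cube. \<bar>f \<omega> x\<bar> < e} \<le> 1"
  using emeasure_mono[of "{x \<in> fundamental_cube. \<bar>f \<omega> x\<bar> < e}" "fundamental_cube :: (real ^ 'n) set" lborel]
  by (auto simp: emeasure_fundamental_cube)

lemma ennreal_occ: "ennreal (occ e \<omega>) = (\<integral>\<^sup>+x. indicator {- e<..<e} (f \<omega> x) \<partial>torus)"
proof -
  have "ennreal (occ e \<omega>) = emeasure lborel {x \<in> fundamental_cube. \<bar>f \<omega> x\<bar> < e}"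
    unfolding occ_def using occ_finite[of \<omega> e] by (intro emeasure_eq_ennreal_measure[symmetric]) (auto simp: top_unique)
  also have "\<dots> = (\<integral>\<^sup>+x. indicator {x \<in> fundamental_cube. \<bar>f \<omega> x\<bar> < e} x \<partial>lborel)"
    by (rule nn_integral_indicator[symmetric]) simp
  also have "\<dots> = (\<integral>\<^sup>+x. indicator {- e<..<e} (f \<omega> x) \<partial>torus)"
    unfolding nn_integral_torus by (intro nn_integral_cong) (auto simp: indicator_def)
  finally show ?thesis .
qed

lemma occ_nonneg: "occ e \<omega> \<ge> 0" by (simp add: occ_def)

lemma occ_le_1: "occ e \<omega> \<le> 1"
proof -
  have "ennreal (occ e \<omega>) \<le> 1"
    unfolding occ_def using occ_finite[of \<omega> e] by (subst emeasure_eq_ennreal_measure[symmetric]) (auto simp: top_unique)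
  then show ?thesis by (simp add: ennreal_le_1)
qed

lemma occ_mono: "a \<le> b \<Longrightarrow> occ a \<omega> \<le> occ b \<omega>"
proof -
  assume ab: "a \<le> b"
  have "ennreal (occ a \<omega>) \<le> ennreal (occ b \<omega>)"
    unfolding ennreal_occ using ab by (intro nn_integral_mono) (auto simp: indicator_def)
  then show ?thesis using occ_nonneg by (simp add: ennreal_le_iff)
qed

lemma occ_measurable [measurable]: "occ e \<in> borel_measurable P"
proof -
  have "occ e = (\<lambda>\<omega>. enn2real (\<integral>\<^sup>+x. indicator {- e<..<e} (f \<omega> x) \<partial>torus))"
    unfolding ennreal_occ[symmetric] using occ_nonneg by (simp add: fun_eq_iff)
  also have "\<dots> \<in> borel_measurable P"
  proof (rule borel_measurable_enn2real)
    have "(\<lambda>p. indicator {- e<..<e} (f (fst p) (snd p)) :: ennreal) \<in> borel_measurable (P \<Otimes>\<^sub>M torus)"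
      by measurable
    then show "(\<lambda>\<omega>. \<integral>\<^sup>+x. indicator {- e<..<e} (f \<omega> x) \<partial>torus) \<in> borel_measurable P"
      by (intro T.borel_measurable_nn_integral) (simp add: split_def)
  qed
  finally show ?thesis .
qed

text \<open>Both sides are definite descriptions over the same set of candidate limits, so they
  agree for every \<omega>, also where no limit exists.\<close>

lemma leray_measure_eq: "leray_measure (f \<omega>) = lim (\<lambda>k. 1 / (2 * mesh k) * occ (mesh k) \<omega>)"
  unfolding leray_measure_def t2_space_class.Lim_def
  by (subst tendsto_at_right_mesh_iff[symmetric, where F = "\<lambda>e. occ e \<omega>"])
    (auto simp: occ_mono occ_nonneg occ_def[symmetric])

lemma occ_expectation: "(\<integral>\<^sup>+\<omega>. ennreal (occ e \<omega>) \<partial>P) = emeasure std_normal {- e<..<e}"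
proof -
  have u0: "u 0 = 1" using fin ne by (simp add: covariance_def)
  have "(\<integral>\<^sup>+\<omega>. ennreal (occ e \<omega>) \<partial>P) = (\<integral>\<^sup>+x. \<integral>\<^sup>+\<omega>. indicator {- e<..<e} (f \<omega> x) \<partial>P \<partial>torus)"
    unfolding ennreal_occ by (rule PT.Fubini'[symmetric]) (simp add: split_def)
  also have "\<dots> = (\<integral>\<^sup>+x. emeasure std_normal {- e<..<e} \<partial>(torus :: (real ^ 'n) measure))"
  proof (rule nn_integral_cong)
    fix x :: "real ^ 'n"
    have "(\<integral>\<^sup>+\<omega>. indicator {- e<..<e} (f \<omega> x) \<partial>P) = gauss2 (\<lambda>p q. indicator {- e<..<e} p) 1 (u (x - x)) (sqrt (1 - (u (x - x))\<^sup>2))"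
      by (rule nn_integral_eigenfunction_pair[OF E fin ne hs, where h = "\<lambda>p q. indicator {- e<..<e} p"]) measurable
    also have "\<dots> = (\<integral>\<^sup>+x. indicator {- e<..<e} x \<partial>std_normal)"
      unfolding gauss2_def using std_normal.emeasure_space_1 by simp
    also have "\<dots> = emeasure std_normal {- e<..<e}" by (rule nn_integral_indicator) simp
    finally show "(\<integral>\<^sup>+\<omega>. indicator {- e<..<e} (f \<omega> x) \<partial>P) = emeasure std_normal {- e<..<e}" .
  qed
  also have "\<dots> = emeasure std_normal {- e<..<e}" using T.emeasure_space_1 by simp
  finally show ?thesis .
qed

text \<open>Tonelli moves the expectation inside, where it depends only on u (x - y); evenness and
  periodicity of u then remove the integration over the base point.\<close>

lemma occ_correlation: "(\<integral>\<^sup>+\<omega>. ennreal (occ e \<omega> * occ e' \<omega>) \<partial>P) = (\<integral>\<^sup>+x. box_prob e e' (u x) \<partial>torus)"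
proof -
  let ?i = "\<lambda>e r. indicator {- e<..<e} (r::real) :: ennreal"
  have m1: "(\<lambda>p. \<integral>\<^sup>+y. ?i e' (f (fst p) y) \<partial>torus) \<in> borel_measurable (P \<Otimes>\<^sub>M (torus :: (real ^ 'n) measure))"
  proof (rule measurable_compose[OF measurable_fst])
    show "(\<lambda>\<omega>. \<integral>\<^sup>+y. ?i e' (f \<omega> y) \<partial>torus) \<in> borel_measurable P"
      unfolding ennreal_occ[symmetric] by measurable
  qed
  have "(\<integral>\<^sup>+\<omega>. ennreal (occ e \<omega> * occ e' \<omega>) \<partial>P)
    = (\<integral>\<^sup>+\<omega>. (\<integral>\<^sup>+x. ?i e (f \<omega> x) * (\<integral>\<^sup>+y. ?i e' (f \<omega> y) \<partial>torus) \<partial>torus) \<partial>P)"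
    by (simp add: ennreal_mult occ_nonneg ennreal_occ nn_integral_multc)
  also have "\<dots> = (\<integral>\<^sup>+x. (\<integral>\<^sup>+\<omega>. ?i e (f \<omega> x) * (\<integral>\<^sup>+y. ?i e' (f \<omega> y) \<partial>torus) \<partial>P) \<partial>torus)"
  proof (rule PT.Fubini'[symmetric])
    have "(\<lambda>p. ?i e (f (fst p) (snd p)) * (\<integral>\<^sup>+y. ?i e' (f (fst p) y) \<partial>torus)) \<in> borel_measurable (P \<Otimes>\<^sub>M torus)"
      by (intro borel_measurable_times_ennreal m1) measurable
    then show "(\<lambda>(\<omega>, x). ?i e (f \<omega> x) * (\<integral>\<^sup>+y. ?i e' (f \<omega> y) \<partial>torus)) \<in> borel_measurable (P \<Otimes>\<^sub>M torus)"
      by (simp add: split_def)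
  qed
  also have "\<dots> = (\<integral>\<^sup>+x. (\<integral>\<^sup>+y. box_prob e e' (u (x - y)) \<partial>torus) \<partial>torus)"
  proof (rule nn_integral_cong)
    fix x :: "real ^ 'n"
    have "(\<integral>\<^sup>+\<omega>. ?i e (f \<omega> x) * (\<integral>\<^sup>+y. ?i e' (f \<omega> y) \<partial>torus) \<partial>P) = (\<integral>\<^sup>+\<omega>. (\<integral>\<^sup>+y. ?i e (f \<omega> x) * ?i e' (f \<omega> y) \<partial>torus) \<partial>P)"
      by (intro nn_integral_cong nn_integral_cmult[symmetric]) measurable
    also have "\<dots> = (\<integral>\<^sup>+y. (\<integral>\<^sup>+\<omega>. ?i e (f \<omega> x) * ?i e' (f \<omega> y) \<partial>P) \<partial>torus)"
    proof (rule PT.Fubini'[symmetric])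
      have "(\<lambda>p. ?i e (f (fst p) x)) \<in> borel_measurable (P \<Otimes>\<^sub>M (torus :: (real ^ 'n) measure))"
        by (rule measurable_compose[OF measurable_fst]) measurable
      then have "(\<lambda>p. ?i e (f (fst p) x) * ?i e' (f (fst p) (snd p))) \<in> borel_measurable (P \<Otimes>\<^sub>M torus)"
        by (intro borel_measurable_times_ennreal) measurable
      then show "(\<lambda>(\<omega>, y). ?i e (f \<omega> x) * ?i e' (f \<omega> y)) \<in> borel_measurable (P \<Otimes>\<^sub>M torus)"
        by (simp add: split_def)
    qed
    also have "\<dots> = (\<integral>\<^sup>+y. box_prob e e' (u (x - y)) \<partial>torus)"
      unfolding box_prob_def
      by (intro nn_integral_cong nn_integral_eigenfunction_pair[OF E fin ne hs, where h = "\<lambda>p q. ?i e p * ?i e' q"]) measurable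
    finally show "(\<integral>\<^sup>+\<omega>. ?i e (f \<omega> x) * (\<integral>\<^sup>+y. ?i e' (f \<omega> y) \<partial>torus) \<partial>P) = (\<integral>\<^sup>+y. box_prob e e' (u (x - y)) \<partial>torus)" .
  qed
  also have "\<dots> = (\<integral>\<^sup>+x. (\<integral>\<^sup>+y. box_prob e e' (u y) \<partial>torus) \<partial>(torus :: (real ^ 'n) measure))"
  proof (rule nn_integral_cong)
    fix x :: "real ^ 'n"
    have "(\<integral>\<^sup>+y. box_prob e e' (u (x - y)) \<partial>torus) = (\<integral>\<^sup>+y. box_prob e e' (u (y + - x)) \<partial>torus)"
      using u_minus[of "x - y" for y] by (intro nn_integral_cong) (metis minus_diff_eq uminus_add_conv_diff add.commute)
    also have "\<dots> = (\<integral>\<^sup>+y. box_prob e e' (u y) \<partial>torus)"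
      by (rule nn_integral_torus_translate) (auto simp: covariance_periodic[OF L_integer])
    finally show "(\<integral>\<^sup>+y. box_prob e e' (u (x - y)) \<partial>torus) = (\<integral>\<^sup>+y. box_prob e e' (u y) \<partial>torus)" .
  qed
  also have "\<dots> = (\<integral>\<^sup>+x. box_prob e e' (u x) \<partial>torus)" using T.emeasure_space_1 by simp
  finally show ?thesis .
qed

end

text \<open>With s = sqrt (1 - r^2) the remainder is exactly (1 - s)^2 (s + 2) / (2 s), while r^4 =
  (1 - s)^2 (1 + s)^2. The computation gives the power -1/2; it is relaxed to -3/4, the weight that
  is controlled already.\<close>

lemma inverse_sqrt_expansion:
  fixes r :: real
  assumes r: "\<bar>r\<bar> < 1"
  shows "0 \<le> 1 / sqrt (1 - r\<^sup>2) - 1 - r\<^sup>2 / 2"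
    and "1 / sqrt (1 - r\<^sup>2) - 1 - r\<^sup>2 / 2 \<le> 3 / 2 * r ^ 4 * (1 - r\<^sup>2) powr (- (3 / 4))"
proof -
  have r2: "r\<^sup>2 < 1" using r by (simp add: abs_square_less_1)
  define s where "s = sqrt (1 - r\<^sup>2)"
  have s: "0 < s" "s \<le> 1" "s\<^sup>2 = 1 - r\<^sup>2" using r2 by (auto simp: s_def)
  have r_s: "r\<^sup>2 = (1 - s) * (1 + s)" using s(3) by (simp add: algebra_simps power2_eq_square)
  have e: "1 / s - 1 - r\<^sup>2 / 2 = (1 - s)\<^sup>2 * (s + 2) / (2 * s)"
    unfolding r_s using s(1) by (simp add: field_simps power2_eq_square)
  then show "0 \<le> 1 / sqrt (1 - r\<^sup>2) - 1 - r\<^sup>2 / 2"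
    unfolding s_def[symmetric] using s by simp
  have "r ^ 4 = (r\<^sup>2)\<^sup>2" by (simp add: power_mult[symmetric])
  also have "\<dots> = (1 - s)\<^sup>2 * (1 + s)\<^sup>2" unfolding r_s by (simp add: power_mult_distrib)
  finally have r4: "r ^ 4 = (1 - s)\<^sup>2 * (1 + s)\<^sup>2" .
  have "(1 - s)\<^sup>2 * 1 \<le> (1 - s)\<^sup>2 * (1 + s)\<^sup>2" using s by (intro mult_left_mono one_le_power) auto
  then have "(1 - s)\<^sup>2 * (s + 2) / (2 * s) \<le> r ^ 4 * 3 / (2 * s)"
    unfolding r4 using s by (intro divide_right_mono mult_mono) auto
  also have "\<dots> = 3 / 2 * r ^ 4 * (1 / s)" by simp
  also have "\<dots> \<le> 3 / 2 * r ^ 4 * (1 - r\<^sup>2) powr (- (3 / 4))"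
  proof (rule mult_left_mono)
    have "1 / s = (1 - r\<^sup>2) powr (- (1 / 2))" using r2 by (simp add: s_def powr_half_sqrt powr_minus_divide)
    also have "\<dots> \<le> (1 - r\<^sup>2) powr (- (3 / 4))" using r2 by (intro powr_mono') auto
    finally show "1 / s \<le> (1 - r\<^sup>2) powr (- (3 / 4))" .
  qed simp
  finally show "1 / sqrt (1 - r\<^sup>2) - 1 - r\<^sup>2 / 2 \<le> 3 / 2 * r ^ 4 * (1 - r\<^sup>2) powr (- (3 / 4))"
    unfolding s_def[symmetric] e .
qed

context random_wave
begin

text \<open>\<open>w x\<close> is the density at the origin of the values of the field at two points
  differing by x, and \<open>q\<close> is the weight of the error. The junk values at |u x| = 1
  concern a null set.\<close>

definition w :: "real ^ 'n \<Rightarrow> real" where "w x = 1 / (2 * pi * sqrt (1 - (u x)\<^sup>2))"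
definition q :: "real ^ 'n \<Rightarrow> real" where "q x = (1 - (u x)\<^sup>2) powr (- (3 / 4))"

lemma w_measurable [measurable]: "w \<in> borel_measurable torus"
  unfolding w_def[abs_def] by measurable

lemma q_measurable [measurable]: "q \<in> borel_measurable torus"
  unfolding q_def[abs_def] by measurable

lemma AE_u: "AE x in torus. \<bar>u x\<bar> < 1"
proof -
  have "AE x in torus. sing_weight (u x) \<noteq> \<infinity>"
    using sing by (intro nn_integral_PInf_AE) auto
  then show ?thesis by eventually_elim (auto simp: sing_weight_def split: if_splits)
qed

lemma q_nonneg: "q x \<ge> 0" by (simp add: q_def)

lemma ennreal_q_le: "ennreal (q x) \<le> sing_weight (u x)"
  by (simp add: q_def sing_weight_def)

lemma q_integrable: "integrable torus q"
proof (rule integrableI_bounded)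
  have "(\<integral>\<^sup>+x. ennreal (norm (q x)) \<partial>torus) \<le> (\<integral>\<^sup>+x. sing_weight (u x) \<partial>torus)"
    using q_nonneg ennreal_q_le by (intro nn_integral_mono) simp
  then show "(\<integral>\<^sup>+x. ennreal (norm (q x)) \<partial>torus) < \<infinity>" using sing by (rule le_less_trans)
qed measurable

lemma w_integrable: "integrable torus w"
proof (rule Bochner_Integration.integrable_bound[OF q_integrable])
  show "AE x in torus. norm (w x) \<le> norm (q x)" using AE_u
  proof eventually_elim
    case (elim x)
    have r2: "(u x)\<^sup>2 < 1" using elim by (simp add: abs_square_less_1)
    have "w x = 1 / (2 * pi) * (1 - (u x)\<^sup>2) powr (- (1 / 2))"
      using r2 by (simp add: w_def powr_half_sqrt powr_minus_divide)
    also have "\<dots> \<le> 1 * (1 - (u x)\<^sup>2) powr (- (3 / 4))"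
      using r2 pi_ge_two by (intro mult_mono powr_mono') auto
    finally have "w x \<le> q x" by (simp add: q_def)
    moreover have "w x \<ge> 0" using r2 by (simp add: w_def)
    ultimately show ?case by simp
  qed
qed measurable

text \<open>This is \<open>box_prob_bounds\<close> integrated over the torus; the integrability of
  \<open>w\<close> and \<open>q\<close> keeps both constants finite.\<close>

lemma occ_products:
  assumes "0 < e" "e \<le> \<delta>" "0 < e'" "e' \<le> \<delta>"
  shows "P.expectation (\<lambda>\<omega>. occ e \<omega> * occ e' \<omega>) \<le> 4 * e * e' * (\<integral>x. w x \<partial>torus)"
    and "4 * e * e' * ((\<integral>x. w x \<partial>torus) - sqrt \<delta> * (\<integral>x. q x \<partial>torus)) \<le> P.expectation (\<lambda>\<omega>. occ e \<omega> * occ e' \<omega>)"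
proof -
  have int: "integrable P (\<lambda>\<omega>. occ e \<omega> * occ e' \<omega>)"
  proof (rule P.integrable_const_bound[of _ 1])
    have "occ e \<omega> * occ e' \<omega> \<le> 1" for \<omega> using occ_nonneg occ_le_1 by (intro mult_le_one) auto
    then show "AE \<omega> in P. norm (occ e \<omega> * occ e' \<omega>) \<le> 1" using occ_nonneg by simp
  qed measurable
  have nn: "P.expectation (\<lambda>\<omega>. occ e \<omega> * occ e' \<omega>) \<ge> 0" using occ_nonneg by (intro integral_nonneg_AE) auto
  have eq: "ennreal (P.expectation (\<lambda>\<omega>. occ e \<omega> * occ e' \<omega>)) = (\<integral>\<^sup>+x. box_prob e e' (u x) \<partial>torus)"
    unfolding occ_correlation[symmetric] using int occ_nonneg by (intro nn_integral_eq_integral[symmetric]) auto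
  have w0: "AE x in torus. 0 \<le> w x" using AE_u by eventually_elim (simp add: w_def abs_square_le_1 less_imp_le)
  have "(\<integral>\<^sup>+x. box_prob e e' (u x) \<partial>torus) \<le> (\<integral>\<^sup>+x. ennreal (4 * e * e' * w x) \<partial>torus)"
  proof (rule nn_integral_mono_AE)
    show "AE x in torus. box_prob e e' (u x) \<le> ennreal (4 * e * e' * w x)"
      using AE_u by eventually_elim (unfold w_def, rule box_prob_bounds(1)[OF assms])
  qed
  also have "\<dots> = ennreal (\<integral>x. 4 * e * e' * w x \<partial>torus)"
    using w_integrable w0 assms by (intro nn_integral_eq_integral) auto
  also have "(\<integral>x. 4 * e * e' * w x \<partial>torus) = 4 * e * e' * (\<integral>x. w x \<partial>torus)" by simp
  finally have "ennreal (P.expectation (\<lambda>\<omega>. occ e \<omega> * occ e' \<omega>)) \<le> ennreal (4 * e * e' * (\<integral>x. w x \<partial>torus))"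
    unfolding eq .
  moreover have "(\<integral>x. w x \<partial>torus) \<ge> 0" using w0 by (rule integral_nonneg_AE)
  ultimately show "P.expectation (\<lambda>\<omega>. occ e \<omega> * occ e' \<omega>) \<le> 4 * e * e' * (\<integral>x. w x \<partial>torus)"
    using assms by (subst (asm) ennreal_le_iff) auto
  \<comment> \<open>Near the singular set w - sqrt \<delta> q can be negative, so its integral is
    compared with that of its positive part.\<close>
  have "ennreal (4 * e * e' * ((\<integral>x. w x \<partial>torus) - sqrt \<delta> * (\<integral>x. q x \<partial>torus)))
      = ennreal (\<integral>x. 4 * e * e' * (w x - sqrt \<delta> * q x) \<partial>torus)"
    using w_integrable q_integrable by simp
  also have "\<dots> \<le> (\<integral>\<^sup>+x. ennreal (4 * e * e' * (w x - sqrt \<delta> * q x)) \<partial>torus)"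
    using w_integrable q_integrable by (intro nn_integral_le_real_integral) auto
  also have "\<dots> \<le> (\<integral>\<^sup>+x. box_prob e e' (u x) \<partial>torus)"
  proof (rule nn_integral_mono_AE)
    show "AE x in torus. ennreal (4 * e * e' * (w x - sqrt \<delta> * q x)) \<le> box_prob e e' (u x)"
      using AE_u by eventually_elim (unfold w_def q_def, rule box_prob_bounds(2)[OF assms])
  qed
  finally have "ennreal (4 * e * e' * ((\<integral>x. w x \<partial>torus) - sqrt \<delta> * (\<integral>x. q x \<partial>torus)))
      \<le> ennreal (P.expectation (\<lambda>\<omega>. occ e \<omega> * occ e' \<omega>))" unfolding eq .
  then show "4 * e * e' * ((\<integral>x. w x \<partial>torus) - sqrt \<delta> * (\<integral>x. q x \<partial>torus)) \<le> P.expectation (\<lambda>\<omega>. occ e \<omega> * occ e' \<omega>)"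
    using nn by (subst (asm) ennreal_le_iff) auto
qed

lemma occ_mean:
  assumes "0 < e"
  shows "P.expectation (occ e) \<le> 2 * e * (1 / sqrt (2 * pi))"
    and "2 * e * (1 / sqrt (2 * pi) * (1 - e\<^sup>2 / 2)) \<le> P.expectation (occ e)"
proof -
  have int: "integrable P (occ e)"
    by (rule P.integrable_const_bound[of _ 1]) (use occ_nonneg occ_le_1 in auto)
  have eq: "ennreal (P.expectation (occ e)) = emeasure std_normal {- e<..<e}"
    unfolding occ_expectation[symmetric] using int occ_nonneg by (intro nn_integral_eq_integral[symmetric]) auto
  show "P.expectation (occ e) \<le> 2 * e * (1 / sqrt (2 * pi))"
    using std_normal_interval_bounds(1)[OF assms] assms unfolding eq[symmetric] by (subst (asm) ennreal_le_iff) auto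
  have "P.expectation (occ e) \<ge> 0" using occ_nonneg by (intro integral_nonneg_AE) auto
  then show "2 * e * (1 / sqrt (2 * pi) * (1 - e\<^sup>2 / 2)) \<le> P.expectation (occ e)"
    using std_normal_interval_bounds(2)[OF assms] unfolding eq[symmetric] by (subst (asm) ennreal_le_iff) auto
qed

text \<open>For i \<le> j both meshes are at most \<open>mesh i\<close>, so the lower bound loses at
  most \<open>sqrt (mesh i)\<close> times the integral of \<open>q\<close>; that integral is the
  \<open>K\<close> of \<open>L2_convergence\<close>.\<close>

lemma leray_moments:
  shows "integrable P (\<lambda>\<omega>. leray_measure (f \<omega>))" "integrable P (\<lambda>\<omega>. (leray_measure (f \<omega>))\<^sup>2)"
    "P.expectation (\<lambda>\<omega>. leray_measure (f \<omega>)) = 1 / sqrt (2 * pi)"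
    "P.expectation (\<lambda>\<omega>. (leray_measure (f \<omega>))\<^sup>2) = (\<integral>x. w x \<partial>torus)"
proof -
  define X where "X = (\<lambda>k \<omega>. 1 / (2 * mesh k) * occ (mesh k) \<omega>)"
  have XX: "P.expectation (\<lambda>\<omega>. X i \<omega> * X j \<omega>) = 1 / (4 * mesh i * mesh j) * P.expectation (\<lambda>\<omega>. occ (mesh i) \<omega> * occ (mesh j) \<omega>)" for i j
  proof -
    have "X i \<omega> * X j \<omega> = 1 / (4 * mesh i * mesh j) * (occ (mesh i) \<omega> * occ (mesh j) \<omega>)" for \<omega>
      by (simp add: X_def)
    then show ?thesis by simp
  qed
  have c: "1 / (4 * a * b) * (4 * a * b * z) = z" if "a > 0" "b > 0" for a b z :: real
    using that by simp
  have up: "P.expectation (\<lambda>\<omega>. X i \<omega> * X j \<omega>) \<le> (\<integral>x. w x \<partial>torus)" if "i \<le> j" for i j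
  proof -
    have "P.expectation (\<lambda>\<omega>. X i \<omega> * X j \<omega>) \<le> 1 / (4 * mesh i * mesh j) * (4 * mesh i * mesh j * (\<integral>x. w x \<partial>torus))"
      unfolding XX using mesh_pos[of i] mesh_pos[of j] mesh_antimono[OF that]
      by (intro mult_left_mono occ_products(1)[where \<delta> = "mesh i"]) auto
    then show ?thesis unfolding c[OF mesh_pos mesh_pos] .
  qed
  have low: "(\<integral>x. w x \<partial>torus) - (\<integral>x. q x \<partial>torus) / real (i + 1) ^ 4 \<le> P.expectation (\<lambda>\<omega>. X i \<omega> * X j \<omega>)"
    if "i \<le> j" for i j
  proof -
    have sq: "sqrt (mesh i) = 1 / real (i + 1) ^ 4"
      by (rule real_sqrt_unique) (simp_all add: mesh_def power_divide power_mult[symmetric])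
    have "1 / (4 * mesh i * mesh j) * (4 * mesh i * mesh j * ((\<integral>x. w x \<partial>torus) - sqrt (mesh i) * (\<integral>x. q x \<partial>torus)))
       \<le> P.expectation (\<lambda>\<omega>. X i \<omega> * X j \<omega>)"
      unfolding XX using mesh_pos[of i] mesh_pos[of j] mesh_antimono[OF that]
      by (intro mult_left_mono occ_products(2)) auto
    then show ?thesis unfolding c[OF mesh_pos mesh_pos] sq by simp
  qed
  have mean: "(\<lambda>k. P.expectation (X k)) \<longlonglongrightarrow> 1 / sqrt (2 * pi)"
  proof (rule tendsto_sandwich)
    have EX: "P.expectation (X k) = 1 / (2 * mesh k) * P.expectation (occ (mesh k))" for k
      unfolding X_def by simp
    have c: "1 / (2 * a) * (2 * a * z) = z" if "a > 0" for a z :: real using that by simp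
    have "1 / sqrt (2 * pi) * (1 - (mesh k)\<^sup>2 / 2) \<le> P.expectation (X k)" for k
    proof -
      have "1 / (2 * mesh k) * (2 * mesh k * (1 / sqrt (2 * pi) * (1 - (mesh k)\<^sup>2 / 2))) \<le> P.expectation (X k)"
        unfolding EX using mesh_pos[of k] by (intro mult_left_mono occ_mean(2)) auto
      then show ?thesis unfolding c[OF mesh_pos] .
    qed
    then show "\<forall>\<^sub>F k in sequentially. 1 / sqrt (2 * pi) * (1 - (mesh k)\<^sup>2 / 2) \<le> P.expectation (X k)" by simp
    have "P.expectation (X k) \<le> 1 / sqrt (2 * pi)" for k
    proof -
      have "P.expectation (X k) \<le> 1 / (2 * mesh k) * (2 * mesh k * (1 / sqrt (2 * pi)))"
        unfolding EX using mesh_pos[of k] by (intro mult_left_mono occ_mean(1)) auto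
      then show ?thesis unfolding c[OF mesh_pos] .
    qed
    then show "\<forall>\<^sub>F k in sequentially. P.expectation (X k) \<le> 1 / sqrt (2 * pi)" by simp
    have "(\<lambda>k. 1 / sqrt (2 * pi) * (1 - (mesh k)\<^sup>2 / 2)) \<longlonglongrightarrow> 1 / sqrt (2 * pi) * (1 - 0\<^sup>2 / 2)"
      by (intro tendsto_intros mesh_tendsto) simp
    then show "(\<lambda>k. 1 / sqrt (2 * pi) * (1 - (mesh k)\<^sup>2 / 2)) \<longlonglongrightarrow> 1 / sqrt (2 * pi)" by simp
  qed simp
  have Xm: "X k \<in> borel_measurable P" for k unfolding X_def by measurable
  have Xb: "\<exists>B. \<forall>\<omega>\<in>space P. \<bar>X k \<omega>\<bar> \<le> B" for k
  proof (intro exI ballI)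
    fix \<omega>
    show "\<bar>X k \<omega>\<bar> \<le> 1 / (2 * mesh k) * 1"
      unfolding X_def abs_mult using occ_nonneg[of "mesh k" \<omega>] occ_le_1[of "mesh k" \<omega>] mesh_pos[of k]
      by (intro mult_mono) auto
  qed
  have K: "(\<integral>x. q x \<partial>torus) \<ge> 0" using q_nonneg by (intro integral_nonneg_AE) auto
  show "integrable P (\<lambda>\<omega>. leray_measure (f \<omega>))" "integrable P (\<lambda>\<omega>. (leray_measure (f \<omega>))\<^sup>2)"
    "P.expectation (\<lambda>\<omega>. leray_measure (f \<omega>)) = 1 / sqrt (2 * pi)"
    "P.expectation (\<lambda>\<omega>. (leray_measure (f \<omega>))\<^sup>2) = (\<integral>x. w x \<partial>torus)"
    using P.L2_convergence[OF Xm Xb K up low mean] unfolding leray_measure_eq X_def by blast+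
qed

text \<open>The squared mean 1 / (2 pi) cancels the constant term in the expansion of
  \<open>w\<close>, and the quadratic term integrates to 1 / (4 pi N).\<close>

lemma leray_variance:
  assumes C: "C \<ge> 0" and bound: "(\<integral>\<^sup>+x. ennreal (u x ^ 4) * sing_weight (u x) \<partial>torus) \<le> ennreal C * (\<integral>\<^sup>+x. ennreal (u x ^ 4) \<partial>torus)"
  obtains V where "has_variance P (\<lambda>\<omega>. leray_measure (f \<omega>)) V"
    "\<bar>V - 1 / (4 * pi * real (card L))\<bar> \<le> C * (\<integral>x. u x ^ 4 \<partial>torus)"
proof
  define V where "V = (\<integral>x. w x \<partial>torus) - 1 / (2 * pi)"
  show "has_variance P (\<lambda>\<omega>. leray_measure (f \<omega>)) V"
    unfolding has_variance_def using leray_moments P.variance_eq[OF leray_moments(1,2)]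
    by (simp add: V_def power_divide)
  have ub: "\<bar>u x\<bar> ^ k \<le> 1" for x k using abs_covariance_le_1[of L x] by (intro power_le_one) auto
  have int2: "integrable torus (\<lambda>x. (u x)\<^sup>2)"
    by (rule bounded_integrable_torus[of _ 1]) (use ub[of _ 2] in \<open>auto simp: power_abs\<close>)
  have int4: "integrable torus (\<lambda>x. u x ^ 4)"
    by (rule bounded_integrable_torus[of _ 1]) (use ub[of _ 4] in \<open>auto simp: power_abs\<close>)
  have int4q: "integrable torus (\<lambda>x. u x ^ 4 * q x)"
  proof (rule Bochner_Integration.integrable_bound[OF q_integrable])
    have "u x ^ 4 * q x \<le> 1 * q x" for x using ub[of x 4] q_nonneg[of x] by (intro mult_right_mono) auto
    then show "AE x in torus. norm (u x ^ 4 * q x) \<le> norm (q x)" using q_nonneg by simp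
  qed measurable
  \<comment> \<open>The remainder of \<open>w\<close> beyond the quadratic term. It is nonnegative
    almost everywhere, so the error of the variance is the integral of \<open>D\<close> and only an
    upper bound is left to prove.\<close>
  define D where "D = (\<lambda>x. w x - 1 / (2 * pi) - (u x)\<^sup>2 / (4 * pi))"
  have D: "D x = 1 / (2 * pi) * (1 / sqrt (1 - (u x)\<^sup>2) - 1 - (u x)\<^sup>2 / 2)" for x
    by (simp add: D_def w_def algebra_simps)
  have Dint: "integrable torus D" unfolding D_def using w_integrable int2 by auto
  have D0: "AE x in torus. 0 \<le> D x"
    using AE_u by eventually_elim (use inverse_sqrt_expansion(1) in \<open>auto simp: D\<close>)
  have D1: "AE x in torus. D x \<le> u x ^ 4 * q x"
    using AE_u
  proof eventually_elim
    case (elim x)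
    have "D x \<le> 1 / (2 * pi) * (3 / 2 * u x ^ 4 * q x)"
      unfolding D q_def by (intro mult_left_mono inverse_sqrt_expansion(2) elim) auto
    also have "\<dots> = 3 / (4 * pi) * (u x ^ 4 * q x)" by simp
    also have "\<dots> \<le> 1 * (u x ^ 4 * q x)" using q_nonneg[of x] pi_ge_two by (intro mult_right_mono) auto
    finally show ?case by simp
  qed
  have "V - 1 / (4 * pi * real (card L)) = (\<integral>x. D x \<partial>torus)"
  proof -
    have "(\<integral>x. D x \<partial>torus) = (\<integral>x. w x \<partial>torus) - 1 / (2 * pi) - (\<integral>x. (u x)\<^sup>2 \<partial>torus) / (4 * pi)"
      unfolding D_def using w_integrable int2 T.prob_space by simp
    also have "(\<integral>x. (u x)\<^sup>2 \<partial>torus) = 1 / real (card L)"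
      by (rule integral_covariance_power2[OF fin ne sym_L L_integer])
    finally show ?thesis by (simp add: V_def)
  qed
  moreover have "0 \<le> (\<integral>x. D x \<partial>torus)" by (rule integral_nonneg_AE[OF D0])
  moreover have "(\<integral>x. D x \<partial>torus) \<le> (\<integral>x. u x ^ 4 * q x \<partial>torus)" by (rule integral_mono_AE[OF Dint int4q D1])
  moreover have "(\<integral>x. u x ^ 4 * q x \<partial>torus) \<le> C * (\<integral>x. u x ^ 4 \<partial>torus)"
  proof -
    have "ennreal (\<integral>x. u x ^ 4 * q x \<partial>torus) = (\<integral>\<^sup>+x. ennreal (u x ^ 4 * q x) \<partial>torus)"
      using int4q q_nonneg by (intro nn_integral_eq_integral[symmetric]) auto
    also have "\<dots> \<le> (\<integral>\<^sup>+x. ennreal (u x ^ 4) * sing_weight (u x) \<partial>torus)"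
      using ennreal_q_le q_nonneg by (intro nn_integral_mono) (simp add: ennreal_mult mult_left_mono)
    also have "\<dots> \<le> ennreal C * (\<integral>\<^sup>+x. ennreal (u x ^ 4) \<partial>torus)" by (rule bound)
    also have "(\<integral>\<^sup>+x. ennreal (u x ^ 4) \<partial>torus) = ennreal (\<integral>x. u x ^ 4 \<partial>torus)"
      using int4 by (intro nn_integral_eq_integral) auto
    also have "ennreal C * ennreal (\<integral>x. u x ^ 4 \<partial>torus) = ennreal (C * (\<integral>x. u x ^ 4 \<partial>torus))"
      using C by (intro ennreal_mult[symmetric]) auto
    finally show ?thesis using C by (subst (asm) ennreal_le_iff) auto
  qed
  ultimately show "\<bar>V - 1 / (4 * pi * real (card L))\<bar> \<le> C * (\<integral>x. u x ^ 4 \<partial>torus)" by linarith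
qed

end

text \<open>\<open>C\<close> depends on the dimension only: the singular estimates are uniform in E.
  The first discharges the assumption of the locale, the second bounds the error.\<close>

lemma leray_variance_additive_energy:
  assumes d: "CARD('n::finite) \<ge> 2"
  obtains C where "C > 0"
    "\<And>E (R :: (real ^ 'n) set). E \<ge> 1 \<Longrightarrow> card (frequencies E :: (real ^ 'n) set) > 0 \<Longrightarrow> half_system (frequencies E) R \<Longrightarrow>
      \<exists>V. has_variance (coeff_space R) (\<lambda>\<omega>. leray_measure (eigenfunction E R \<omega>)) V \<and>
        \<bar>V - 1 / (4 * pi * real (card (frequencies E :: (real ^ 'n) set)))\<bar> \<le>
          C * (real (additive_energy (frequencies E :: (real ^ 'n) set)) / real (card (frequencies E :: (real ^ 'n) set)) ^ 4)"
proof -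
  obtain C where C: "C > 0"
    "\<And>E. E \<ge> 1 \<Longrightarrow> finite (frequencies E :: (real ^ 'n) set) \<Longrightarrow> (frequencies E :: (real ^ 'n) set) \<noteq> {} \<Longrightarrow>
      (\<integral>\<^sup>+x. sing_weight (covariance (frequencies E :: (real ^ 'n) set) x) \<partial>torus) \<le> ennreal C"
    "\<And>E. E \<ge> 1 \<Longrightarrow> finite (frequencies E :: (real ^ 'n) set) \<Longrightarrow> (frequencies E :: (real ^ 'n) set) \<noteq> {} \<Longrightarrow>
      (\<integral>\<^sup>+x. ennreal (covariance (frequencies E :: (real ^ 'n) set) x ^ 4) * sing_weight (covariance (frequencies E) x) \<partial>torus)
        \<le> ennreal C * (\<integral>\<^sup>+x. ennreal (covariance (frequencies E :: (real ^ 'n) set) x ^ 4) \<partial>torus)"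
    by (rule covariance_sing_weight_bound[OF d], rule that)
  show ?thesis
  proof (rule that[OF C(1)])
    fix E :: nat and R :: "(real ^ 'n) set"
    assume E: "E \<ge> 1" and N: "card (frequencies E :: (real ^ 'n) set) > 0" and hs: "half_system (frequencies E) R"
    have fin: "finite (frequencies E :: (real ^ 'n) set)" and ne: "(frequencies E :: (real ^ 'n) set) \<noteq> {}"
      using N by (auto simp: card_gt_0_iff)
    interpret random_wave E R
    proof
      show "(\<integral>\<^sup>+x. sing_weight (covariance (frequencies E :: (real ^ 'n) set) x) \<partial>torus) < \<infinity>"
        using C(2)[OF E fin ne] by (simp add: le_less_trans)
    qed (fact E fin ne hs)+
    obtain V where V: "has_variance P (\<lambda>\<omega>. leray_measure (f \<omega>)) V"
      "\<bar>V - 1 / (4 * pi * real (card L))\<bar> \<le> C * (\<integral>x. u x ^ 4 \<partial>torus)"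
      using leray_variance[OF _ C(3)[OF E fin ne]] C(1) by (metis less_imp_le)
    then show "\<exists>V. has_variance (coeff_space R) (\<lambda>\<omega>. leray_measure (eigenfunction E R \<omega>)) V \<and>
        \<bar>V - 1 / (4 * pi * real (card (frequencies E :: (real ^ 'n) set)))\<bar> \<le>
          C * (real (additive_energy (frequencies E :: (real ^ 'n) set)) / real (card (frequencies E :: (real ^ 'n) set)) ^ 4)"
      unfolding integral_covariance_power4[OF fin sym_L L_integer] by blast
  qed
qed

text \<open>A floor converts the real bound into the natural number that the count works with, and
  \<open>max 0\<close> admits any real \<open>B\<close>. The 1 stems from the pairs with a + b =
  0.\<close>

lemma energy_ratio_le:
  fixes L :: "(real ^ 'n) set" and B :: real
  assumes N: "card L > 0"
    and B: "\<And>v. v \<noteq> 0 \<Longrightarrow> real (card {l\<in>L. v - l \<in> L}) \<le> B"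
  shows "real (additive_energy L) / real (card L) ^ 4
    \<le> (1 + max 0 B) / (real (card L))\<^sup>2"
proof -
  have fin: "finite L" using N by (simp add: card_gt_0_iff)
  define M where "M = nat \<lfloor>max 0 B\<rfloor>"
  have M: "card {l\<in>L. v - l \<in> L} \<le> M" if "v \<noteq> 0" for v
    unfolding M_def using B[OF that] by (intro le_nat_floor) simp
  have "real (additive_energy L) \<le> real ((1 + M) * (card L)\<^sup>2)"
    by (rule of_nat_mono, rule additive_energy_le[OF fin M])
  also have "\<dots> = (1 + real M) * (real (card L))\<^sup>2" by (simp add: distrib_right)
  also have "\<dots> \<le> (1 + max 0 B) * (real (card L))\<^sup>2"
    unfolding M_def by (intro mult_right_mono add_left_mono of_nat_floor) auto
  finally have "real (additive_energy L) / real (card L) ^ 4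
    \<le> (1 + max 0 B) * (real (card L))\<^sup>2 / real (card L) ^ 4" by (rule divide_right_mono) simp
  also have "\<dots> = (1 + max 0 B) / (real (card L))\<^sup>2" using N by (simp add: eval_nat_numeral)
  finally show ?thesis .
qed

theorem mainTheorem2:
  shows
    "(CARD('n::finite) = 2 \<longrightarrow>
       (\<exists>C. \<forall>E\<ge>1. \<forall>R :: (real ^ 'n) set.
          let N = card (frequencies E :: (real ^ 'n) set) in
          N > 3 ^ CARD('n) \<and> half_system (frequencies E) R \<longrightarrow>
          (\<exists>V. has_variance (coeff_space R) (\<lambda>\<omega>. leray_measure (eigenfunction E R \<omega>)) V \<and>
               \<bar>V - 1 / (4 * pi * real N)\<bar> \<le> C * (1 / (real N)\<^sup>2))))
     \<and>
     (CARD('n) \<ge> 3 \<longrightarrow>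
       (\<forall>\<epsilon>>0. \<exists>C. \<forall>E\<ge>1. \<forall>R :: (real ^ 'n) set.
          let N = card (frequencies E :: (real ^ 'n) set) in
          N > 3 ^ CARD('n) \<and> half_system (frequencies E) R \<longrightarrow>
          (\<exists>V. has_variance (coeff_space R) (\<lambda>\<omega>. leray_measure (eigenfunction E R \<omega>)) V \<and>
               \<bar>V - 1 / (4 * pi * real N)\<bar> \<le>
                 C * (real E powr ((real CARD('n) - 3) / 2 + \<epsilon>) / (real N)\<^sup>2))))
     \<and>
     (CARD('n) \<ge> 2 \<longrightarrow>
       (\<exists>C. \<forall>E\<ge>1. \<forall>R :: (real ^ 'n) set.
          let N = card (frequencies E :: (real ^ 'n) set) in
          N > 3 ^ CARD('n) \<and> half_system (frequencies E) R \<longrightarrow>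
          (\<exists>V. has_variance (coeff_space R) (\<lambda>\<omega>. leray_measure (eigenfunction E R \<omega>)) V \<and>
               \<bar>V\<bar> \<le> C * (1 / real N))))"
proof (intro conjI impI)
  assume d: "CARD('n) = 2"
  then have d2: "CARD('n) \<ge> 2" by simp
  obtain C where C: "C > 0"
    "\<And>E (R :: (real ^ 'n) set). E \<ge> 1 \<Longrightarrow> card (frequencies E :: (real ^ 'n) set) > 0 \<Longrightarrow> half_system (frequencies E) R \<Longrightarrow>
      \<exists>V. has_variance (coeff_space R) (\<lambda>\<omega>. leray_measure (eigenfunction E R \<omega>)) V \<and>
        \<bar>V - 1 / (4 * pi * real (card (frequencies E :: (real ^ 'n) set)))\<bar> \<le>
          C * (real (additive_energy (frequencies E :: (real ^ 'n) set)) / real (card (frequencies E :: (real ^ 'n) set)) ^ 4)"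
    by (rule leray_variance_additive_energy[OF d2], rule that)
  show "\<exists>C. \<forall>E\<ge>1. \<forall>R :: (real ^ 'n) set.
      let N = card (frequencies E :: (real ^ 'n) set) in
      N > 3 ^ CARD('n) \<and> half_system (frequencies E) R \<longrightarrow>
      (\<exists>V. has_variance (coeff_space R) (\<lambda>\<omega>. leray_measure (eigenfunction E R \<omega>)) V \<and>
           \<bar>V - 1 / (4 * pi * real N)\<bar> \<le> C * (1 / (real N)\<^sup>2))"
    unfolding Let_def
  proof (rule exI[of _ "3 * C"], intro allI impI, elim conjE)
    fix E :: nat and R :: "(real ^ 'n) set"
    assume E: "1 \<le> E" and N: "3 ^ CARD('n) < card (frequencies E :: (real ^ 'n) set)" and hs: "half_system (frequencies E) R"
    have N0: "card (frequencies E :: (real ^ 'n) set) > 0" using N by (rule le_less_trans[OF le0])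
    \<comment> \<open>At most two completions, together with the 1 for a + b = 0, make the factor
      3.\<close>
    have "real (card {l\<in>frequencies E. v - l \<in> frequencies E}) \<le> 2" if "v \<noteq> 0" for v :: "real ^ 'n"
      using card_frequencies_difference_planar[OF d that, of E] by simp
    from mult_left_mono[OF energy_ratio_le[OF N0 this] less_imp_le[OF C(1)]] C(2)[OF E N0 hs]
    show "\<exists>V. has_variance (coeff_space R) (\<lambda>\<omega>. leray_measure (eigenfunction E R \<omega>)) V \<and>
           \<bar>V - 1 / (4 * pi * real (card (frequencies E :: (real ^ 'n) set)))\<bar>
             \<le> 3 * C * (1 / (real (card (frequencies E :: (real ^ 'n) set)))\<^sup>2)"
      by (auto simp: mult.commute intro: order_trans)
  qed
next
  assume d: "3 \<le> CARD('n)"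
  then have d2: "CARD('n) \<ge> 2" by simp
  obtain C where C: "C > 0"
    "\<And>E (R :: (real ^ 'n) set). E \<ge> 1 \<Longrightarrow> card (frequencies E :: (real ^ 'n) set) > 0 \<Longrightarrow> half_system (frequencies E) R \<Longrightarrow>
      \<exists>V. has_variance (coeff_space R) (\<lambda>\<omega>. leray_measure (eigenfunction E R \<omega>)) V \<and>
        \<bar>V - 1 / (4 * pi * real (card (frequencies E :: (real ^ 'n) set)))\<bar> \<le>
          C * (real (additive_energy (frequencies E :: (real ^ 'n) set)) / real (card (frequencies E :: (real ^ 'n) set)) ^ 4)"
    by (rule leray_variance_additive_energy[OF d2], rule that)
  show "\<forall>\<epsilon>>0. \<exists>C. \<forall>E\<ge>1. \<forall>R :: (real ^ 'n) set.
      let N = card (frequencies E :: (real ^ 'n) set) in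
      N > 3 ^ CARD('n) \<and> half_system (frequencies E) R \<longrightarrow>
      (\<exists>V. has_variance (coeff_space R) (\<lambda>\<omega>. leray_measure (eigenfunction E R \<omega>)) V \<and>
           \<bar>V - 1 / (4 * pi * real N)\<bar> \<le> C * (real E powr ((real CARD('n) - 3) / 2 + \<epsilon>) / (real N)\<^sup>2))"
    unfolding Let_def
  proof (intro allI impI)
    fix \<epsilon> :: real assume \<epsilon>: "0 < \<epsilon>"
    obtain B where B: "B > 0"
      "\<And>E (v :: real ^ 'n). E \<ge> 1 \<Longrightarrow> v \<noteq> 0 \<Longrightarrow>
         real (card {l\<in>frequencies E. v - l \<in> frequencies E}) \<le> B * real E powr ((real CARD('n) - 3) / 2 + \<epsilon>)"
      by (rule card_frequencies_difference_le[OF \<epsilon> d], rule that)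
    show "\<exists>C. \<forall>E\<ge>1. \<forall>R :: (real ^ 'n) set. 3 ^ CARD('n) < card (frequencies E :: (real ^ 'n) set) \<and> half_system (frequencies E) R \<longrightarrow>
      (\<exists>V. has_variance (coeff_space R) (\<lambda>\<omega>. leray_measure (eigenfunction E R \<omega>)) V \<and>
           \<bar>V - 1 / (4 * pi * real (card (frequencies E :: (real ^ 'n) set)))\<bar>
             \<le> C * (real E powr ((real CARD('n) - 3) / 2 + \<epsilon>) / (real (card (frequencies E :: (real ^ 'n) set)))\<^sup>2))"
    proof (rule exI[of _ "C * (1 + B)"], intro allI impI, elim conjE)
      fix E :: nat and R :: "(real ^ 'n) set"
      assume E: "1 \<le> E" and N: "3 ^ CARD('n) < card (frequencies E :: (real ^ 'n) set)" and hs: "half_system (frequencies E) R"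
      let ?N = "real (card (frequencies E :: (real ^ 'n) set))" and ?X = "real E powr ((real CARD('n) - 3) / 2 + \<epsilon>)"
      have N0: "card (frequencies E :: (real ^ 'n) set) > 0" using N by (rule le_less_trans[OF le0])
      \<comment> \<open>The exponent is positive for d \<ge> 3, so the 1 from the pairs with zero
        sum is absorbed into the factor 1 + B.\<close>
      have X1: "?X \<ge> 1" using E d \<epsilon> by (intro ge_one_powr_ge_zero) auto
      have "C * ((1 + max 0 (B * ?X)) / ?N\<^sup>2) \<le> C * ((1 + B) * ?X / ?N\<^sup>2)"
        using X1 B(1) C(1) by (intro mult_left_mono divide_right_mono) (auto simp: algebra_simps)
      also have "\<dots> = C * (1 + B) * (?X / ?N\<^sup>2)" by simp
      finally have le: "C * ((1 + max 0 (B * ?X)) / ?N\<^sup>2) \<le> C * (1 + B) * (?X / ?N\<^sup>2)" .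
      from order_trans[OF mult_left_mono[OF energy_ratio_le[OF N0 B(2)[OF E]] less_imp_le[OF C(1)]] le] C(2)[OF E N0 hs]
      show "\<exists>V. has_variance (coeff_space R) (\<lambda>\<omega>. leray_measure (eigenfunction E R \<omega>)) V \<and>
           \<bar>V - 1 / (4 * pi * ?N)\<bar> \<le> C * (1 + B) * (?X / ?N\<^sup>2)"
        by (meson order_trans)
    qed
  qed
next
  assume d: "2 \<le> CARD('n)"
  obtain C where C: "C > 0"
    "\<And>E (R :: (real ^ 'n) set). E \<ge> 1 \<Longrightarrow> card (frequencies E :: (real ^ 'n) set) > 0 \<Longrightarrow> half_system (frequencies E) R \<Longrightarrow>
      \<exists>V. has_variance (coeff_space R) (\<lambda>\<omega>. leray_measure (eigenfunction E R \<omega>)) V \<and>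
        \<bar>V - 1 / (4 * pi * real (card (frequencies E :: (real ^ 'n) set)))\<bar> \<le>
          C * (real (additive_energy (frequencies E :: (real ^ 'n) set)) / real (card (frequencies E :: (real ^ 'n) set)) ^ 4)"
    by (rule leray_variance_additive_energy[OF d], rule that)
  show "\<exists>C. \<forall>E\<ge>1. \<forall>R :: (real ^ 'n) set.
      let N = card (frequencies E :: (real ^ 'n) set) in
      N > 3 ^ CARD('n) \<and> half_system (frequencies E) R \<longrightarrow>
      (\<exists>V. has_variance (coeff_space R) (\<lambda>\<omega>. leray_measure (eigenfunction E R \<omega>)) V \<and> \<bar>V\<bar> \<le> C * (1 / real N))"
    unfolding Let_def
  proof (rule exI[of _ "1 + 2 * C"], intro allI impI, elim conjE)
    fix E :: nat and R :: "(real ^ 'n) set"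
    assume E: "1 \<le> E" and N: "3 ^ CARD('n) < card (frequencies E :: (real ^ 'n) set)" and hs: "half_system (frequencies E) R"
    let ?N = "real (card (frequencies E :: (real ^ 'n) set))"
    have N0: "card (frequencies E :: (real ^ 'n) set) > 0" using N by (rule le_less_trans[OF le0])
    have fin: "finite (frequencies E :: (real ^ 'n) set)" using N0 by (simp add: card_gt_0_iff)
    \<comment> \<open>The trivial count: with at most N completions the energy ratio is at most 2 /
      N, the same order as the main term.\<close>
    have "real (card {l\<in>frequencies E. v - l \<in> frequencies E}) \<le> ?N" for v :: "real ^ 'n"
      using fin by (intro of_nat_mono card_mono) auto
    note energy_ratio_le[OF N0 this]
    also have "(1 + max 0 ?N) / ?N\<^sup>2 \<le> (2 * ?N) / ?N\<^sup>2" using N0 by (intro divide_right_mono) auto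
    also have "\<dots> = 2 / ?N" by (simp add: power2_eq_square)
    finally have "C * (real (additive_energy (frequencies E :: (real ^ 'n) set)) / ?N ^ 4) \<le> C * (2 / ?N)"
      using C(1) by (intro mult_left_mono) auto
    then obtain V where V: "has_variance (coeff_space R) (\<lambda>\<omega>. leray_measure (eigenfunction E R \<omega>)) V"
      "\<bar>V - 1 / (4 * pi * ?N)\<bar> \<le> C * (2 / ?N)"
      using C(2)[OF E N0 hs] by (meson order_trans)
    have "1 / (4 * pi * ?N) \<le> 1 / (1 * ?N)"
      using N0 pi_ge_two by (intro divide_left_mono mult_right_mono) auto
    moreover have "1 / (4 * pi * ?N) \<ge> 0" by simp
    ultimately have "\<bar>V\<bar> \<le> 1 / ?N + C * (2 / ?N)" using V(2) by linarith
    also have "\<dots> = (1 + 2 * C) * (1 / ?N)" by (simp add: algebra_simps add_divide_distrib)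
    finally show "\<exists>V. has_variance (coeff_space R) (\<lambda>\<omega>. leray_measure (eigenfunction E R \<omega>)) V \<and> \<bar>V\<bar> \<le> (1 + 2 * C) * (1 / ?N)"
      using V(1) by blast
  qed
qed

end
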